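(* Let $L=(\Sigma,\Gamma,d)$ be a simple structural law on a locally finitely presentable category $\mathbf{C}$, let $S=\Sigma^*$, let $T$ be the free monad on the endofunctor $X\mapsto\Gamma(X,SX)$, and equip $ST$ with the composite monad structure given by the distributive law $\delta\colon TS\to ST$ induced by $L$. Then there is an isomorphism of categories over $\mathbf{C}$ (i.e., commuting with the forgetful functors to $\mathbf{C}$) $$L\text{-}\mathbf{alg}\;\cong\;ST\text{-}\mathbf{Alg},$$ where $L\text{-}\mathbf{alg}$ is the category of algebras for $L$ and $ST\text{-}\mathbf{Alg}$ the category of monad algebras of $ST$.
   Context: Simple structural law: a finitary endofunctor $\Sigma$ on $\mathbf{C}$; a functor $\Gamma\colon\mathbf{C}^2\to\mathbf{C}$ cocontinuous in its first argument and finitary in its second; and a natural transformation $d_{X,Y}\colon\Gamma(\Sigma X,Y)\to S(\Gamma(X,SY)+X+Y)$, where $S=\Sigma^*$ is the free monad on $\Sigma$. $\eta_\Sigma\colon\Sigma\to S$ is the canonical transformation; $\eta^M,\mu^M$ are unit and multiplication of a monad $M$. Algebras for $L$: an object $X$ with morphisms $\mathbf{a}\colon\Sigma X\to X$ and $\mathbf{b}\colon\Gamma(X,X)\to X$ such that $$\mathbf{b}\circ\Gamma(\mathbf{a},X)=\bar{\mathbf{a}}\circ S[\mathbf{b},\mathrm{id}_X,\mathrm{id}_X]\circ S(\Gamma(X,\bar{\mathbf{a}})+X+X)\circ d_{X,X}\colon\ \Gamma(\Sigma X,X)\to X,$$ where $\bar{\mathbf{a}}\colon SX\to X$ is the $S$-algebra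 freely induced by $\mathbf{a}$. A morphism of $L$-algebras is a morphism of underlying objects which is both a morphism of $\Sigma$-algebras and of $\Gamma\Delta$-algebras (for $\Gamma\Delta\colon X\mapsto\Gamma(X,X)$). The induced distributive law $\delta$: For each object $Y$, let $L_Y=\Gamma(-,SY)+(-)$, a cocontinuous endofunctor of $\mathbf{C}$, with right adjoint $R_Y$. Let $K_Y=S(-+Y)$, a monad with unit $A\to A+Y\to S(A+Y)$ and multiplication $S(S(A+Y)+Y)\to SS(A+Y)\to S(A+Y)$, given by $S[\mathrm{id},\eta^S_{A+Y}\circ in_2]$ followed by $\mu^S$. Then $R_YK_YL_Y$ is a monad via the adjunction. Define $h_{X,Y}\colon L_Y\Sigma X\to K_YL_YX=S(\Gamma(X,SY)+X+Y)$: on the summand $\Sigma X$ it is $\Sigma X\xrightarrow{\eta_\Sigma}SX\xrightarrow{S in_2}S(\Gamma(X,SY)+X+Y)$; on the summand $\Gamma(\Sigma X,SY)$ it is the composite of $d_{X,SY}\colon\Gamma(\Sigma X,SY)\to S(A+SY)$, where $A=\Gamma(X,SSY)+X$, then $S[\eta^S_{A+Y}\circ in_1,\,S in_2]\colon S(A+SY)\to SS(A+Y)$, then $\mu^S_{A+Y}$, then $S(\Gamma(X,\mu^S_Y)+X+Y)$. For fixed $Y$, the transposes $\Sigma X\to R_YK_YL_YX$ of $h_{X,Y}$ extend to a unique monad morphism $S\to R_YK_YL_Y$; transposing it back yields $L_YSX\to K_YL_YX$, and restricting to the first summand yields $\hat d_{X,Y}\colon\Gamma(SX,SY)\to S(\Gamma(X,SY)+X+Y)$.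 A $T$-algebra is the same as an object $X$ with a morphism $\mathbf{c}\colon\Gamma(X,SX)\to X$; given such, $SX$ gets the structure $$\Gamma(SX,SSX)\xrightarrow{\Gamma(SX,\mu^S_X)}\Gamma(SX,SX)\xrightarrow{\hat d_{X,X}}S(\Gamma(X,SX)+X+X)\xrightarrow{S[\mathbf{c},\mathrm{id},\mathrm{id}]}SX .$$ This lifts the monad $S$ to $T\text{-}\mathbf{Alg}$, and $\delta$ is the distributive law corresponding to this lifting by Beck's theorem: $\delta_X$ is $TS\eta^T_X\colon TSX\to TSTX$ followed by the $T$-algebra structure $TSTX\to STX$ of the lifting applied to the free algebra $TX$. *)

theory Defs
  imports Main
begin

text \<open>Categories are given by a set of objects and a set of morphisms; all structure is only
  constrained on these carriers.\<close>

record ('o, 'm) cat =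
  Ob :: "'o set"
  Mor :: "'m set"
  Dom :: "'m \<Rightarrow> 'o"
  Cod :: "'m \<Rightarrow> 'o"
  Ide :: "'o \<Rightarrow> 'm"
  Cmp :: "'m \<Rightarrow> 'm \<Rightarrow> 'm"  (infixr "\<cdot>\<index>" 75)

definition hom :: "('o, 'm) cat \<Rightarrow> 'o \<Rightarrow> 'o \<Rightarrow> 'm set" where
  "hom C X Y = {f \<in> Mor C. Dom C f = X \<and> Cod C f = Y}"

definition category :: "('o, 'm) cat \<Rightarrow> bool" where
  "category C \<longleftrightarrow>
     (\<forall>f\<in>Mor C. Dom C f \<in> Ob C \<and> Cod C f \<in> Ob C) \<and>
     (\<forall>X\<in>Ob C. Ide C X \<in> hom C X X) \<and>
     (\<forall>X Y Z. \<forall>f\<in>hom C X Y. \<forall>g\<in>hom C Y Z. g \<cdot>\<^bsub>C\<^esub> f \<in> hom C X Z) \<and>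
     (\<forall>X Y. \<forall>f\<in>hom C X Y. f \<cdot>\<^bsub>C\<^esub> Ide C X = f \<and> Ide C Y \<cdot>\<^bsub>C\<^esub> f = f) \<and>
     (\<forall>W X Y Z. \<forall>f\<in>hom C W X. \<forall>g\<in>hom C X Y. \<forall>h\<in>hom C Y Z.
        (h \<cdot>\<^bsub>C\<^esub> g) \<cdot>\<^bsub>C\<^esub> f = h \<cdot>\<^bsub>C\<^esub> (g \<cdot>\<^bsub>C\<^esub> f))"

definition prod_cat :: "('o, 'm) cat \<Rightarrow> ('p, 'n) cat \<Rightarrow> ('o \<times> 'p, 'm \<times> 'n) cat" where
  "prod_cat C D =
     \<lparr>Ob = Ob C \<times> Ob D, Mor = Mor C \<times> Mor D,
      Dom = (\<lambda>(f, g). (Dom C f, Dom D g)), Cod = (\<lambda>(f, g). (Cod C f, Cod D g)),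
      Ide = (\<lambda>(X, Y). (Ide C X, Ide D Y)),
      Cmp = (\<lambda>(f', g') (f, g). (f' \<cdot>\<^bsub>C\<^esub> f, g' \<cdot>\<^bsub>D\<^esub> g))\<rparr>"


subsection \<open>Functors, natural transformations, adjunctions\<close>

record ('o, 'm, 'p, 'n) func =
  omap :: "'o \<Rightarrow> 'p"
  amap :: "'m \<Rightarrow> 'n"

definition is_functor ::
  "('o, 'm) cat \<Rightarrow> ('p, 'n) cat \<Rightarrow> ('o, 'm, 'p, 'n, 'z) func_scheme \<Rightarrow> bool" where
  "is_functor C D F \<longleftrightarrow>
     (\<forall>X\<in>Ob C. omap F X \<in> Ob D) \<and>
     (\<forall>X Y. \<forall>f\<in>hom C X Y. amap F f \<in> hom D (omap F X) (omap F Y)) \<and>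
     (\<forall>X\<in>Ob C. amap F (Ide C X) = Ide D (omap F X)) \<and>
     (\<forall>X Y Z. \<forall>f\<in>hom C X Y. \<forall>g\<in>hom C Y Z.
        amap F (g \<cdot>\<^bsub>C\<^esub> f) = amap F g \<cdot>\<^bsub>D\<^esub> amap F f)"

definition id_func :: "('o, 'm, 'o, 'm) func" where
  "id_func = \<lparr>omap = (\<lambda>X. X), amap = (\<lambda>f. f)\<rparr>"

definition func_comp ::
  "('p, 'n, 'q, 'k, 'y) func_scheme \<Rightarrow> ('o, 'm, 'p, 'n, 'z) func_scheme \<Rightarrow> ('o, 'm, 'q, 'k) func" where
  "func_comp G F = \<lparr>omap = (\<lambda>X. omap G (omap F X)), amap = (\<lambda>f. amap G (amap F f))\<rparr>"

definition nat_trans ::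
  "('o, 'm) cat \<Rightarrow> ('p, 'n) cat \<Rightarrow> ('o, 'm, 'p, 'n, 'y) func_scheme \<Rightarrow>
   ('o, 'm, 'p, 'n, 'z) func_scheme \<Rightarrow> ('o \<Rightarrow> 'n) \<Rightarrow> bool" where
  "nat_trans C D F G t \<longleftrightarrow>
     (\<forall>X\<in>Ob C. t X \<in> hom D (omap F X) (omap G X)) \<and>
     (\<forall>X Y. \<forall>f\<in>hom C X Y. t Y \<cdot>\<^bsub>D\<^esub> amap F f = amap G f \<cdot>\<^bsub>D\<^esub> t X)"

definition adjunction ::
  "('o, 'm) cat \<Rightarrow> ('p, 'n) cat \<Rightarrow> ('o, 'm, 'p, 'n) func \<Rightarrow> ('p, 'n, 'o, 'm) func \<Rightarrow>
   ('o \<Rightarrow> 'm) \<Rightarrow> ('p \<Rightarrow> 'n) \<Rightarrow> bool" where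
  "adjunction C D L R u v \<longleftrightarrow>
     is_functor C D L \<and> is_functor D C R \<and>
     nat_trans C C id_func (func_comp R L) u \<and>
     nat_trans D D (func_comp L R) id_func v \<and>
     (\<forall>X\<in>Ob C. v (omap L X) \<cdot>\<^bsub>D\<^esub> amap L (u X) = Ide D (omap L X)) \<and>
     (\<forall>Y\<in>Ob D. amap R (v Y) \<cdot>\<^bsub>C\<^esub> u (omap R Y) = Ide C (omap R Y))"


subsection \<open>Colimits and smallness\<close>

text \<open>Smallness is relative to a type 'u whose cardinality is regular and uncountable: small
  means of cardinality below that of 'u. For an inaccessible cardinality this is smallness in a
  Grothendieck universe, but no closure under power sets is imposed. Every small category is
  isomorphic to one whose objects and morphisms are drawn from 'u.\<close>

definition universe :: "'u itself \<Rightarrow> bool" where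
  "universe U \<longleftrightarrow>
     regularCard (card_of (UNIV :: 'u set)) \<and> (natLeq, card_of (UNIV :: 'u set)) \<in> ordLess"

definition small :: "'u itself \<Rightarrow> 'x set \<Rightarrow> bool" where
  "small U A \<longleftrightarrow> (card_of A, card_of (UNIV :: 'u set)) \<in> ordLess"

definition small_cat :: "'u itself \<Rightarrow> ('o, 'm) cat \<Rightarrow> bool" where
  "small_cat U J \<longleftrightarrow> category J \<and> small U (Ob J) \<and> small U (Mor J)"

definition filtered :: "('o, 'm) cat \<Rightarrow> bool" where
  "filtered J \<longleftrightarrow>
     Ob J \<noteq> {} \<and>
     (\<forall>i\<in>Ob J. \<forall>j\<in>Ob J. \<exists>k\<in>Ob J. hom J i k \<noteq> {} \<and> hom J j k \<noteq> {}) \<and>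
     (\<forall>i j. \<forall>u\<in>hom J i j. \<forall>v\<in>hom J i j. \<exists>k. \<exists>w\<in>hom J j k. w \<cdot>\<^bsub>J\<^esub> u = w \<cdot>\<^bsub>J\<^esub> v)"

definition cocone ::
  "('i, 'j) cat \<Rightarrow> ('o, 'm) cat \<Rightarrow> ('i, 'j, 'o, 'm) func \<Rightarrow> 'o \<Rightarrow> ('i \<Rightarrow> 'm) \<Rightarrow> bool" where
  "cocone J C D X c \<longleftrightarrow>
     X \<in> Ob C \<and>
     (\<forall>i\<in>Ob J. c i \<in> hom C (omap D i) X) \<and>
     (\<forall>i j. \<forall>u\<in>hom J i j. c j \<cdot>\<^bsub>C\<^esub> amap D u = c i)"

definition colimit ::
  "('i, 'j) cat \<Rightarrow> ('o, 'm) cat \<Rightarrow> ('i, 'j, 'o, 'm) func \<Rightarrow> 'o \<Rightarrow> ('i \<Rightarrow> 'm) \<Rightarrow> bool" where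
  "colimit J C D X c \<longleftrightarrow>
     cocone J C D X c \<and>
     (\<forall>X' c'. cocone J C D X' c' \<longrightarrow> (\<exists>!f. f \<in> hom C X X' \<and> (\<forall>i\<in>Ob J. f \<cdot>\<^bsub>C\<^esub> c i = c' i)))"

definition preserves_colimits ::
  "('i, 'j) cat \<Rightarrow> ('o, 'm) cat \<Rightarrow> ('p, 'n) cat \<Rightarrow> ('o, 'm, 'p, 'n) func \<Rightarrow> bool" where
  "preserves_colimits J C C' F \<longleftrightarrow>
     (\<forall>D X c. is_functor J C D \<and> colimit J C D X c \<longrightarrow>
        colimit J C' (func_comp F D) (omap F X) (\<lambda>i. amap F (c i)))"

definition cocontinuous ::
  "'u itself \<Rightarrow> ('o, 'm) cat \<Rightarrow> ('p, 'n) cat \<Rightarrow> ('o, 'm, 'p, 'n) func \<Rightarrow> bool" where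
  "cocontinuous U C C' F \<longleftrightarrow>
     is_functor C C' F \<and>
     (\<forall>J :: ('u, 'u) cat. small_cat U J \<longrightarrow> preserves_colimits J C C' F)"

definition finitary ::
  "'u itself \<Rightarrow> ('o, 'm) cat \<Rightarrow> ('p, 'n) cat \<Rightarrow> ('o, 'm, 'p, 'n) func \<Rightarrow> bool" where
  "finitary U C C' F \<longleftrightarrow>
     is_functor C C' F \<and>
     (\<forall>J :: ('u, 'u) cat. small_cat U J \<and> filtered J \<longrightarrow> preserves_colimits J C C' F)"

definition cocomplete :: "'u itself \<Rightarrow> ('o, 'm) cat \<Rightarrow> bool" where
  "cocomplete U C \<longleftrightarrow>
     (\<forall>(J :: ('u, 'u) cat) D. small_cat U J \<and> is_functor J C D \<longrightarrow> (\<exists>X c. colimit J C D X c))"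

text \<open>hom(G,-) preserves small filtered colimits, spelled out: each morphism from G into such
  a colimit factors through the diagram, and does so essentially uniquely.\<close>

definition finitely_presentable :: "'u itself \<Rightarrow> ('o, 'm) cat \<Rightarrow> 'o \<Rightarrow> bool" where
  "finitely_presentable U C G \<longleftrightarrow>
     G \<in> Ob C \<and>
     (\<forall>(J :: ('u, 'u) cat) D X c.
        small_cat U J \<and> filtered J \<and> is_functor J C D \<and> colimit J C D X c \<longrightarrow>
        (\<forall>f\<in>hom C G X. \<exists>i\<in>Ob J. \<exists>g\<in>hom C G (omap D i). c i \<cdot>\<^bsub>C\<^esub> g = f) \<and>
        (\<forall>i\<in>Ob J. \<forall>j\<in>Ob J. \<forall>g\<in>hom C G (omap D i). \<forall>g'\<in>hom C G (omap D j).
           c i \<cdot>\<^bsub>C\<^esub> g = c j \<cdot>\<^bsub>C\<^esub> g' \<longrightarrow>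
           (\<exists>k. \<exists>u\<in>hom J i k. \<exists>v\<in>hom J j k. amap D u \<cdot>\<^bsub>C\<^esub> g = amap D v \<cdot>\<^bsub>C\<^esub> g')))"

text \<open>Local smallness is part of the usual convention for categories and hence explicit here.\<close>

definition locally_finitely_presentable :: "'u itself \<Rightarrow> ('o, 'm) cat \<Rightarrow> bool" where
  "locally_finitely_presentable U C \<longleftrightarrow>
     category C \<and>
     (\<forall>X\<in>Ob C. \<forall>Y\<in>Ob C. small U (hom C X Y)) \<and>
     cocomplete U C \<and>
     (\<exists>\<G>. small U \<G> \<and> (\<forall>G\<in>\<G>. finitely_presentable U C G) \<and>
        (\<forall>X\<in>Ob C. \<exists>(J :: ('u, 'u) cat) D c.
           small_cat U J \<and> filtered J \<and> is_functor J C D \<and>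
           (\<forall>i\<in>Ob J. omap D i \<in> \<G>) \<and> colimit J C D X c))"


subsection \<open>Binary coproducts\<close>

definition is_coproduct :: "('o, 'm) cat \<Rightarrow> 'o \<Rightarrow> 'o \<Rightarrow> 'o \<times> 'm \<times> 'm \<Rightarrow> bool" where
  "is_coproduct C X Y = (\<lambda>(P, i, j).
     i \<in> hom C X P \<and> j \<in> hom C Y P \<and>
     (\<forall>Z. \<forall>f\<in>hom C X Z. \<forall>g\<in>hom C Y Z.
        \<exists>!h. h \<in> hom C P Z \<and> h \<cdot>\<^bsub>C\<^esub> i = f \<and> h \<cdot>\<^bsub>C\<^esub> j = g))"

definition coproduct :: "('o, 'm) cat \<Rightarrow> 'o \<Rightarrow> 'o \<Rightarrow> 'o \<times> 'm \<times> 'm" where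
  "coproduct C X Y = (SOME p. is_coproduct C X Y p)"

definition osum :: "('o, 'm) cat \<Rightarrow> 'o \<Rightarrow> 'o \<Rightarrow> 'o"  (infixl "\<oplus>\<index>" 65) where
  "X \<oplus>\<^bsub>C\<^esub> Y = fst (coproduct C X Y)"

definition in1 :: "('o, 'm) cat \<Rightarrow> 'o \<Rightarrow> 'o \<Rightarrow> 'm" where
  "in1 C X Y = fst (snd (coproduct C X Y))"

definition in2 :: "('o, 'm) cat \<Rightarrow> 'o \<Rightarrow> 'o \<Rightarrow> 'm" where
  "in2 C X Y = snd (snd (coproduct C X Y))"

definition copair :: "('o, 'm) cat \<Rightarrow> 'm \<Rightarrow> 'm \<Rightarrow> 'm" where
  "copair C f g =
     (THE h. h \<in> hom C (Dom C f \<oplus>\<^bsub>C\<^esub> Dom C g) (Cod C f) \<and>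
        h \<cdot>\<^bsub>C\<^esub> in1 C (Dom C f) (Dom C g) = f \<and> h \<cdot>\<^bsub>C\<^esub> in2 C (Dom C f) (Dom C g) = g)"

definition msum :: "('o, 'm) cat \<Rightarrow> 'm \<Rightarrow> 'm \<Rightarrow> 'm"  (infixl "\<boxplus>\<index>" 65) where
  "f \<boxplus>\<^bsub>C\<^esub> g =
     copair C (in1 C (Cod C f) (Cod C g) \<cdot>\<^bsub>C\<^esub> f) (in2 C (Cod C f) (Cod C g) \<cdot>\<^bsub>C\<^esub> g)"


subsection \<open>Monads and their algebras\<close>

record ('o, 'm) mnd = "('o, 'm, 'o, 'm) func" +
  Eta :: "'o \<Rightarrow> 'm"
  Mu :: "'o \<Rightarrow> 'm"

definition monad :: "('o, 'm) cat \<Rightarrow> ('o, 'm) mnd \<Rightarrow> bool" where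
  "monad C M \<longleftrightarrow>
     is_functor C C M \<and>
     nat_trans C C id_func M (Eta M) \<and>
     nat_trans C C (func_comp M M) M (Mu M) \<and>
     (\<forall>X\<in>Ob C.
        Mu M X \<cdot>\<^bsub>C\<^esub> Eta M (omap M X) = Ide C (omap M X) \<and>
        Mu M X \<cdot>\<^bsub>C\<^esub> amap M (Eta M X) = Ide C (omap M X) \<and>
        Mu M X \<cdot>\<^bsub>C\<^esub> Mu M (omap M X) = Mu M X \<cdot>\<^bsub>C\<^esub> amap M (Mu M X))"

definition monad_morphism ::
  "('o, 'm) cat \<Rightarrow> ('o, 'm) mnd \<Rightarrow> ('o, 'm) mnd \<Rightarrow> ('o \<Rightarrow> 'm) \<Rightarrow> bool" where
  "monad_morphism C M N p \<longleftrightarrow>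
     nat_trans C C M N p \<and>
     (\<forall>X\<in>Ob C.
        p X \<cdot>\<^bsub>C\<^esub> Eta M X = Eta N X \<and>
        p X \<cdot>\<^bsub>C\<^esub> Mu M X = Mu N X \<cdot>\<^bsub>C\<^esub> amap N (p X) \<cdot>\<^bsub>C\<^esub> p (omap M X))"

definition extends ::
  "('o, 'm) cat \<Rightarrow> ('o, 'm) mnd \<Rightarrow> ('o \<Rightarrow> 'm) \<Rightarrow> ('o, 'm) mnd \<Rightarrow> ('o \<Rightarrow> 'm) \<Rightarrow> ('o \<Rightarrow> 'm) \<Rightarrow> bool" where
  "extends C M e N t p \<longleftrightarrow> monad_morphism C M N p \<and> (\<forall>X\<in>Ob C. p X \<cdot>\<^bsub>C\<^esub> e X = t X)"

definition free_monad ::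
  "('o, 'm) cat \<Rightarrow> ('o, 'm, 'o, 'm) func \<Rightarrow> ('o, 'm) mnd \<Rightarrow> ('o \<Rightarrow> 'm) \<Rightarrow> bool" where
  "free_monad C F M e \<longleftrightarrow>
     monad C M \<and> nat_trans C C F M e \<and>
     (\<forall>N t. monad C N \<and> nat_trans C C F N t \<longrightarrow>
        (\<exists>p. extends C M e N t p \<and> (\<forall>q. extends C M e N t q \<longrightarrow> (\<forall>X\<in>Ob C. q X = p X))))"

definition monad_algebra :: "('o, 'm) cat \<Rightarrow> ('o, 'm) mnd \<Rightarrow> 'o \<Rightarrow> 'm \<Rightarrow> bool" where
  "monad_algebra C M X a \<longleftrightarrow>
     X \<in> Ob C \<and> a \<in> hom C (omap M X) X \<and>
     a \<cdot>\<^bsub>C\<^esub> Eta M X = Ide C X \<and>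
     a \<cdot>\<^bsub>C\<^esub> Mu M X = a \<cdot>\<^bsub>C\<^esub> amap M a"

text \<open>The algebra structure freely induced by a morphism a from F X to X, where M is the free
  monad on F with universal transformation e.\<close>

definition induced_alg ::
  "('o, 'm) cat \<Rightarrow> ('o, 'm) mnd \<Rightarrow> ('o \<Rightarrow> 'm) \<Rightarrow> 'o \<Rightarrow> 'm \<Rightarrow> 'm" where
  "induced_alg C M e X a = (THE c. monad_algebra C M X c \<and> c \<cdot>\<^bsub>C\<^esub> e X = a)"

text \<open>Morphisms of algebras are tagged with their source and target.\<close>

definition EM :: "('o, 'm) cat \<Rightarrow> ('o, 'm) mnd \<Rightarrow> ('o \<times> 'm, ('o \<times> 'm) \<times> 'm \<times> ('o \<times> 'm)) cat" where
  "EM C M =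
     \<lparr>Ob = {(X, a). monad_algebra C M X a},
      Mor = {((X, a), f, (Y, b)) | X a f Y b.
               monad_algebra C M X a \<and> monad_algebra C M Y b \<and>
               f \<in> hom C X Y \<and> f \<cdot>\<^bsub>C\<^esub> a = b \<cdot>\<^bsub>C\<^esub> amap M f},
      Dom = (\<lambda>(A, f, B). A), Cod = (\<lambda>(A, f, B). B),
      Ide = (\<lambda>A. (A, Ide C (fst A), A)),
      Cmp = (\<lambda>(B', g, B) (A, f, A'). (A, g \<cdot>\<^bsub>C\<^esub> f, B))\<rparr>"

text \<open>The functor to C forgetting algebra structure, for tagged morphisms as above.\<close>

definition forget :: "('o \<times> 's, ('o \<times> 's) \<times> 'm \<times> ('o \<times> 's), 'o, 'm) func" where
  "forget = \<lparr>omap = fst, amap = (\<lambda>(A, f, B). f)\<rparr>"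

definition isomorphic_over ::
  "('p, 'n) cat \<Rightarrow> ('p, 'n, 'o, 'm) func \<Rightarrow> ('q, 'k) cat \<Rightarrow> ('q, 'k, 'o, 'm) func \<Rightarrow> bool" where
  "isomorphic_over D U E V \<longleftrightarrow>
     (\<exists>(F :: ('p, 'n, 'q, 'k) func) (G :: ('q, 'k, 'p, 'n) func).
        is_functor D E F \<and> is_functor E D G \<and>
        (\<forall>A\<in>Ob D. omap G (omap F A) = A) \<and> (\<forall>f\<in>Mor D. amap G (amap F f) = f) \<and>
        (\<forall>B\<in>Ob E. omap F (omap G B) = B) \<and> (\<forall>g\<in>Mor E. amap F (amap G g) = g) \<and>
        (\<forall>A\<in>Ob D. omap V (omap F A) = omap U A) \<and> (\<forall>f\<in>Mor D. amap V (amap F f) = amap U f))"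


subsection \<open>Simple structural laws\<close>

text \<open>The locale only fixes notation. S with universal transformation e plays the role of the
  free monad on Sig; triple sums associate to the left.\<close>

locale law =
  fixes C :: "('o, 'm) cat" (structure)
    and Sig :: "('o, 'm, 'o, 'm) func"
    and Gam :: "('o \<times> 'o, 'm \<times> 'm, 'o, 'm) func"
    and S :: "('o, 'm) mnd"
    and e :: "'o \<Rightarrow> 'm"
    and d :: "'o \<times> 'o \<Rightarrow> 'm"
begin

abbreviation \<Gamma>o :: "'o \<Rightarrow> 'o \<Rightarrow> 'o" where "\<Gamma>o X Y \<equiv> omap Gam (X, Y)"
abbreviation \<Gamma>m :: "'m \<Rightarrow> 'm \<Rightarrow> 'm" where "\<Gamma>m f g \<equiv> amap Gam (f, g)"
abbreviation So :: "'o \<Rightarrow> 'o" where "So X \<equiv> omap S X"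
abbreviation Sm :: "'m \<Rightarrow> 'm" where "Sm f \<equiv> amap S f"
abbreviation idm :: "'o \<Rightarrow> 'm" where "idm X \<equiv> Ide C X"

definition d_source :: "('o \<times> 'o, 'm \<times> 'm, 'o, 'm) func" where
  "d_source = \<lparr>omap = (\<lambda>(X, Y). \<Gamma>o (omap Sig X) Y), amap = (\<lambda>(f, g). \<Gamma>m (amap Sig f) g)\<rparr>"

definition d_target :: "('o \<times> 'o, 'm \<times> 'm, 'o, 'm) func" where
  "d_target = \<lparr>omap = (\<lambda>(X, Y). So (\<Gamma>o X (So Y) \<oplus> X \<oplus> Y)),
               amap = (\<lambda>(f, g). Sm (\<Gamma>m f (Sm g) \<boxplus> f \<boxplus> g))\<rparr>"

definition simple_structural_law :: "'u itself \<Rightarrow> bool" where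
  "simple_structural_law U \<longleftrightarrow>
     finitary U C C Sig \<and>
     is_functor (prod_cat C C) C Gam \<and>
     (\<forall>Y\<in>Ob C. cocontinuous U C C \<lparr>omap = (\<lambda>X. \<Gamma>o X Y), amap = (\<lambda>f. \<Gamma>m f (idm Y))\<rparr>) \<and>
     (\<forall>X\<in>Ob C. finitary U C C \<lparr>omap = (\<lambda>Y. \<Gamma>o X Y), amap = (\<lambda>g. \<Gamma>m (idm X) g)\<rparr>) \<and>
     free_monad C Sig S e \<and>
     nat_trans (prod_cat C C) C d_source d_target d"

definition L_algebra :: "'o \<Rightarrow> 'm \<Rightarrow> 'm \<Rightarrow> bool" where
  "L_algebra X a b \<longleftrightarrow>
     X \<in> Ob C \<and> a \<in> hom C (omap Sig X) X \<and> b \<in> hom C (\<Gamma>o X X) X \<and>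
     (let a' = induced_alg C S e X a in
        b \<cdot> \<Gamma>m a (idm X) =
        a' \<cdot> Sm (copair C (copair C b (idm X)) (idm X)) \<cdot>
          Sm (\<Gamma>m (idm X) a' \<boxplus> idm X \<boxplus> idm X) \<cdot> d (X, X))"

definition L_alg :: "('o \<times> 'm \<times> 'm, ('o \<times> 'm \<times> 'm) \<times> 'm \<times> ('o \<times> 'm \<times> 'm)) cat" where
  "L_alg =
     \<lparr>Ob = {(X, a, b). L_algebra X a b},
      Mor = {((X, a, b), f, (Y, a', b')) | X a b f Y a' b'.
               L_algebra X a b \<and> L_algebra Y a' b' \<and> f \<in> hom C X Y \<and>
               f \<cdot> a = a' \<cdot> amap Sig f \<and> f \<cdot> b = b' \<cdot> \<Gamma>m f f},
      Dom = (\<lambda>(A, f, B). A), Cod = (\<lambda>(A, f, B). B),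
      Ide = (\<lambda>A. (A, idm (fst A), A)),
      Cmp = (\<lambda>(B', g, B) (A, f, A'). (A, g \<cdot> f, B))\<rparr>"

definition L_fun :: "'o \<Rightarrow> ('o, 'm, 'o, 'm) func" where
  "L_fun Y = \<lparr>omap = (\<lambda>X. \<Gamma>o X (So Y) \<oplus> X), amap = (\<lambda>f. \<Gamma>m f (idm (So Y)) \<boxplus> f)\<rparr>"

definition K_mnd :: "'o \<Rightarrow> ('o, 'm) mnd" where
  "K_mnd Y =
     \<lparr>omap = (\<lambda>A. So (A \<oplus> Y)), amap = (\<lambda>f. Sm (f \<boxplus> idm Y)),
      Eta = (\<lambda>A. Eta S (A \<oplus> Y) \<cdot> in1 C A Y),
      Mu = (\<lambda>A. Mu S (A \<oplus> Y) \<cdot> Sm (copair C (idm (So (A \<oplus> Y))) (Eta S (A \<oplus> Y) \<cdot> in2 C A Y)))\<rparr>"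

text \<open>A right adjoint of the endofunctor L_fun Y, with unit and counit.\<close>

definition R_adj :: "'o \<Rightarrow> ('o, 'm, 'o, 'm) func \<times> ('o \<Rightarrow> 'm) \<times> ('o \<Rightarrow> 'm)" where
  "R_adj Y = (SOME (R, u, v). adjunction C C (L_fun Y) R u v)"

definition R_fun :: "'o \<Rightarrow> ('o, 'm, 'o, 'm) func" where "R_fun Y = fst (R_adj Y)"
definition R_unit :: "'o \<Rightarrow> 'o \<Rightarrow> 'm" where "R_unit Y = fst (snd (R_adj Y))"
definition R_counit :: "'o \<Rightarrow> 'o \<Rightarrow> 'm" where "R_counit Y = snd (snd (R_adj Y))"

definition RKL_mnd :: "'o \<Rightarrow> ('o, 'm) mnd" where
  "RKL_mnd Y = (let L = L_fun Y; K = K_mnd Y; R = R_fun Y in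
     \<lparr>omap = (\<lambda>X. omap R (omap K (omap L X))), amap = (\<lambda>f. amap R (amap K (amap L f))),
      Eta = (\<lambda>X. amap R (Eta K (omap L X)) \<cdot> R_unit Y X),
      Mu = (\<lambda>X. amap R (Mu K (omap L X) \<cdot> amap K (R_counit Y (omap K (omap L X)))))\<rparr>)"

definition h1 :: "'o \<Rightarrow> 'o \<Rightarrow> 'm" where
  "h1 X Y = (let A = \<Gamma>o X (So (So Y)) \<oplus> X in
     Sm (\<Gamma>m (idm X) (Mu S Y) \<boxplus> idm X \<boxplus> idm Y) \<cdot>
     Mu S (A \<oplus> Y) \<cdot>
     Sm (copair C (Eta S (A \<oplus> Y) \<cdot> in1 C A Y) (Sm (in2 C A Y))) \<cdot>
     d (X, So Y))"

definition h2 :: "'o \<Rightarrow> 'o \<Rightarrow> 'm" where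
  "h2 X Y = Sm (in1 C (\<Gamma>o X (So Y) \<oplus> X) Y \<cdot> in2 C (\<Gamma>o X (So Y)) X) \<cdot> e X"

definition h_tr :: "'o \<Rightarrow> 'o \<Rightarrow> 'm" where
  "h_tr X Y = copair C (h1 X Y) (h2 X Y)"

definition h_transpose :: "'o \<Rightarrow> 'o \<Rightarrow> 'm" where
  "h_transpose Y X = amap (R_fun Y) (h_tr X Y) \<cdot> R_unit Y (omap Sig X)"

definition h_ext :: "'o \<Rightarrow> 'o \<Rightarrow> 'm" where
  "h_ext Y = (SOME p. extends C S e (RKL_mnd Y) (h_transpose Y) p)"

definition d_hat :: "'o \<Rightarrow> 'o \<Rightarrow> 'm" where
  "d_hat X Y =
     R_counit Y (omap (K_mnd Y) (omap (L_fun Y) X)) \<cdot> amap (L_fun Y) (h_ext Y X) \<cdot>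
     in1 C (\<Gamma>o (So X) (So Y)) (So X)"

definition GS :: "('o, 'm, 'o, 'm) func" where
  "GS = \<lparr>omap = (\<lambda>X. \<Gamma>o X (So X)), amap = (\<lambda>f. \<Gamma>m f (Sm f))\<rparr>"

definition lift_alg :: "'o \<Rightarrow> 'm \<Rightarrow> 'm" where
  "lift_alg X c =
     Sm (copair C (copair C c (idm X)) (idm X)) \<cdot> d_hat X X \<cdot> \<Gamma>m (idm (So X)) (Mu S X)"

text \<open>In the following, T with universal transformation t is the free monad on GS; the morphism
  corresponding to the free T-algebra on X is the composite of t and the multiplication.\<close>

definition dist_law :: "('o, 'm) mnd \<Rightarrow> ('o \<Rightarrow> 'm) \<Rightarrow> 'o \<Rightarrow> 'm" where
  "dist_law T t X =
     induced_alg C T t (So (omap T X)) (lift_alg (omap T X) (Mu T X \<cdot> t (omap T X))) \<cdot>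
     amap T (Sm (Eta T X))"

definition ST_mnd :: "('o, 'm) mnd \<Rightarrow> ('o \<Rightarrow> 'm) \<Rightarrow> ('o, 'm) mnd" where
  "ST_mnd T t =
     \<lparr>omap = (\<lambda>X. So (omap T X)), amap = (\<lambda>f. Sm (amap T f)),
      Eta = (\<lambda>X. Eta S (omap T X) \<cdot> Eta T X),
      Mu = (\<lambda>X. Mu S (omap T X) \<cdot> Sm (Sm (Mu T X)) \<cdot> Sm (dist_law T t (omap T X)))\<rparr>"

end

end

theory Submission
  imports Defs
begin

text \<open>For a \<open>\<Gamma>(-,S-)\<close>-algebra (X, c), the morphism \<open>S[c,id,id] \<circ> d_hat\<close> makes SX an algebra of the law,
  and it is the free one on (X, c): by the adjunction defining \<open>d_hat\<close>, morphisms out of \<open>\<Gamma>(SX,SX) + SX\<close>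
  that satisfy the recursion of the law are \<open>\<Sigma>\<close>-algebra morphisms out of the free algebra SX. This
  freeness replaces all axioms of the distributive law: an algebra of the law with structure (a, b)
  gives \<open>x = \<alpha> \<circ> S\<beta>\<close>, where \<open>\<alpha>\<close> and \<open>\<beta>\<close> are the S- and T-algebras induced by a and
  \<open>b \<circ> \<Gamma>(id,\<alpha>)\<close>, and conversely \<open>\<alpha> = x \<circ> S\<eta>\<close>, \<open>\<beta> = x \<circ> \<eta>\<close>.

  That S and T, which are only given as initial monads, have as algebras the algebras of their
  endofunctors, and that the right adjoints exist, both come down to the representability of
  presheaves on a locally finitely presentable category that turn colimits into limits.\<close>

section \<open>Small sets\<close>

text \<open>Smallness is governed by a cardinal that is merely regular and uncountable, so the set
  of all functions between two small sets may be large. Families of morphisms indexed by a hom set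
  therefore have to be encoded as morphisms out of a copower before representability can be applied
  to them. Initiality among monads says nothing about a single algebra until algebras are turned
  into monad morphisms. The target monad is attached to an arrow and not to an object: identity
  arrows then account for existence and uniqueness of induced algebras, and a general arrow shows
  that morphisms of F-algebras are morphisms of algebras of the free monad. On the composite side,
  \<open>\<beta> \<cdot> t X\<close> has source \<open>\<Gamma>o X (So X)\<close>, whereas an
  algebra of the law needs an operation b on \<open>\<Gamma>o X X\<close>. An arbitrary T-algebra
  offers no such b. Compatibility with the distributive law does: the lifted operation contains a
  multiplication of S in its second argument, and comparing both sides on generators forces
  \<open>\<beta> \<cdot> t X\<close> to factor through \<alpha>.\<close>

lemma small_subset: "small U B \<Longrightarrow> A \<subseteq> B \<Longrightarrow> small U A"
  unfolding small_def using card_of_mono1 ordLeq_ordLess_trans by blast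

lemma small_image: "small U A \<Longrightarrow> small U (f ` A)"
  unfolding small_def using card_of_image ordLeq_ordLess_trans by blast

lemma small_inj_on: "small U (f ` A) \<Longrightarrow> inj_on f A \<Longrightarrow> small U A"
  unfolding small_def
  by (metis inj_on_imp_bij_betw card_of_ordIsoI ordIso_ordLess_trans)

lemma small_embedding:
  assumes "small (U :: 'u itself) A"
  obtains f :: "'a \<Rightarrow> 'u" where "inj_on f A"
  using assms unfolding small_def
  by (metis card_of_ordLeq ordLess_imp_ordLeq)

text \<open>Regularity is what makes this work: an infinite regular cardinal is stable, so a
  disjoint union of fewer than that many sets, each of smaller cardinality, stays below it.\<close>

lemma small_Sigma:
  assumes "universe (U :: 'u itself)" "small U A" "\<And>a. a \<in> A \<Longrightarrow> small U (B a)"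
  shows "small U (Sigma A B)"
proof -
  have "\<not> finite (UNIV :: 'u set)"
    using assms(1) unfolding universe_def
    by (metis card_of_nat card_of_ordLeq_infinite infinite_UNIV_nat ordIso_ordLeq_trans
        ordLess_imp_ordLeq)
  then have "stable (card_of (UNIV :: 'u set))"
    using assms(1) by (intro regularCard_stable) (auto simp: universe_def Field_card_of card_of_card_order_on)
  then show ?thesis
    using assms(2,3) unfolding small_def by (intro stable_elim) auto
qed

lemma small_finite:
  assumes "universe (U :: 'u itself)" "finite A"
  shows "small U A"
proof -
  have "(card_of A, natLeq) \<in> ordLess"
    using assms(2) finite_iff_ordLess_natLeq by blast
  then show ?thesis
    using assms(1) ordLess_transitive unfolding small_def universe_def by blast
qed

lemma small_Times:
  "universe U \<Longrightarrow> small U A \<Longrightarrow> small U B \<Longrightarrow> small U (A \<times> B)"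
  by (rule small_Sigma)

lemma small_Union:
  assumes "universe U" "small U A" "\<And>a. a \<in> A \<Longrightarrow> small U (B a)"
  shows "small U (\<Union>a\<in>A. B a)"
proof -
  have "(\<Union>a\<in>A. B a) = snd ` Sigma A B" by (auto simp: image_iff)
  then show ?thesis using small_image[OF small_Sigma[OF assms], where f = snd] by simp
qed


section \<open>Categories\<close>

lemma hom_iff: "f \<in> hom C X Y \<longleftrightarrow> f \<in> Mor C \<and> Dom C f = X \<and> Cod C f = Y"
  by (auto simp: hom_def)

text \<open>The laws are restated with \<open>Mor\<close>, \<open>Dom\<close> and \<open>Cod\<close>
  in place of \<open>hom\<close>: typing becomes a matter of conditional rewriting, and composites
  are normalised by associating them to the right.\<close>

locale cat_laws =
  fixes C :: "('o, 'm) cat" (structure)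
  assumes category: "category C"
begin

lemma Dom_Ob [simp]: "f \<in> Mor C \<Longrightarrow> Dom C f \<in> Ob C"
  and Cod_Ob [simp]: "f \<in> Mor C \<Longrightarrow> Cod C f \<in> Ob C"
  using category unfolding category_def by blast+

lemma Ide_simps [simp]:
  assumes "X \<in> Ob C"
  shows "Ide C X \<in> Mor C" "Dom C (Ide C X) = X" "Cod C (Ide C X) = X"
proof -
  have "Ide C X \<in> hom C X X" using category assms unfolding category_def by blast
  then show "Ide C X \<in> Mor C" "Dom C (Ide C X) = X" "Cod C (Ide C X) = X"
    by (auto simp: hom_iff)
qed

lemma Cmp_simps [simp]:
  assumes "f \<in> Mor C" "g \<in> Mor C" "Cod C f = Dom C g"
  shows "g \<cdot> f \<in> Mor C" "Dom C (g \<cdot> f) = Dom C f" "Cod C (g \<cdot> f) = Cod C g"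
proof -
  have "f \<in> hom C (Dom C f) (Cod C f)" "g \<in> hom C (Cod C f) (Cod C g)"
    using assms by (auto simp: hom_iff)
  then have "g \<cdot> f \<in> hom C (Dom C f) (Cod C g)"
    using category unfolding category_def by blast
  then show "g \<cdot> f \<in> Mor C" "Dom C (g \<cdot> f) = Dom C f" "Cod C (g \<cdot> f) = Cod C g"
    by (auto simp: hom_iff)
qed

lemma Cmp_assoc [simp]:
  assumes "f \<in> Mor C" "g \<in> Mor C" "h \<in> Mor C" "Cod C f = Dom C g" "Cod C g = Dom C h"
  shows "(h \<cdot> g) \<cdot> f = h \<cdot> (g \<cdot> f)"
proof -
  have "f \<in> hom C (Dom C f) (Cod C f)" "g \<in> hom C (Cod C f) (Cod C g)"
    "h \<in> hom C (Cod C g) (Cod C h)"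
    using assms by (auto simp: hom_iff)
  then show ?thesis using category unfolding category_def by blast
qed

lemma Cmp_Ide [simp]: "f \<in> Mor C \<Longrightarrow> Dom C f = X \<Longrightarrow> f \<cdot> Ide C X = f"
  and Ide_Cmp [simp]: "f \<in> Mor C \<Longrightarrow> Cod C f = Y \<Longrightarrow> Ide C Y \<cdot> f = f"
  using category unfolding category_def hom_def by blast+

text \<open>In right-associated normal form an equation for a composite of two factors does not
  match in front of a further factor x. This rule produces the variant that does, and is used
  throughout.\<close>

lemma Cmp_pre:
  assumes "g \<cdot> f = k" "f \<in> Mor C" "g \<in> Mor C" "Cod C f = Dom C g"
    and "x \<in> Mor C" "Cod C x = Dom C f"
  shows "g \<cdot> (f \<cdot> x) = k \<cdot> x"
  using assms(2-) by (simp flip: assms(1))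

lemma hom_Cmp: "g \<in> hom C Y Z \<Longrightarrow> f \<in> hom C X Y \<Longrightarrow> g \<cdot> f \<in> hom C X Z"
  by (simp add: hom_iff)

end

lemma functor_simps:
  assumes "category C" "is_functor C D F"
  shows "X \<in> Ob C \<Longrightarrow> omap F X \<in> Ob D"
    and "f \<in> Mor C \<Longrightarrow> amap F f \<in> Mor D"
    and "f \<in> Mor C \<Longrightarrow> Dom D (amap F f) = omap F (Dom C f)"
    and "f \<in> Mor C \<Longrightarrow> Cod D (amap F f) = omap F (Cod C f)"
    and "X \<in> Ob C \<Longrightarrow> amap F (Ide C X) = Ide D (omap F X)"
proof -
  assume "f \<in> Mor C"
  then have "f \<in> hom C (Dom C f) (Cod C f)" by (simp add: hom_iff)
  then have "amap F f \<in> hom D (omap F (Dom C f)) (omap F (Cod C f))"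
    using assms(2) unfolding is_functor_def by blast
  then show "amap F f \<in> Mor D" "Dom D (amap F f) = omap F (Dom C f)"
    "Cod D (amap F f) = omap F (Cod C f)"
    by (auto simp: hom_iff)
qed (use assms(2) in \<open>auto simp: is_functor_def\<close>)

lemma functor_Cmp:
  assumes "category C" "is_functor C D F" "f \<in> Mor C" "g \<in> Mor C" "Cod C f = Dom C g"
  shows "amap F (g \<cdot>\<^bsub>C\<^esub> f) = amap F g \<cdot>\<^bsub>D\<^esub> amap F f"
proof -
  have "f \<in> hom C (Dom C f) (Cod C f)" "g \<in> hom C (Cod C f) (Cod C g)"
    using assms by (auto simp: hom_iff)
  then show ?thesis using assms(2) unfolding is_functor_def by blast
qed

lemma functor_Cmp_pre:
  assumes "category C" "category D" "is_functor C D F" "f \<in> Mor C" "g \<in> Mor C" "Cod C f = Dom C g"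
    and "x \<in> Mor D" "Cod D x = omap F (Dom C f)"
  shows "amap F g \<cdot>\<^bsub>D\<^esub> (amap F f \<cdot>\<^bsub>D\<^esub> x) = amap F (g \<cdot>\<^bsub>C\<^esub> f) \<cdot>\<^bsub>D\<^esub> x"
proof -
  interpret D: cat_laws D by unfold_locales fact
  show ?thesis
    by (rule D.Cmp_pre)
      (use assms functor_simps[OF assms(1,3)] functor_Cmp[OF assms(1,3)] in auto)
qed

lemma is_functor_comp:
  assumes "is_functor B C F" "is_functor C D G"
  shows "is_functor B D (func_comp G F)"
  unfolding is_functor_def func_comp_def func.select_convs
proof (intro conjI ballI allI)
  fix X Y Z f g assume h: "f \<in> hom B X Y" "g \<in> hom B Y Z"
  then have "amap F f \<in> hom C (omap F X) (omap F Y)" "amap F g \<in> hom C (omap F Y) (omap F Z)"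
    using assms(1) unfolding is_functor_def by auto
  moreover have "amap F (g \<cdot>\<^bsub>B\<^esub> f) = amap F g \<cdot>\<^bsub>C\<^esub> amap F f"
    using assms(1) h unfolding is_functor_def by blast
  ultimately show "amap G (amap F (g \<cdot>\<^bsub>B\<^esub> f)) = amap G (amap F g) \<cdot>\<^bsub>D\<^esub> amap G (amap F f)"
    using assms(2) unfolding is_functor_def by simp
qed (use assms in \<open>simp_all add: is_functor_def\<close>)

lemma is_functor_id: "category C \<Longrightarrow> is_functor C C id_func"
  unfolding is_functor_def id_func_def by auto

lemma nat_trans_simps:
  assumes "category C" "nat_trans C D F G t"
  shows "X \<in> Ob C \<Longrightarrow> t X \<in> Mor D"
    and "X \<in> Ob C \<Longrightarrow> Dom D (t X) = omap F X"
    and "X \<in> Ob C \<Longrightarrow> Cod D (t X) = omap G X"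
  using assms(2) unfolding nat_trans_def by (auto simp: hom_iff)

lemma nat_trans_comm:
  assumes "nat_trans C D F G t" "f \<in> Mor C" "Dom C f = X" "Cod C f = Y"
  shows "t Y \<cdot>\<^bsub>D\<^esub> amap F f = amap G f \<cdot>\<^bsub>D\<^esub> t X"
  using assms unfolding nat_trans_def by (simp add: hom_iff)


section \<open>Colimits over arbitrary small categories\<close>

lemma colimit_ex1:
  "colimit J C D X c \<Longrightarrow> cocone J C D X' c' \<Longrightarrow>
    \<exists>!f. f \<in> hom C X X' \<and> (\<forall>i\<in>Ob J. f \<cdot>\<^bsub>C\<^esub> c i = c' i)"
  unfolding colimit_def by blast

lemma (in cat_laws) cocone_comp:
  assumes "category J" "is_functor J C D" "cocone J C D X c" "f \<in> hom C X Y"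
  shows "cocone J C D Y (\<lambda>i. f \<cdot> c i)"
proof -
  interpret J: cat_laws J by unfold_locales fact
  have "(f \<cdot> c j) \<cdot> amap D u = f \<cdot> c i" if "u \<in> hom J i j" for i j u
  proof -
    have "i \<in> Ob J" "j \<in> Ob J" using that by (auto simp: hom_iff)
    then have "c i \<in> hom C (omap D i) X" "c j \<in> hom C (omap D j) X" "c j \<cdot> amap D u = c i"
      using assms(3) that unfolding cocone_def by auto
    then show ?thesis
      using assms(4) that functor_simps[OF assms(1,2)] by (simp add: hom_iff)
  qed
  moreover have "Y \<in> Ob C" using assms(4) by (auto simp: hom_iff)
  moreover have "f \<cdot> c i \<in> hom C (omap D i) Y" if "i \<in> Ob J" for i
    using that assms(3,4) hom_Cmp unfolding cocone_def by blast
  ultimately show ?thesis unfolding cocone_def by blast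
qed

lemma (in cat_laws) colimit_joint_epi:
  assumes "category J" "is_functor J C D" "colimit J C D X c"
    and "f \<in> hom C X Y" "g \<in> hom C X Y" "\<And>i. i \<in> Ob J \<Longrightarrow> f \<cdot> c i = g \<cdot> c i"
  shows "f = g"
proof -
  have "cocone J C D Y (\<lambda>i. f \<cdot> c i)"
    using assms(3) by (intro cocone_comp[OF assms(1,2) _ assms(4)]) (simp add: colimit_def)
  from colimit_ex1[OF assms(3) this] obtain h
    where h: "\<And>k. k \<in> hom C X Y \<Longrightarrow> \<forall>i\<in>Ob J. k \<cdot> c i = f \<cdot> c i \<Longrightarrow> k = h"
    by blast
  from h[OF assms(4)] h[OF assms(5)] assms(6) show ?thesis by simp
qed

text \<open>An isomorphism between two shapes. Cocompleteness and preservation of colimits are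
  stated for shapes with objects and morphisms in 'u, while categories of elements have types built
  from those of C; reindexing bridges the two.\<close>

locale cat_reindexing =
  J: cat_laws J + J': cat_laws J'
  for J :: "('a, 'b) cat" and J' :: "('i, 'j) cat" and I :: "('i, 'j, 'a, 'b) func"
    and I' :: "('a, 'b, 'i, 'j) func" +
  assumes I: "is_functor J' J I" and I': "is_functor J J' I'"
    and inv: "\<And>i. i \<in> Ob J \<Longrightarrow> omap I (omap I' i) = i" "\<And>u. u \<in> Mor J \<Longrightarrow> amap I (amap I' u) = u"
    and inv': "\<And>i. i \<in> Ob J' \<Longrightarrow> omap I' (omap I i) = i" "\<And>u. u \<in> Mor J' \<Longrightarrow> amap I' (amap I u) = u"
begin

lemmas I_simps = functor_simps[OF J'.category I]
lemmas I'_simps = functor_simps[OF J.category I']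

lemma cocone_reindex:
  assumes "\<And>i. i \<in> Ob J' \<Longrightarrow> c' i = c (omap I i)"
  shows "cocone J' C (func_comp D I) X c' \<longleftrightarrow> cocone J C D X c"
proof
  assume l: "cocone J' C (func_comp D I) X c'"
  have "c i \<in> hom C (omap D i) X" if "i \<in> Ob J" for i
    using l that I'_simps(1)[OF that] inv(1)[OF that] assms[of "omap I' i"]
    unfolding cocone_def func_comp_def by (metis func.select_convs(1))
  moreover have "c j \<cdot>\<^bsub>C\<^esub> amap D u = c i" if "u \<in> hom J i j" for i j u
  proof -
    have "amap I' u \<in> hom J' (omap I' i) (omap I' j)"
      using that I'_simps by (simp add: hom_iff)
    then have "c' (omap I' j) \<cdot>\<^bsub>C\<^esub> amap D (amap I (amap I' u)) = c' (omap I' i)"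
      using l unfolding cocone_def func_comp_def by simp
    moreover have "i \<in> Ob J" "j \<in> Ob J" "u \<in> Mor J"
      using that by (auto simp: hom_iff)
    ultimately show ?thesis using assms I'_simps(1) inv by metis
  qed
  ultimately show "cocone J C D X c" using l by (auto simp: cocone_def)
next
  assume r: "cocone J C D X c"
  show "cocone J' C (func_comp D I) X c'"
    unfolding cocone_def func_comp_def func.select_convs
  proof (intro conjI ballI allI)
    show "X \<in> Ob C" using r by (simp add: cocone_def)
    fix i assume "i \<in> Ob J'"
    then show "c' i \<in> hom C (omap D (omap I i)) X"
      using r assms I_simps by (simp add: cocone_def)
  next
    fix i j u assume u: "u \<in> hom J' i j"
    then have "amap I u \<in> hom J (omap I i) (omap I j)" "i \<in> Ob J'" "j \<in> Ob J'"
      using I_simps by (auto simp: hom_iff)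
    then show "c' j \<cdot>\<^bsub>C\<^esub> amap D (amap I u) = c' i"
      using r assms by (simp add: cocone_def)
  qed
qed

lemma colimit_reindex:
  assumes "\<And>i. i \<in> Ob J' \<Longrightarrow> c' i = c (omap I i)"
  shows "colimit J' C (func_comp D I) X c' \<longleftrightarrow> colimit J C D X c"
proof -
  have fact_iff: "(\<forall>i\<in>Ob J'. f \<cdot>\<^bsub>C\<^esub> c' i = k' i) \<longleftrightarrow> (\<forall>i\<in>Ob J. f \<cdot>\<^bsub>C\<^esub> c i = k i)"
    if "\<And>i. i \<in> Ob J' \<Longrightarrow> k' i = k (omap I i)" for f k k'
    using that assms I_simps(1) I'_simps(1) inv(1) by metis
  show ?thesis
  proof
    assume l: "colimit J' C (func_comp D I) X c'"
    show "colimit J C D X c"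
      unfolding colimit_def
    proof (intro conjI allI impI)
      show "cocone J C D X c"
        using l cocone_reindex[where c' = c' and c = c and C = C and D = D and X = X, OF assms] by (simp add: colimit_def)
      fix Y k assume "cocone J C D Y k"
      then have "cocone J' C (func_comp D I) Y (\<lambda>i. k (omap I i))"
        by (subst cocone_reindex[where c = k]) auto
      from colimit_ex1[OF l this]
      show "\<exists>!f. f \<in> hom C X Y \<and> (\<forall>i\<in>Ob J. f \<cdot>\<^bsub>C\<^esub> c i = k i)"
        by (subst (asm) fact_iff[where k = k]) auto
    qed
  next
    assume r: "colimit J C D X c"
    show "colimit J' C (func_comp D I) X c'"
      unfolding colimit_def
    proof (intro conjI allI impI)
      show "cocone J' C (func_comp D I) X c'"
        using r cocone_reindex[where c' = c' and c = c and C = C and D = D and X = X, OF assms] by (simp add: colimit_def)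
      fix Y k' assume k': "cocone J' C (func_comp D I) Y k'"
      have *: "k' i = k' (omap I' (omap I i))" if "i \<in> Ob J'" for i
        using that by (simp add: inv')
      have "cocone J C D Y (\<lambda>i. k' (omap I' i))"
        using k' by (subst (asm) cocone_reindex[where c = "\<lambda>i. k' (omap I' i)"]) (use * in auto)
      from colimit_ex1[OF r this]
      show "\<exists>!f. f \<in> hom C X Y \<and> (\<forall>i\<in>Ob J'. f \<cdot>\<^bsub>C\<^esub> c' i = k' i)"
        by (subst fact_iff[where k = "\<lambda>i. k' (omap I' i)"]) (use * in auto)
    qed
  qed
qed

end

lemma small_cat_copy:
  assumes "small_cat (U :: 'u itself) (J :: ('a, 'b) cat)"
  obtains J' :: "('u, 'u) cat" and I I' where "small_cat U J'" "cat_reindexing J J' I I'"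
proof -
  interpret J: cat_laws J using assms by unfold_locales (simp add: small_cat_def)
  obtain p :: "'a \<Rightarrow> 'u" where p: "inj_on p (Ob J)"
    using assms small_embedding unfolding small_cat_def by blast
  obtain q :: "'b \<Rightarrow> 'u" where q: "inj_on q (Mor J)"
    using assms small_embedding unfolding small_cat_def by blast
  define p' where "p' = the_inv_into (Ob J) p"
  define q' where "q' = the_inv_into (Mor J) q"
  have p': "\<And>x. x \<in> Ob J \<Longrightarrow> p' (p x) = x"
    using p by (simp add: p'_def the_inv_into_f_f)
  have q': "\<And>x. x \<in> Mor J \<Longrightarrow> q' (q x) = x"
    using q by (simp add: q'_def the_inv_into_f_f)
  define J' :: "('u, 'u) cat" where "J' =
    \<lparr>Ob = p ` Ob J, Mor = q ` Mor J, Dom = (\<lambda>f. p (Dom J (q' f))), Cod = (\<lambda>f. p (Cod J (q' f))),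
     Ide = (\<lambda>x. q (Ide J (p' x))), Cmp = (\<lambda>g f. q (q' g \<cdot>\<^bsub>J\<^esub> q' f))\<rparr>"
  define I where "I = \<lparr>omap = p', amap = q'\<rparr>"
  define I' where "I' = \<lparr>omap = p, amap = q\<rparr>"
  have peq: "p x = p y \<longleftrightarrow> x = y" if "x \<in> Ob J" "y \<in> Ob J" for x y
    using p that by (auto dest: inj_onD)
  have cat': "category J'"
    unfolding category_def J'_def
    by (auto simp: hom_iff p' q' peq)
  interpret J': cat_laws J' by unfold_locales fact
  have "small_cat U J'"
    using assms cat' unfolding small_cat_def by (auto simp: J'_def intro: small_image)
  moreover have "cat_reindexing J J' I I'"
    by unfold_locales
      (auto simp: is_functor_def hom_iff I_def I'_def J'_def p' q' peq)
  ultimately show thesis using that by blast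
qed

lemma cocomplete_colimit:
  assumes "cocomplete (U :: 'u itself) C" "small_cat U J" "is_functor J C D"
  obtains X c where "colimit J C D X c"
proof -
  obtain J' :: "('u, 'u) cat" and I I' where J': "small_cat U J'" "cat_reindexing J J' I I'"
    using small_cat_copy[OF assms(2)] by blast
  interpret cat_reindexing J J' I I' by fact
  have "is_functor J' C (func_comp D I)"
    using I assms(3) by (rule is_functor_comp)
  then obtain X c where "colimit J' C (func_comp D I) X c"
    using assms(1) J'(1) unfolding cocomplete_def by blast
  then have "colimit J C D X (\<lambda>i. c (omap I' i))"
    by (subst (asm) colimit_reindex[where c = "\<lambda>i. c (omap I' i)"]) (auto simp: inv')
  then show thesis by (rule that)
qed

lemma cocontinuous_colimit:
  assumes "cocontinuous (U :: 'u itself) C C' F" "small_cat U J" "is_functor J C D" "colimit J C D X c"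
  shows "colimit J C' (func_comp F D) (omap F X) (\<lambda>i. amap F (c i))"
proof -
  obtain J' :: "('u, 'u) cat" and I I' where J': "small_cat U J'" "cat_reindexing J J' I I'"
    using small_cat_copy[OF assms(2)] by blast
  interpret cat_reindexing J J' I I' by fact
  have "is_functor J' C (func_comp D I)"
    using I assms(3) by (rule is_functor_comp)
  moreover have "colimit J' C (func_comp D I) X (\<lambda>i. c (omap I i))"
    using assms(4) by (subst colimit_reindex[where c = c]) auto
  ultimately have "colimit J' C' (func_comp F (func_comp D I)) (omap F X) (\<lambda>i. amap F (c (omap I i)))"
    using assms(1) J'(1) unfolding cocontinuous_def preserves_colimits_def by blast
  moreover have "func_comp F (func_comp D I) = func_comp (func_comp F D) I"
    by (simp add: func_comp_def)
  ultimately show ?thesis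
    by (subst colimit_reindex[symmetric, where c' = "\<lambda>i. amap F (c (omap I i))"]) auto
qed


section \<open>Representability in locally finitely presentable categories\<close>

locale lfp_cat = cat_laws C for C :: "('o, 'm) cat" (structure) +
  fixes U :: "'u itself"
  assumes universe: "universe U" and lfp: "locally_finitely_presentable U C"
begin

lemma cocomplete: "cocomplete U C"
  using lfp by (simp add: locally_finitely_presentable_def)

lemma small_hom: "X \<in> Ob C \<Longrightarrow> Y \<in> Ob C \<Longrightarrow> small U (hom C X Y)"
  using lfp by (simp add: locally_finitely_presentable_def)

text \<open>The small set \<open>\<G>\<close> will serve as solution set: an element of a presheaf
  over any object is controlled by its restrictions to members of \<open>\<G>\<close>.\<close>

lemma generators:
  obtains \<G> where "small U \<G>" "\<G> \<subseteq> Ob C"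
    "\<And>X. X \<in> Ob C \<Longrightarrow> \<exists>(J :: ('u, 'u) cat) D c. small_cat U J \<and> is_functor J C D \<and>
       (\<forall>i\<in>Ob J. omap D i \<in> \<G>) \<and> colimit J C D X c"
proof -
  from lfp obtain \<G> where G: "small U \<G>" "\<forall>G\<in>\<G>. finitely_presentable U C G"
    "\<forall>X\<in>Ob C. \<exists>(J :: ('u, 'u) cat) D c. small_cat U J \<and> filtered J \<and> is_functor J C D \<and>
       (\<forall>i\<in>Ob J. omap D i \<in> \<G>) \<and> colimit J C D X c"
    unfolding locally_finitely_presentable_def by blast
  then show thesis by (intro that[of \<G>]) (auto simp: finitely_presentable_def, blast)
qed

lemma coproduct_family:
  assumes "small U K" "\<And>k. k \<in> K \<Longrightarrow> A k \<in> Ob C"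
  obtains P i where "P \<in> Ob C" "\<And>k. k \<in> K \<Longrightarrow> i k \<in> hom C (A k) P"
    "\<And>Z f. Z \<in> Ob C \<Longrightarrow> (\<And>k. k \<in> K \<Longrightarrow> f k \<in> hom C (A k) Z) \<Longrightarrow>
       \<exists>!h. h \<in> hom C P Z \<and> (\<forall>k\<in>K. h \<cdot> i k = f k)"
proof -
  \<comment> \<open>The discrete category on K. Each index doubles as its own identity, so one set
    provides both objects and morphisms.\<close>
  define J where "J = \<lparr>Ob = K, Mor = K, Dom = (\<lambda>k. k), Cod = (\<lambda>k. k), Ide = (\<lambda>k. k), Cmp = (\<lambda>g f. f)\<rparr>"
  define D where "D = \<lparr>omap = A, amap = (\<lambda>k. Ide C (A k))\<rparr>"
  have "category J"
    by (auto simp: category_def J_def hom_iff)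
  then have J: "small_cat U J"
    using assms(1) by (simp add: small_cat_def J_def)
  have D: "is_functor J C D"
    using assms(2) by (auto simp: is_functor_def J_def D_def hom_iff)
  obtain P i where P: "colimit J C D P i"
    using cocomplete_colimit[OF cocomplete J D] by blast
  have "cocone J C D Z f" if "Z \<in> Ob C" "\<And>k. k \<in> K \<Longrightarrow> f k \<in> hom C (A k) Z" for Z f
    using that by (auto simp: cocone_def J_def D_def hom_iff)
  from colimit_ex1[OF P this] P that[of P i] show thesis
    by (auto simp: colimit_def cocone_def J_def D_def)
qed

lemma binary_coproduct:
  assumes "X \<in> Ob C" "Y \<in> Ob C"
  shows "\<exists>p. is_coproduct C X Y p"
proof -
  have "small U (UNIV :: bool set)"
    by (rule small_finite[OF universe]) simp
  then obtain P i where P: "P \<in> Ob C" "\<And>k. i k \<in> hom C (if k then X else Y) P"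
    "\<And>Z f. Z \<in> Ob C \<Longrightarrow> (\<And>k. f k \<in> hom C (if k then X else Y) Z) \<Longrightarrow>
       \<exists>!h. h \<in> hom C P Z \<and> (\<forall>k. h \<cdot> i k = f k)"
    by (rule coproduct_family[of UNIV "\<lambda>k. if k then X else Y"]) (use assms in auto)
  have "is_coproduct C X Y (P, i True, i False)"
    unfolding is_coproduct_def
  proof (simp only: prod.case, intro conjI allI ballI)
    fix Z f g assume fg: "f \<in> hom C X Z" "g \<in> hom C Y Z"
    then have "Z \<in> Ob C" by (auto simp: hom_iff)
    then have "\<exists>!h. h \<in> hom C P Z \<and> (\<forall>k. h \<cdot> i k = (if k then f else g))"
      by (rule P(3)) (use fg in auto)
    then show "\<exists>!h. h \<in> hom C P Z \<and> h \<cdot> i True = f \<and> h \<cdot> i False = g"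
      by (simp add: all_bool_eq conj_commute)
  qed (use P(2)[of True] P(2)[of False] in auto)
  then show ?thesis by blast
qed

end

text \<open>A presheaf with small values that turns colimits into limits. The two halves of that
  property are asked for at the shapes where they are applied: gluing over categories of elements,
  separation over presentations of an object by generators. The types of the shapes are fixed
  because an assumption of a locale cannot be polymorphic.\<close>

locale continuous_presheaf = lfp_cat C U for C :: "('o, 'm) cat" (structure) and U :: "'u itself" +
  fixes Fo :: "'o \<Rightarrow> 's set" and Fm :: "'m \<Rightarrow> 's \<Rightarrow> 's"
  assumes Fm_in: "f \<in> Mor C \<Longrightarrow> s \<in> Fo (Cod C f) \<Longrightarrow> Fm f s \<in> Fo (Dom C f)"
    and Fm_Cmp: "f \<in> Mor C \<Longrightarrow> g \<in> Mor C \<Longrightarrow> Cod C f = Dom C g \<Longrightarrow> s \<in> Fo (Cod C g) \<Longrightarrow>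
      Fm (g \<cdot> f) s = Fm f (Fm g s)"
    and Fm_Ide: "X \<in> Ob C \<Longrightarrow> s \<in> Fo X \<Longrightarrow> Fm (Ide C X) s = s"
    and glue: "small_cat U (J :: ('o \<times> 's, ('o \<times> 's) \<times> 'm \<times> ('o \<times> 's)) cat) \<Longrightarrow> is_functor J C D \<Longrightarrow> colimit J C D X c \<Longrightarrow>
      (\<And>i. i \<in> Ob J \<Longrightarrow> y i \<in> Fo (omap D i)) \<Longrightarrow>
      (\<And>i j u. u \<in> hom J i j \<Longrightarrow> Fm (amap D u) (y j) = y i) \<Longrightarrow>
      \<exists>x\<in>Fo X. \<forall>i\<in>Ob J. Fm (c i) x = (y :: 'o \<times> 's \<Rightarrow> 's) i"
    and separated: "small_cat U (J' :: ('u, 'u) cat) \<Longrightarrow> is_functor J' C D' \<Longrightarrow> colimit J' C D' X c' \<Longrightarrow>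
      s \<in> Fo X \<Longrightarrow> s' \<in> Fo X \<Longrightarrow> (\<And>i. i \<in> Ob J' \<Longrightarrow> Fm (c' i) s = Fm (c' i) s') \<Longrightarrow> s = s'"
    and small_Fo: "X \<in> Ob C \<Longrightarrow> small U (Fo X)"
begin

definition elements :: "('o \<times> 's) set" where
  "elements = (SIGMA X : Ob C. Fo X)"

text \<open>The full subcategory of the category of elements spanned by W. Projection to first
  components makes it a diagram in C, and cutting down to a small W makes that diagram
  small.\<close>

definition el_cat :: "('o \<times> 's) set \<Rightarrow> ('o \<times> 's, ('o \<times> 's) \<times> 'm \<times> ('o \<times> 's)) cat" where
  "el_cat W =
     \<lparr>Ob = W, Mor = {(v, f, w). v \<in> W \<and> w \<in> W \<and> f \<in> hom C (fst v) (fst w) \<and> Fm f (snd w) = snd v},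
      Dom = (\<lambda>(v, f, w). v), Cod = (\<lambda>(v, f, w). w), Ide = (\<lambda>w. (w, Ide C (fst w), w)),
      Cmp = (\<lambda>(v', g, w) (v, f, w'). (v, g \<cdot> f, w))\<rparr>"

lemma category_el_cat:
  assumes "W \<subseteq> elements"
  shows "category (el_cat W)"
proof -
  have el: "X \<in> Ob C" "s \<in> Fo X" if "(X, s) \<in> W" for X s
    using assms that by (auto simp: elements_def)
  have Cmp: "Fm (g \<cdot> f) s = Fm f (Fm g s)"
    if "f \<in> Mor C" "g \<in> Mor C" "Cod C f = Dom C g" "(Cod C g, s) \<in> W" for f g s
    using that by (intro Fm_Cmp el)
  have Id: "Fm (Ide C X) s = s" if "(X, s) \<in> W" for X s
    using el[OF that] by (rule Fm_Ide)
  show ?thesis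
    unfolding category_def
  proof (intro conjI allI ballI)
    fix X Y Z f g assume "f \<in> hom (el_cat W) X Y" "g \<in> hom (el_cat W) Y Z"
    then show "g \<cdot>\<^bsub>el_cat W\<^esub> f \<in> hom (el_cat W) X Z"
      by (cases X; cases Y; cases Z) (auto simp: el_cat_def hom_iff Cmp)
  qed (auto simp: el_cat_def hom_iff Id el)
qed

lemma small_el_cat:
  assumes "W \<subseteq> elements" "small U W"
  shows "small_cat U (el_cat W)"
proof -
  have "small U (\<Union>v\<in>W. \<Union>w\<in>W. {v} \<times> hom C (fst v) (fst w) \<times> {w})"
    using assms(1)
    by (intro small_Union[OF universe assms(2)] small_Times[OF universe] small_hom
        small_finite[OF universe]) (auto simp: elements_def)
  then have "small U (Mor (el_cat W))"
    by (rule small_subset) (auto simp: el_cat_def)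
  then show ?thesis
    using assms category_el_cat unfolding small_cat_def by (simp add: el_cat_def)
qed

text \<open>By the definition of morphisms in \<open>el_cat\<close>, the elements
  \<open>snd w\<close> are compatible over the diagram of the objects \<open>fst w\<close>, so they
  glue to an element q of its colimit Q. The last property obtained is that the coprojections are
  jointly epic.\<close>

lemma el_cat_colimit:
  assumes "W \<subseteq> elements" "small U W"
  obtains Q q \<iota> where "Q \<in> Ob C" "q \<in> Fo Q"
    "\<And>w. w \<in> W \<Longrightarrow> \<iota> w \<in> hom C (fst w) Q" "\<And>w. w \<in> W \<Longrightarrow> Fm (\<iota> w) q = snd w"
    "\<And>v w f. v \<in> W \<Longrightarrow> w \<in> W \<Longrightarrow> f \<in> hom C (fst v) (fst w) \<Longrightarrow> Fm f (snd w) = snd v \<Longrightarrow> \<iota> w \<cdot> f = \<iota> v"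
    "\<And>Y f g. f \<in> hom C Q Y \<Longrightarrow> g \<in> hom C Q Y \<Longrightarrow> (\<And>w. w \<in> W \<Longrightarrow> f \<cdot> \<iota> w = g \<cdot> \<iota> w) \<Longrightarrow> f = g"
proof -
  define D :: "('o \<times> 's, ('o \<times> 's) \<times> 'm \<times> ('o \<times> 's), 'o, 'm) func" where
    "D = \<lparr>omap = fst, amap = (\<lambda>(v, f, w). f)\<rparr>"
  let ?J = "el_cat W"
  note J = small_el_cat[OF assms]
  have D: "is_functor ?J C D"
    using assms(1) unfolding is_functor_def by (auto simp: el_cat_def D_def hom_iff elements_def)
  obtain Q \<iota> where Q: "colimit ?J C D Q \<iota>"
    using cocomplete_colimit[OF cocomplete J D] by blast
  have "\<exists>x\<in>Fo Q. \<forall>i\<in>Ob ?J. Fm (\<iota> i) x = snd i"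
    using assms(1) by (intro glue[OF J D Q]) (auto simp: el_cat_def D_def elements_def hom_iff)
  then obtain q where q: "q \<in> Fo Q" "\<And>w. w \<in> W \<Longrightarrow> Fm (\<iota> w) q = snd w"
    by (auto simp: el_cat_def)
  have c: "cocone ?J C D Q \<iota>" using Q by (simp add: colimit_def)
  show thesis
  proof (rule that[of Q q \<iota>])
    show "Q \<in> Ob C" using c by (simp add: cocone_def)
    show "q \<in> Fo Q" by fact
    show "\<iota> w \<in> hom C (fst w) Q" if "w \<in> W" for w
      using c that by (simp add: cocone_def el_cat_def D_def)
    show "Fm (\<iota> w) q = snd w" if "w \<in> W" for w
      using that by (rule q(2))
    show "\<iota> w \<cdot> f = \<iota> v"
      if "v \<in> W" "w \<in> W" "f \<in> hom C (fst v) (fst w)" "Fm f (snd w) = snd v" for v w f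
    proof -
      have "(v, f, w) \<in> hom ?J v w" using that by (simp add: hom_iff el_cat_def)
      then have "\<iota> w \<cdot> amap D (v, f, w) = \<iota> v" using c unfolding cocone_def by blast
      then show ?thesis by (simp add: D_def)
    qed
    show "f = g" if "f \<in> hom C Q Y" "g \<in> hom C Q Y" "\<And>w. w \<in> W \<Longrightarrow> f \<cdot> \<iota> w = g \<cdot> \<iota> w" for Y f g
      using that(3) by (intro colimit_joint_epi[OF category_el_cat[OF assms(1)] D Q that(1,2)])
        (simp add: el_cat_def)
  qed
qed

text \<open>The elements over the generators have a weakly terminal colimit P in the category of
  elements. Adding P to the diagram makes the colimit terminal, since two morphisms into it agree
  when restricted to generators.\<close>

theorem representable:
  obtains Q q where "Q \<in> Ob C" "q \<in> Fo Q"
    "\<And>Y y. Y \<in> Ob C \<Longrightarrow> y \<in> Fo Y \<Longrightarrow> \<exists>!f. f \<in> hom C Y Q \<and> Fm f q = y"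
proof -
  obtain \<G> where G: "small U \<G>" "\<G> \<subseteq> Ob C"
    and dense: "\<And>X. X \<in> Ob C \<Longrightarrow> \<exists>(J :: ('u, 'u) cat) D c. small_cat U J \<and> is_functor J C D \<and>
       (\<forall>i\<in>Ob J. omap D i \<in> \<G>) \<and> colimit J C D X c"
    using generators by blast
  define W where "W = (SIGMA X : \<G>. Fo X)"
  have W: "W \<subseteq> elements" "small U W"
    using G by (auto simp: W_def elements_def intro!: small_Sigma[OF universe] small_Fo)
  obtain P p \<iota> where P: "P \<in> Ob C" "p \<in> Fo P"
    and \<iota>: "\<And>w. w \<in> W \<Longrightarrow> \<iota> w \<in> hom C (fst w) P" "\<And>w. w \<in> W \<Longrightarrow> Fm (\<iota> w) p = snd w"
    and \<iota>_nat: "\<And>v w f. v \<in> W \<Longrightarrow> w \<in> W \<Longrightarrow> f \<in> hom C (fst v) (fst w) \<Longrightarrow> Fm f (snd w) = snd v \<Longrightarrow> \<iota> w \<cdot> f = \<iota> v"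
    by (rule el_cat_colimit[OF W]) blast
  \<comment> \<open>Present Y as a colimit of generators. The restrictions of y along the legs are
    members of W, and their coprojections into P form a cocone; the induced morphism pulls p back to
    y because both elements agree on every leg.\<close>
  have weak: "\<exists>f\<in>hom C Y P. Fm f p = y" if Y: "Y \<in> Ob C" "y \<in> Fo Y" for Y y
  proof -
    obtain J :: "('u, 'u) cat" and D c where J: "small_cat U J" "is_functor J C D"
      "\<And>i. i \<in> Ob J \<Longrightarrow> omap D i \<in> \<G>" "colimit J C D Y c"
      using dense[OF Y(1)] by blast
    interpret J: cat_laws J using J(1) by unfold_locales (simp add: small_cat_def)
    note D = functor_simps[OF J.category J(2)]
    have c: "\<And>i. i \<in> Ob J \<Longrightarrow> c i \<in> hom C (omap D i) Y" "\<And>i j u. u \<in> hom J i j \<Longrightarrow> c j \<cdot> amap D u = c i"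
      using J(4) by (auto simp: colimit_def cocone_def)
    define w where "w i = (omap D i, Fm (c i) y)" for i
    have w: "w i \<in> W" if "i \<in> Ob J" for i
      using Fm_in[of "c i" y] c(1)[OF that] J(3)[OF that] Y by (simp add: W_def w_def hom_iff)
    have "cocone J C D P (\<lambda>i. \<iota> (w i))"
      unfolding cocone_def
    proof (intro conjI ballI allI)
      fix i assume "i \<in> Ob J"
      then show "\<iota> (w i) \<in> hom C (omap D i) P" using \<iota>(1)[OF w] by (simp add: w_def)
    next
      fix i j u assume u: "u \<in> hom J i j"
      then have ij: "i \<in> Ob J" "j \<in> Ob J" by (auto simp: hom_iff)
      have "Fm (amap D u) (Fm (c j) y) = Fm (c i) y"
        using c(2)[OF u] c(1)[OF ij(2)] u D(2-4)[of u] Y(2) Fm_Cmp[of "amap D u" "c j" y]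
        by (simp add: hom_iff)
      then show "\<iota> (w j) \<cdot> amap D u = \<iota> (w i)"
        using u D(2-4)[of u] w ij by (intro \<iota>_nat) (auto simp: w_def hom_iff)
    qed fact
    from colimit_ex1[OF J(4) this] obtain f
      where f: "f \<in> hom C Y P" "\<And>i. i \<in> Ob J \<Longrightarrow> f \<cdot> c i = \<iota> (w i)"
      by blast
    have "Fm f p = y"
    proof (rule separated[OF J(1,2,4)])
      show "Fm f p \<in> Fo Y" using Fm_in[of f p] f P(2) by (simp add: hom_iff)
      fix i assume i: "i \<in> Ob J"
      have "Fm (c i) (Fm f p) = Fm (\<iota> (w i)) p"
        using Fm_Cmp[of "c i" f p] f(1) f(2)[OF i] c(1)[OF i] P(2) by (simp add: hom_iff)
      then show "Fm (c i) (Fm f p) = Fm (c i) y"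
        using \<iota>(2)[OF w[OF i]] by (simp add: w_def)
    qed fact
    then show ?thesis using f(1) by blast
  qed
  define W' where "W' = insert (P, p) W"
  have W': "W' \<subseteq> elements" "small U W'"
  proof -
    have "W' = (\<Union>b\<in>(UNIV :: bool set). if b then W else {(P, p)})"
      by (auto simp: W'_def split: if_splits)
    moreover have "small U \<dots>"
    proof (rule small_Union[OF universe small_finite[OF universe]])
      show "small U (if b then W else {(P, p)})" for b
        using W(2) small_finite[OF universe, of "{(P, p)}"] by simp
    qed simp
    ultimately show "small U W'" by simp
    show "W' \<subseteq> elements" using W P by (auto simp: W'_def elements_def)
  qed
  obtain Q q \<kappa> where Q: "Q \<in> Ob C" "q \<in> Fo Q"
    and \<kappa>: "\<And>w. w \<in> W' \<Longrightarrow> \<kappa> w \<in> hom C (fst w) Q" "\<And>w. w \<in> W' \<Longrightarrow> Fm (\<kappa> w) q = snd w"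
    and \<kappa>_nat: "\<And>v w f. v \<in> W' \<Longrightarrow> w \<in> W' \<Longrightarrow> f \<in> hom C (fst v) (fst w) \<Longrightarrow> Fm f (snd w) = snd v \<Longrightarrow> \<kappa> w \<cdot> f = \<kappa> v"
    and \<kappa>_epi: "\<And>Y f g. f \<in> hom C Q Y \<Longrightarrow> g \<in> hom C Q Y \<Longrightarrow> (\<And>w. w \<in> W' \<Longrightarrow> f \<cdot> \<kappa> w = g \<cdot> \<kappa> w) \<Longrightarrow> f = g"
    by (rule el_cat_colimit[OF W']) blast
  let ?k = "\<kappa> (P, p)"
  have Pp: "(P, p) \<in> W'" by (simp add: W'_def)
  have k: "?k \<in> hom C P Q" "Fm ?k q = p"
    using \<kappa>[OF Pp] by auto
  obtain m where m: "m \<in> hom C Q P" "Fm m p = q"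
    using weak[OF Q] by blast
  \<comment> \<open>For each w in W', \<open>m \<cdot> \<kappa> w\<close> is a morphism of elements
    from w to (P, p). Since the diagram is full and contains (P, p), the cocone identity applies to
    it. Thus \<open>?k \<cdot> m\<close> fixes every coprojection and is the identity.\<close>
  have km: "?k \<cdot> m = Ide C Q"
  proof (rule \<kappa>_epi)
    show "?k \<cdot> m \<in> hom C Q Q" "Ide C Q \<in> hom C Q Q"
      using k m Q by (auto simp: hom_iff)
    fix w assume w: "w \<in> W'"
    have "Fm (m \<cdot> \<kappa> w) p = snd w"
      using \<kappa>[OF w] m P(2) Fm_Cmp[of "\<kappa> w" m p] by (simp add: hom_iff)
    then have "?k \<cdot> (m \<cdot> \<kappa> w) = \<kappa> w"
      using \<kappa>_nat[OF w Pp, of "m \<cdot> \<kappa> w"] \<kappa>[OF w] m by (simp add: hom_iff)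
    then show "(?k \<cdot> m) \<cdot> \<kappa> w = Ide C Q \<cdot> \<kappa> w"
      using \<kappa>[OF w] m k by (simp add: hom_iff)
  qed
  \<comment> \<open>By \<open>km\<close>, f equals \<open>?k\<close> after
    \<open>m \<cdot> f\<close>, and the latter is a morphism of the diagram. A morphism from a
    generator into Q is therefore determined by the element it pulls back from q.\<close>
  have gen: "f = \<kappa> (G, Fm f q)" if f: "f \<in> hom C G Q" and "G \<in> \<G>" for G f
  proof -
    let ?w = "(G, Fm f q)"
    have w: "?w \<in> W'"
      using Fm_in[of f q] that Q by (auto simp: W'_def W_def hom_iff)
    have "Fm (m \<cdot> f) p = Fm f q"
      using f m P(2) Fm_Cmp[of f m p] by (simp add: hom_iff)
    then have "?k \<cdot> (m \<cdot> f) = \<kappa> ?w"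
      using \<kappa>_nat[OF w Pp, of "m \<cdot> f"] f m by (simp add: hom_iff)
    moreover have "?k \<cdot> (m \<cdot> f) = f"
      using Cmp_pre[OF km] f m k by (simp add: hom_iff)
    ultimately show ?thesis by simp
  qed
  have "\<exists>!f. f \<in> hom C Y Q \<and> Fm f q = y" if Y: "Y \<in> Ob C" "y \<in> Fo Y" for Y y
  proof (rule ex_ex1I)
    obtain f where f: "f \<in> hom C Y P" "Fm f p = y" using weak[OF Y] by blast
    then have "Fm (?k \<cdot> f) q = y"
      using Fm_Cmp[of f ?k q] k Q by (simp add: hom_iff)
    then show "\<exists>f. f \<in> hom C Y Q \<and> Fm f q = y"
      using hom_Cmp[OF k(1) f(1)] by blast
  next
    fix f g assume "f \<in> hom C Y Q \<and> Fm f q = y" "g \<in> hom C Y Q \<and> Fm g q = y"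
    then have f: "f \<in> hom C Y Q" "Fm f q = y" and g: "g \<in> hom C Y Q" "Fm g q = y" by auto
    obtain J :: "('u, 'u) cat" and D c where J: "small_cat U J" "is_functor J C D"
      "\<And>i. i \<in> Ob J \<Longrightarrow> omap D i \<in> \<G>" "colimit J C D Y c"
      using dense[OF Y(1)] by blast
    show "f = g"
    proof (rule colimit_joint_epi[OF _ J(2,4) f(1) g(1)])
      show "category J" using J(1) by (simp add: small_cat_def)
      fix i assume i: "i \<in> Ob J"
      have c: "c i \<in> hom C (omap D i) Y"
        using J(4) i by (auto simp: colimit_def cocone_def)
      have "Fm (f \<cdot> c i) q = Fm (g \<cdot> c i) q"
        using Fm_Cmp[of "c i" f q] Fm_Cmp[of "c i" g q] f g c Q by (simp add: hom_iff)
      then show "f \<cdot> c i = g \<cdot> c i"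
        using gen[OF hom_Cmp[OF f(1) c] J(3)[OF i]] gen[OF hom_Cmp[OF g(1) c] J(3)[OF i]] by simp
    qed
  qed
  then show thesis using that Q by blast
qed

end


section \<open>Adjoints of cocontinuous functors\<close>

text \<open>Universal arrows are chosen objectwise. Uniqueness of transposes gives functoriality of
  R, naturality of the unit and one triangle identity; naturality of the counit and the other
  triangle hold by construction.\<close>

lemma (in cat_laws) adjunction_of_universal:
  assumes L: "is_functor C C L"
    and univ: "\<And>X. X \<in> Ob C \<Longrightarrow> \<exists>Q q. Q \<in> Ob C \<and> q \<in> hom C (omap L Q) X \<and>
      (\<forall>Z\<in>Ob C. \<forall>y\<in>hom C (omap L Z) X. \<exists>!f. f \<in> hom C Z Q \<and> q \<cdot> amap L f = y)"
  shows "\<exists>R u v. adjunction C C L R u v"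
proof -
  note Ls [simp] = functor_simps[OF category L]
  note LC = functor_Cmp[OF category L]
  from univ obtain Ro v where Ro [simp]: "\<And>X. X \<in> Ob C \<Longrightarrow> Ro X \<in> Ob C"
    and v: "\<And>X. X \<in> Ob C \<Longrightarrow> v X \<in> hom C (omap L (Ro X)) X"
    and ex1: "\<And>X Z y. X \<in> Ob C \<Longrightarrow> Z \<in> Ob C \<Longrightarrow> y \<in> hom C (omap L Z) X \<Longrightarrow>
      \<exists>!f. f \<in> hom C Z (Ro X) \<and> v X \<cdot> amap L f = y"
    by metis
  have vs [simp]: "v X \<in> Mor C" "Dom C (v X) = omap L (Ro X)" "Cod C (v X) = X" if "X \<in> Ob C" for X
    using v[OF that] by (auto simp: hom_iff)
  define tr where "tr Z X y = (THE f. f \<in> hom C Z (Ro X) \<and> v X \<cdot> amap L f = y)" for Z X y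
  have tr: "tr Z X y \<in> Mor C" "Dom C (tr Z X y) = Z" "Cod C (tr Z X y) = Ro X"
    "v X \<cdot> amap L (tr Z X y) = y"
    if "X \<in> Ob C" "Z \<in> Ob C" "y \<in> hom C (omap L Z) X" for X Z y
    using theI'[OF ex1[OF that]] by (auto simp: tr_def hom_iff)
  have uniq: "f = g" if "f \<in> Mor C" "g \<in> Mor C" "X \<in> Ob C" "Dom C f = Dom C g" "Cod C f = Ro X"
    "Cod C g = Ro X" "v X \<cdot> amap L f = v X \<cdot> amap L g" for f g X
    using ex1[of X "Dom C f" "v X \<cdot> amap L f"] that by (auto simp: hom_iff)
  define R where "R = \<lparr>omap = Ro, amap = (\<lambda>f. tr (Ro (Dom C f)) (Cod C f) (f \<cdot> v (Dom C f)))\<rparr>"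
  define u where "u Z = tr Z (omap L Z) (Ide C (omap L Z))" for Z
  have Rs [simp]: "amap R f \<in> Mor C" "Dom C (amap R f) = Ro (Dom C f)" "Cod C (amap R f) = Ro (Cod C f)"
    "omap R = Ro" "v (Cod C f) \<cdot> amap L (amap R f) = f \<cdot> v (Dom C f)"
    if "f \<in> Mor C" for f
    using that tr[of "Cod C f" "Ro (Dom C f)" "f \<cdot> v (Dom C f)"] by (auto simp: R_def hom_iff)
  have Ro' [simp]: "omap R = Ro" by (simp add: R_def)
  have us [simp]: "u Z \<in> Mor C" "Dom C (u Z) = Z" "Cod C (u Z) = Ro (omap L Z)"
    "v (omap L Z) \<cdot> amap L (u Z) = Ide C (omap L Z)" if "Z \<in> Ob C" for Z
    using that tr[of "omap L Z" Z "Ide C (omap L Z)"] by (auto simp: u_def hom_iff)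
  have vR: "v Y \<cdot> (amap L (amap R f) \<cdot> x) = f \<cdot> (v (Dom C f) \<cdot> x)"
    if "f \<in> Mor C" "x \<in> Mor C" "Cod C f = Y" "Cod C x = omap L (Ro (Dom C f))" for f x Y
    using that(1,2,4) Cmp_pre[OF Rs(5)[of f], of x] by (simp flip: that(3))
  have vu: "v (omap L Z) \<cdot> (amap L (u Z) \<cdot> x) = x"
    if "Z \<in> Ob C" "x \<in> Mor C" "Cod C x = omap L Z" for Z x
    using that Cmp_pre[OF us(4)[of Z], of x] by simp
  have R: "is_functor C C R"
    unfolding is_functor_def
  proof (intro conjI ballI allI)
    fix X assume "X \<in> Ob C"
    show "amap R (Ide C X) = Ide C (omap R X)"
      by (rule uniq[where X = X]) (use \<open>X \<in> Ob C\<close> Rs(5)[of "Ide C X"] in auto)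
  next
    fix X Y Z f g assume fg: "f \<in> hom C X Y" "g \<in> hom C Y Z"
    show "amap R (g \<cdot> f) = amap R g \<cdot> amap R f"
      by (rule uniq[where X = Z])
        (use fg Rs(5)[of f] Rs(5)[of g] Rs(5)[of "g \<cdot> f"] in \<open>auto simp: hom_iff LC vR\<close>)
  qed (auto simp: hom_iff)
  moreover have "nat_trans C C id_func (func_comp R L) u"
    unfolding nat_trans_def id_func_def func_comp_def func.select_convs
  proof (intro conjI ballI allI)
    fix X Y f assume f: "f \<in> hom C X Y"
    show "u Y \<cdot> f = amap R (amap L f) \<cdot> u X"
      by (rule uniq[of _ _ "omap L Y"]) (use f in \<open>auto simp: hom_iff LC vR vu\<close>)
  qed (auto simp: hom_iff)
  moreover have "nat_trans C C (func_comp L R) id_func v"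
    unfolding nat_trans_def id_func_def func_comp_def func.select_convs
  proof (intro conjI ballI allI)
    fix X Y f assume "f \<in> hom C X Y"
    then show "v Y \<cdot> amap L (amap R f) = f \<cdot> v X"
      using Rs(5)[of f] by (auto simp: hom_iff)
  qed (auto simp: hom_iff)
  moreover have "amap R (v Y) \<cdot> u (omap R Y) = Ide C (omap R Y)" if "Y \<in> Ob C" for Y
    by (rule uniq[of _ _ Y]) (use that in \<open>auto simp: LC vR\<close>)
  ultimately have "adjunction C C L R u v"
    unfolding adjunction_def using L by simp
  then show ?thesis by blast
qed

text \<open>The value of the right adjoint at X is the object representing the morphisms from L Z to
  X as a presheaf in Z. It turns colimits into limits because L preserves colimits, and its values
  are small by local smallness.\<close>

theorem (in lfp_cat) cocontinuous_left_adjoint: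
  assumes "cocontinuous U C C L"
  shows "\<exists>R u v. adjunction C C L R u v"
proof (rule adjunction_of_universal)
  show L: "is_functor C C L" using assms by (simp add: cocontinuous_def)
  note Ls [simp] = functor_simps[OF category L]
  note LC = functor_Cmp[OF category L]
  fix X assume X: "X \<in> Ob C"
  have colim: "colimit J C (func_comp L D) (omap L Y) (\<lambda>i. amap L (c i))"
    if "small_cat U J" "is_functor J C D" "colimit J C D Y c"
    for J :: "('i, 'j) cat" and D Y c
    using cocontinuous_colimit[OF assms that] .
  interpret continuous_presheaf C U "\<lambda>Z. hom C (omap L Z) X" "\<lambda>f s. s \<cdot> amap L f"
  proof (unfold_locales, goal_cases)
    \<comment> \<open>Goals 4, 5 and 6 are \<open>glue\<close>, \<open>separated\<close> and
      \<open>small_Fo\<close>; the presheaf laws before them follow from functoriality of L.\<close>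
    case (4 J D Y c y)
    have "cocone J C (func_comp L D) X y"
      using 4(4,5) X by (simp add: cocone_def func_comp_def)
    from colimit_ex1[OF colim[OF 4(1-3)] this] show ?case by blast
  next
    case (5 J D Y c s s')
    have "category J" using 5(1) by (simp add: small_cat_def)
    then show ?case
      by (rule colimit_joint_epi[OF _ is_functor_comp[OF 5(2) L] colim[OF 5(1-3)] 5(4,5) 5(6)])
  next
    case (6 Y)
    then show ?case using X by (simp add: small_hom)
  qed (auto simp: hom_iff LC)
  show "\<exists>Q q. Q \<in> Ob C \<and> q \<in> hom C (omap L Q) X \<and>
      (\<forall>Z\<in>Ob C. \<forall>y\<in>hom C (omap L Z) X. \<exists>!f. f \<in> hom C Z Q \<and> q \<cdot> amap L f = y)"
    using representable by metis
qed


section \<open>Free monads are algebraically free\<close>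

lemma monad_algebraD:
  assumes "monad_algebra C M X a"
  shows "X \<in> Ob C" "a \<in> Mor C" "Dom C a = omap M X" "Cod C a = X"
    "a \<cdot>\<^bsub>C\<^esub> Eta M X = Ide C X" "a \<cdot>\<^bsub>C\<^esub> Mu M X = a \<cdot>\<^bsub>C\<^esub> amap M a"
  using assms by (auto simp: monad_algebra_def hom_iff)

text \<open>The monad of an arrow f from A False to A True: Po Z represents the functor sending W to the
  compatible pairs of functions from hom Z (A i) to hom W (A i), and \<pi> is the universal pair.
  Monad morphisms into it are the algebra structures on A False and A True making f a morphism.\<close>

locale arrow_monad = cat_laws C for C :: "('o, 'm) cat" (structure) +
  fixes A :: "bool \<Rightarrow> 'o" and f :: 'm and Po :: "'o \<Rightarrow> 'o" and \<pi> :: "bool \<Rightarrow> 'm \<Rightarrow> 'm"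
  assumes f_hom: "f \<in> hom C (A False) (A True)"
    and Po [simp]: "Z \<in> Ob C \<Longrightarrow> Po Z \<in> Ob C"
    and \<pi>_hom: "z \<in> Mor C \<Longrightarrow> Cod C z = A i \<Longrightarrow> \<pi> i z \<in> hom C (Po (Dom C z)) (A i)"
    and \<pi>_compat: "z \<in> Mor C \<Longrightarrow> Cod C z = A False \<Longrightarrow> f \<cdot> \<pi> False z = \<pi> True (f \<cdot> z)"
    and univ: "W \<in> Ob C \<Longrightarrow> Z \<in> Ob C \<Longrightarrow> (\<And>i z. z \<in> hom C Z (A i) \<Longrightarrow> s i z \<in> hom C W (A i)) \<Longrightarrow>
      (\<And>z. z \<in> hom C Z (A False) \<Longrightarrow> f \<cdot> s False z = s True (f \<cdot> z)) \<Longrightarrow>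
      \<exists>!k. k \<in> hom C W (Po Z) \<and> (\<forall>i. \<forall>z\<in>hom C Z (A i). \<pi> i z \<cdot> k = s i z)"
begin

lemma f_simps [simp]: "f \<in> Mor C" "Dom C f = A False" "Cod C f = A True"
  using f_hom by (auto simp: hom_iff)

lemma A_Ob [simp]: "A i \<in> Ob C"
  using Dom_Ob[of f] Cod_Ob[of f] by (cases i) auto

lemma \<pi>_simps [simp]:
  "z \<in> Mor C \<Longrightarrow> Cod C z = A i \<Longrightarrow> \<pi> i z \<in> Mor C"
  "z \<in> Mor C \<Longrightarrow> Cod C z = A i \<Longrightarrow> Dom C (\<pi> i z) = Po (Dom C z)"
  "z \<in> Mor C \<Longrightarrow> Cod C z = A i \<Longrightarrow> Cod C (\<pi> i z) = A i"
  using \<pi>_hom by (auto simp: hom_iff)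

definition lft :: "'o \<Rightarrow> 'o \<Rightarrow> (bool \<Rightarrow> 'm \<Rightarrow> 'm) \<Rightarrow> 'm" where
  "lft W Z s = (THE k. k \<in> hom C W (Po Z) \<and> (\<forall>i. \<forall>z\<in>hom C Z (A i). \<pi> i z \<cdot> k = s i z))"

lemma lft:
  assumes "W \<in> Ob C" "Z \<in> Ob C" "\<And>i z. z \<in> Mor C \<Longrightarrow> Dom C z = Z \<Longrightarrow> Cod C z = A i \<Longrightarrow>
      s i z \<in> Mor C \<and> Dom C (s i z) = W \<and> Cod C (s i z) = A i"
    and "\<And>z. z \<in> Mor C \<Longrightarrow> Dom C z = Z \<Longrightarrow> Cod C z = A False \<Longrightarrow> f \<cdot> s False z = s True (f \<cdot> z)"
  shows "lft W Z s \<in> Mor C" "Dom C (lft W Z s) = W" "Cod C (lft W Z s) = Po Z"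
    "\<And>i z. z \<in> Mor C \<Longrightarrow> Dom C z = Z \<Longrightarrow> Cod C z = A i \<Longrightarrow> \<pi> i z \<cdot> lft W Z s = s i z"
proof -
  have "\<exists>!k. k \<in> hom C W (Po Z) \<and> (\<forall>i. \<forall>z\<in>hom C Z (A i). \<pi> i z \<cdot> k = s i z)"
    by (rule univ) (use assms in \<open>simp_all add: hom_iff\<close>)
  from theI'[OF this]
  have *: "lft W Z s \<in> hom C W (Po Z)" "\<forall>i. \<forall>z\<in>hom C Z (A i). \<pi> i z \<cdot> lft W Z s = s i z"
    unfolding lft_def by auto
  then show "lft W Z s \<in> Mor C" "Dom C (lft W Z s) = W" "Cod C (lft W Z s) = Po Z"
    "\<And>i z. z \<in> Mor C \<Longrightarrow> Dom C z = Z \<Longrightarrow> Cod C z = A i \<Longrightarrow> \<pi> i z \<cdot> lft W Z s = s i z"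
    by (auto simp: hom_iff)
qed

text \<open>The projections \<open>\<pi> i z\<close> are jointly monic. Every equation between
  morphisms into \<open>Po Z\<close> is checked through them, since they evaluate each operation of
  the monad.\<close>

lemma ext:
  assumes "k \<in> Mor C" "k' \<in> Mor C" "Dom C k = Dom C k'" "Z \<in> Ob C" "Cod C k = Po Z" "Cod C k' = Po Z"
    and "\<And>i z. z \<in> Mor C \<Longrightarrow> Dom C z = Z \<Longrightarrow> Cod C z = A i \<Longrightarrow> \<pi> i z \<cdot> k = \<pi> i z \<cdot> k'"
  shows "k = k'"
proof -
  have "\<exists>!h. h \<in> hom C (Dom C k) (Po Z) \<and> (\<forall>i. \<forall>z\<in>hom C Z (A i). \<pi> i z \<cdot> h = \<pi> i z \<cdot> k)"
  proof (rule univ)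
    fix z assume "z \<in> hom C Z (A False)"
    then show "f \<cdot> \<pi> False z \<cdot> k = \<pi> True (f \<cdot> z) \<cdot> k"
      using assms(1,5) Cmp_pre[OF \<pi>_compat, of z] by (simp add: hom_iff)
  qed (use assms in \<open>auto simp: hom_iff\<close>)
  then obtain h where "\<And>k'. k' \<in> hom C (Dom C k) (Po Z) \<Longrightarrow>
      \<forall>i. \<forall>z\<in>hom C Z (A i). \<pi> i z \<cdot> k' = \<pi> i z \<cdot> k \<Longrightarrow> k' = h"
    by blast
  from this[of k] this[of k'] show ?thesis using assms by (simp add: hom_iff)
qed

text \<open>This is the codensity monad of the functor from the two-element chain to C that picks
  out f. Its structure is that of a continuation monad: the unit evaluates at z, the multiplication
  iterates the projection.\<close>

definition mnd :: "('o, 'm) mnd" where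
  "mnd = \<lparr>omap = Po, amap = (\<lambda>g. lft (Po (Dom C g)) (Cod C g) (\<lambda>i z. \<pi> i (z \<cdot> g))),
      Eta = (\<lambda>Z. lft Z Z (\<lambda>i z. z)), Mu = (\<lambda>Z. lft (Po (Po Z)) Z (\<lambda>i z. \<pi> i (\<pi> i z)))\<rparr>"

lemma omap_mnd [simp]: "omap mnd = Po"
  by (simp add: mnd_def)

lemma amap_mnd [simp]:
  assumes "g \<in> Mor C"
  shows "amap mnd g \<in> Mor C" "Dom C (amap mnd g) = Po (Dom C g)" "Cod C (amap mnd g) = Po (Cod C g)"
    "\<And>i z. z \<in> Mor C \<Longrightarrow> Dom C z = Cod C g \<Longrightarrow> Cod C z = A i \<Longrightarrow> \<pi> i z \<cdot> amap mnd g = \<pi> i (z \<cdot> g)"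
  using lft[of "Po (Dom C g)" "Cod C g" "\<lambda>i z. \<pi> i (z \<cdot> g)"] assms
  by (auto simp: mnd_def \<pi>_compat)

lemma Eta_mnd [simp]:
  assumes "Z \<in> Ob C"
  shows "Eta mnd Z \<in> Mor C" "Dom C (Eta mnd Z) = Z" "Cod C (Eta mnd Z) = Po Z"
    "\<And>i z. z \<in> Mor C \<Longrightarrow> Dom C z = Z \<Longrightarrow> Cod C z = A i \<Longrightarrow> \<pi> i z \<cdot> Eta mnd Z = z"
  using lft[of Z Z "\<lambda>i z. z"] assms by (auto simp: mnd_def)

lemma Mu_mnd [simp]:
  assumes "Z \<in> Ob C"
  shows "Mu mnd Z \<in> Mor C" "Dom C (Mu mnd Z) = Po (Po Z)" "Cod C (Mu mnd Z) = Po Z"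
    "\<And>i z. z \<in> Mor C \<Longrightarrow> Dom C z = Z \<Longrightarrow> Cod C z = A i \<Longrightarrow> \<pi> i z \<cdot> Mu mnd Z = \<pi> i (\<pi> i z)"
  using lft[of "Po (Po Z)" Z "\<lambda>i z. \<pi> i (\<pi> i z)"] assms by (auto simp: mnd_def \<pi>_compat)

lemma mnd_pre [simp]:
  "g \<in> Mor C \<Longrightarrow> z \<in> Mor C \<Longrightarrow> Dom C z = Cod C g \<Longrightarrow> Cod C z = A i \<Longrightarrow> x \<in> Mor C \<Longrightarrow>
    Cod C x = Po (Dom C g) \<Longrightarrow> \<pi> i z \<cdot> amap mnd g \<cdot> x = \<pi> i (z \<cdot> g) \<cdot> x"
  "Z \<in> Ob C \<Longrightarrow> z \<in> Mor C \<Longrightarrow> Dom C z = Z \<Longrightarrow> Cod C z = A i \<Longrightarrow> x \<in> Mor C \<Longrightarrow>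
    Cod C x = Z \<Longrightarrow> \<pi> i z \<cdot> Eta mnd Z \<cdot> x = z \<cdot> x"
  "Z \<in> Ob C \<Longrightarrow> z \<in> Mor C \<Longrightarrow> Dom C z = Z \<Longrightarrow> Cod C z = A i \<Longrightarrow> x \<in> Mor C \<Longrightarrow>
    Cod C x = Po (Po Z) \<Longrightarrow> \<pi> i z \<cdot> Mu mnd Z \<cdot> x = \<pi> i (\<pi> i z) \<cdot> x"
  by (rule Cmp_pre; simp)+

lemma functor_mnd: "is_functor C C mnd"
  unfolding is_functor_def
proof (intro conjI ballI allI)
  fix X assume "X \<in> Ob C"
  then show "amap mnd (Ide C X) = Ide C (omap mnd X)"
    by - (rule ext[where Z = X], auto)
next
  fix X Y Z g h assume "g \<in> hom C X Y" "h \<in> hom C Y Z"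
  then show "amap mnd (h \<cdot> g) = amap mnd h \<cdot> amap mnd g"
    by - (rule ext[where Z = Z], auto simp: hom_iff)
qed (auto simp: hom_iff)

lemma monad_mnd: "monad C mnd"
  unfolding monad_def
proof (intro conjI ballI)
  show "is_functor C C mnd" by (rule functor_mnd)
  show "nat_trans C C id_func mnd (Eta mnd)"
    unfolding nat_trans_def id_func_def func.select_convs
  proof (intro conjI ballI allI)
    fix X Y g assume "g \<in> hom C X Y"
    then show "Eta mnd Y \<cdot> g = amap mnd g \<cdot> Eta mnd X"
      by - (rule ext[where Z = Y], auto simp: hom_iff)
  qed (auto simp: hom_iff)
  show "nat_trans C C (func_comp mnd mnd) mnd (Mu mnd)"
    unfolding nat_trans_def func_comp_def func.select_convs
  proof (intro conjI ballI allI)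
    fix X Y g assume "g \<in> hom C X Y"
    then show "Mu mnd Y \<cdot> amap mnd (amap mnd g) = amap mnd g \<cdot> Mu mnd X"
      by - (rule ext[where Z = Y], auto simp: hom_iff)
  qed (auto simp: hom_iff)
  fix X assume X: "X \<in> Ob C"
  show "Mu mnd X \<cdot> Eta mnd (omap mnd X) = Ide C (omap mnd X)"
    "Mu mnd X \<cdot> amap mnd (Eta mnd X) = Ide C (omap mnd X)"
    "Mu mnd X \<cdot> Mu mnd (omap mnd X) = Mu mnd X \<cdot> amap mnd (Mu mnd X)"
    by (rule ext[where Z = X]; use X in auto)+
qed

text \<open>The component at z, a morphism from Z to A i, carries z through F and applies the
  operation a i. If f is a morphism between the two structures, these components are compatible and
  hence define a morphism into \<open>Po Z\<close>.\<close>

definition act :: "('o, 'm, 'o, 'm, 'z) func_scheme \<Rightarrow> (bool \<Rightarrow> 'm) \<Rightarrow> 'o \<Rightarrow> 'm" where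
  "act F a Z = lft (omap F Z) Z (\<lambda>i z. a i \<cdot> amap F z)"

context
  fixes F :: "('o, 'm, 'o, 'm, 'z) func_scheme" and a :: "bool \<Rightarrow> 'm"
  assumes F: "is_functor C C F"
    and a: "\<And>i. a i \<in> hom C (omap F (A i)) (A i)"
    and f_a: "f \<cdot> a False = a True \<cdot> amap F f"
begin

lemma a_simps: "a i \<in> Mor C" "Dom C (a i) = omap F (A i)" "Cod C (a i) = A i"
  using a[of i] by (auto simp: hom_iff)

lemmas F_simps [simp] = functor_simps[OF category F]

lemma act [simp]:
  assumes "Z \<in> Ob C"
  shows "act F a Z \<in> Mor C" "Dom C (act F a Z) = omap F Z" "Cod C (act F a Z) = Po Z"
    "\<And>i z. z \<in> Mor C \<Longrightarrow> Dom C z = Z \<Longrightarrow> Cod C z = A i \<Longrightarrow> \<pi> i z \<cdot> act F a Z = a i \<cdot> amap F z"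
proof -
  have "f \<cdot> a False \<cdot> amap F z = a True \<cdot> amap F (f \<cdot> z)"
    if "z \<in> Mor C" "Dom C z = Z" "Cod C z = A False" for z
    using that Cmp_pre[OF f_a, of "amap F z"] by (simp add: a_simps functor_Cmp[OF category F])
  then show "act F a Z \<in> Mor C" "Dom C (act F a Z) = omap F Z" "Cod C (act F a Z) = Po Z"
    "\<And>i z. z \<in> Mor C \<Longrightarrow> Dom C z = Z \<Longrightarrow> Cod C z = A i \<Longrightarrow> \<pi> i z \<cdot> act F a Z = a i \<cdot> amap F z"
    using lft[of "omap F Z" Z "\<lambda>i z. a i \<cdot> amap F z"] assms by (auto simp: act_def a_simps)
qed

lemma act_pre [simp]:
  "Z \<in> Ob C \<Longrightarrow> z \<in> Mor C \<Longrightarrow> Dom C z = Z \<Longrightarrow> Cod C z = A i \<Longrightarrow> x \<in> Mor C \<Longrightarrow>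
    Cod C x = omap F Z \<Longrightarrow> \<pi> i z \<cdot> act F a Z \<cdot> x = a i \<cdot> amap F z \<cdot> x"
  by (rule trans[OF Cmp_pre]) (auto simp: a_simps)

lemma nat_trans_act: "nat_trans C C F mnd (act F a)"
  unfolding nat_trans_def
proof (intro conjI ballI allI)
  fix X Y g assume "g \<in> hom C X Y"
  then show "act F a Y \<cdot> amap F g = amap mnd g \<cdot> act F a X"
    by - (rule ext[where Z = Y], auto simp: hom_iff a_simps functor_Cmp[OF category F])
qed (auto simp: hom_iff)

end

text \<open>After projection at z, naturality of the unit and multiplication of M moves z past them,
  and what remains are the unit and associativity laws of the algebra a i.\<close>

lemma monad_morphism_act:
  assumes "monad C M" "\<And>i. monad_algebra C M (A i) (a i)" "f \<cdot> a False = a True \<cdot> amap M f"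
  shows "monad_morphism C M mnd (act M a)"
proof -
  have M: "is_functor C C M" and \<eta>: "nat_trans C C id_func M (Eta M)"
    and \<mu>: "nat_trans C C (func_comp M M) M (Mu M)"
    using assms(1) by (auto simp: monad_def)
  note [simp] = functor_simps[OF category M] nat_trans_simps[OF category \<eta>, simplified id_func_def func.select_convs]
    nat_trans_simps[OF category \<mu>, simplified func_comp_def func.select_convs]
  note alg = monad_algebraD[OF assms(2)]
  note [simp] = alg(1-4)
  have a: "\<And>i. a i \<in> hom C (omap M (A i)) (A i)" by (simp add: hom_iff)
  note act = act[OF M a assms(3)] act_pre[OF M a assms(3)]
  note [simp] = act
  show ?thesis
    unfolding monad_morphism_def
  proof (intro conjI ballI)
    show "nat_trans C C M mnd (act M a)" by (rule nat_trans_act[OF M a assms(3)])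
    fix X assume X: "X \<in> Ob C"
    show "act M a X \<cdot> Eta M X = Eta mnd X"
    proof (rule ext[where Z = X])
      fix i z assume z: "z \<in> Mor C" "Dom C z = X" "Cod C z = A i"
      then have "amap M z \<cdot> Eta M X = Eta M (A i) \<cdot> z"
        using nat_trans_comm[OF \<eta>, of z X "A i"] by (simp add: id_func_def)
      then show "\<pi> i z \<cdot> act M a X \<cdot> Eta M X = \<pi> i z \<cdot> Eta mnd X"
        using z X Cmp_pre[OF alg(5), of i z] by simp
    qed (use X in auto)
    show "act M a X \<cdot> Mu M X = Mu mnd X \<cdot> amap mnd (act M a X) \<cdot> act M a (omap M X)"
    proof (rule ext[where Z = X])
      fix i z assume z: "z \<in> Mor C" "Dom C z = X" "Cod C z = A i"
      then have "amap M z \<cdot> Mu M X = Mu M (A i) \<cdot> amap M (amap M z)"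
        using nat_trans_comm[OF \<mu>, of z X "A i"] by (simp add: func_comp_def)
      then show "\<pi> i z \<cdot> act M a X \<cdot> Mu M X =
          \<pi> i z \<cdot> Mu mnd X \<cdot> amap mnd (act M a X) \<cdot> act M a (omap M X)"
        using z X Cmp_pre[OF alg(6), of i "amap M (amap M z)"] by (simp add: functor_Cmp[OF category M])
    qed (use X in auto)
  qed
qed

text \<open>The projection at the identity of A i is the canonical algebra structure of the
  codensity monad on A i, and f is a morphism between the two canonical structures by
  \<open>\<pi>_compat\<close>. Both are pulled back along p.\<close>

lemma algebra_of_monad_morphism:
  assumes "monad C M" "monad_morphism C M mnd p"
  shows "monad_algebra C M (A i) (\<pi> i (Ide C (A i)) \<cdot> p (A i))"
    and "f \<cdot> \<pi> False (Ide C (A False)) \<cdot> p (A False) = (\<pi> True (Ide C (A True)) \<cdot> p (A True)) \<cdot> amap M f"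
proof -
  have M: "is_functor C C M" and \<eta>: "nat_trans C C id_func M (Eta M)"
    and \<mu>: "nat_trans C C (func_comp M M) M (Mu M)"
    using assms(1) by (auto simp: monad_def)
  have p: "nat_trans C C M mnd p" using assms(2) by (simp add: monad_morphism_def)
  note [simp] = functor_simps[OF category M] nat_trans_simps[OF category \<eta>, simplified id_func_def func.select_convs]
    nat_trans_simps[OF category \<mu>, simplified func_comp_def func.select_convs]
    nat_trans_simps[OF category p]
  have p\<eta>: "p X \<cdot> Eta M X = Eta mnd X" if "X \<in> Ob C" for X
    using assms(2) that by (simp add: monad_morphism_def)
  have p\<mu>: "p X \<cdot> Mu M X = Mu mnd X \<cdot> amap mnd (p X) \<cdot> p (omap M X)" if "X \<in> Ob C" for X
    using assms(2) that by (simp add: monad_morphism_def)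
  have pn: "p Y \<cdot> amap M g = amap mnd g \<cdot> p X" if "g \<in> Mor C" "Dom C g = X" "Cod C g = Y" for g X Y
    by (rule nat_trans_comm[OF p that])
  let ?\<alpha> = "\<lambda>i. \<pi> i (Ide C (A i)) \<cdot> p (A i)"
  have "\<pi> i (Ide C (A i)) \<cdot> p (A i) \<cdot> amap M (?\<alpha> i) = ?\<alpha> i \<cdot> Mu M (A i)"
  proof -
    have "p (A i) \<cdot> amap M (?\<alpha> i) = amap mnd (?\<alpha> i) \<cdot> p (omap M (A i))"
      by (rule pn) auto
    then show ?thesis by (simp add: p\<mu>)
  qed
  then show "monad_algebra C M (A i) (?\<alpha> i)"
    unfolding monad_algebra_def by (auto simp: hom_iff p\<eta>)
  show "f \<cdot> ?\<alpha> False = ?\<alpha> True \<cdot> amap M f"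
    using pn[of f "A False" "A True"] Cmp_pre[OF \<pi>_compat, of "Ide C (A False)" "p (A False)"] by simp
qed

end

section \<open>Existence of the codensity monad of an arrow\<close>

lemma (in lfp_cat) arrow_monad_object:
  fixes A :: "bool \<Rightarrow> 'o"
  assumes f: "f \<in> hom C (A False) (A True)" and Z: "Z \<in> Ob C"
  shows "\<exists>P \<pi>. P \<in> Ob C \<and> (\<forall>i. \<forall>z\<in>hom C Z (A i). \<pi> i z \<in> hom C P (A i)) \<and>
    (\<forall>z\<in>hom C Z (A False). f \<cdot> \<pi> False z = \<pi> True (f \<cdot> z)) \<and>
    (\<forall>W s. W \<in> Ob C \<longrightarrow> (\<forall>i. \<forall>z\<in>hom C Z (A i). s i z \<in> hom C W (A i)) \<longrightarrow>
      (\<forall>z\<in>hom C Z (A False). f \<cdot> s False z = s True (f \<cdot> z)) \<longrightarrow>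
      (\<exists>!k. k \<in> hom C W P \<and> (\<forall>i. \<forall>z\<in>hom C Z (A i). \<pi> i z \<cdot> k = s i z)))"
proof -
  have A [simp]: "A i \<in> Ob C" for i
    using f Dom_Ob[of f] Cod_Ob[of f] by (cases i) (auto simp: hom_iff)
  \<comment> \<open>The presheaf of compatible pairs of functions. Values off the hom sets are
    pinned to \<open>undefined\<close>, so that two elements with equal relevant values are equal as
    functions.\<close>
  define Fo :: "'o \<Rightarrow> (bool \<Rightarrow> 'm \<Rightarrow> 'm) set" where
    "Fo W = {s. (\<forall>i z. z \<in> hom C Z (A i) \<longrightarrow> s i z \<in> hom C W (A i)) \<and>
      (\<forall>i z. z \<notin> hom C Z (A i) \<longrightarrow> s i z = undefined) \<and>
      (\<forall>z\<in>hom C Z (A False). f \<cdot> s False z = s True (f \<cdot> z))}" for W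
  define Fm where "Fm g s = (\<lambda>i z. if z \<in> hom C Z (A i) then s i z \<cdot> g else undefined)"
    for g and s :: "bool \<Rightarrow> 'm \<Rightarrow> 'm"
  have fz: "f \<cdot> z \<in> hom C Z (A True)" if "z \<in> hom C Z (A False)" for z
    using hom_Cmp[OF f that] .
  have Fo_hom: "s i z \<in> hom C W (A i)" if "s \<in> Fo W" "z \<in> hom C Z (A i)" for s i z W
    using that by (simp add: Fo_def)
  have Fo_compat: "f \<cdot> s False z = s True (f \<cdot> z)" if "s \<in> Fo W" "z \<in> hom C Z (A False)" for s z W
    using that by (simp add: Fo_def)
  have Fo_eqI: "s = s'" if "s \<in> Fo W" "s' \<in> Fo W"
    "\<And>i z. z \<in> hom C Z (A i) \<Longrightarrow> s i z = s' i z" for s s' W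
  proof (intro HOL.ext)
    fix i z
    show "s i z = s' i z"
      using that by (cases "z \<in> hom C Z (A i)") (auto simp: Fo_def)
  qed
  interpret continuous_presheaf C U Fo Fm
  proof (unfold_locales, goal_cases)
    case (1 g s)
    have "f \<cdot> (s False z \<cdot> g) = s True (f \<cdot> z) \<cdot> g" if "z \<in> hom C Z (A False)" for z
      using Cmp_pre[OF Fo_compat[OF 1(2) that], of g] Fo_hom[OF 1(2) that] f 1(1)
      by (simp add: hom_iff)
    then show ?case
      using Fo_hom[OF 1(2)] 1(1) fz by (auto simp: Fo_def Fm_def hom_iff)
  next
    case (2 g h s)
    then show ?case using Fo_hom[OF 2(4)] by (auto simp: Fm_def hom_iff fun_eq_iff)
  next
    case (3 X s)
    then show ?case using Fo_hom[OF 3(2)]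
      by (auto simp: Fm_def Fo_def hom_iff fun_eq_iff)
  next
    case (4 J D X c y)
    have J: "category J" using 4(1) by (simp add: small_cat_def)
    interpret J: cat_laws J by unfold_locales fact
    have ex: "\<exists>g. g \<in> hom C X (A i) \<and> (\<forall>j\<in>Ob J. g \<cdot> c j = y j i z)" if z: "z \<in> hom C Z (A i)" for i z
    proof -
      have "y j' i z \<cdot> amap D u = y j i z" if "u \<in> hom J j j'" for j j' u
        using fun_cong[OF fun_cong[OF 4(5)[OF that]], of i z] z by (simp add: Fm_def)
      then have "cocone J C D (A i) (\<lambda>j. y j i z)"
        using Fo_hom[OF 4(4) z] by (simp add: cocone_def)
      from colimit_ex1[OF 4(3) this] show ?thesis by blast
    qed
    define x where "x i z = (SOME g. g \<in> hom C X (A i) \<and> (\<forall>j\<in>Ob J. g \<cdot> c j = y j i z))" for i z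
    have x: "x i z \<in> hom C X (A i)" "\<And>j. j \<in> Ob J \<Longrightarrow> x i z \<cdot> c j = y j i z"
      if "z \<in> hom C Z (A i)" for i z
      using someI_ex[OF ex[OF that]] by (auto simp: x_def)
    have c: "c j \<in> hom C (omap D j) X" if "j \<in> Ob J" for j
      using 4(3) that by (auto simp: colimit_def cocone_def)
    define x' where "x' i z = (if z \<in> hom C Z (A i) then x i z else undefined)" for i z
    have "f \<cdot> x False z = x True (f \<cdot> z)" if z: "z \<in> hom C Z (A False)" for z
    proof (rule colimit_joint_epi[OF J 4(2,3)])
      show "f \<cdot> x False z \<in> hom C X (A True)" "x True (f \<cdot> z) \<in> hom C X (A True)"
        using x(1)[OF z] x(1)[OF fz[OF z]] f by (auto simp: hom_iff)
      fix j assume j: "j \<in> Ob J"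
      have "(f \<cdot> x False z) \<cdot> c j = f \<cdot> y j False z"
        using x(2)[OF z j] x(1)[OF z] c[OF j] f by (simp add: hom_iff)
      also have "\<dots> = x True (f \<cdot> z) \<cdot> c j"
        using x(2)[OF fz[OF z] j] Fo_compat[OF 4(4)[OF j] z] by simp
      finally show "(f \<cdot> x False z) \<cdot> c j = x True (f \<cdot> z) \<cdot> c j" .
    qed
    then have "x' \<in> Fo X"
      using x(1) fz by (auto simp: Fo_def x'_def)
    moreover have "Fm (c j) x' = y j" if j: "j \<in> Ob J" for j
    proof (rule Fo_eqI)
      show "y j \<in> Fo (omap D j)" by (rule 4(4)[OF j])
      fix i z assume "z \<in> hom C Z (A i)"
      then show "Fm (c j) x' i z = y j i z" using x(2)[OF _ j] by (simp add: Fm_def x'_def)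
    next
      have "f \<cdot> y j False z = y j True (f \<cdot> z)" if "z \<in> hom C Z (A False)" for z
        using Fo_compat[OF 4(4)[OF j] that] .
      then show "Fm (c j) x' \<in> Fo (omap D j)"
        using x(2)[OF _ j] Fo_hom[OF 4(4)[OF j]] fz by (auto simp: Fo_def Fm_def x'_def)
    qed
    ultimately show ?case by blast
  next
    case (5 J D X c s s')
    have J: "category J" using 5(1) by (simp add: small_cat_def)
    show ?case
    proof (rule Fo_eqI[OF 5(4,5)])
      fix i z assume z: "z \<in> hom C Z (A i)"
      show "s i z = s' i z"
      proof (rule colimit_joint_epi[OF J 5(2,3) Fo_hom[OF 5(4) z] Fo_hom[OF 5(5) z]])
        fix j assume "j \<in> Ob J"
        from fun_cong[OF fun_cong[OF 5(6)[OF this]], of i z] z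
        show "s i z \<cdot> c j = s' i z \<cdot> c j" by (simp add: Fm_def)
      qed
    qed
  next
    case (6 W)
    \<comment> \<open>A function set between small sets need not be small here. Instead, a function
      from hom Z (A i) to hom W (A i) is recorded as one morphism to A i from the copower of W by
      hom Z (A i). An element of \<open>Fo W\<close> thus becomes a pair of morphisms in small hom
      sets.\<close>
    have "\<exists>P e. P \<in> Ob C \<and> (\<forall>g. (\<forall>z\<in>hom C Z (A i). g z \<in> hom C W (A i)) \<longrightarrow>
        (\<exists>!h. h \<in> hom C P (A i) \<and> (\<forall>z\<in>hom C Z (A i). h \<cdot> e z = g z)))" for i
    proof (rule coproduct_family[OF small_hom[OF Z A], of i "\<lambda>_. W"])
      fix P e
      assume "P \<in> Ob C" and *: "\<And>Y g. Y \<in> Ob C \<Longrightarrow> (\<And>z. z \<in> hom C Z (A i) \<Longrightarrow> g z \<in> hom C W Y) \<Longrightarrow>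
        \<exists>!h. h \<in> hom C P Y \<and> (\<forall>z\<in>hom C Z (A i). h \<cdot> e z = g z)"
      then show ?thesis
        by (intro exI[of _ P] exI[of _ e]) (simp add: *[OF A])
    qed (rule 6)
    then obtain P e where P: "\<And>i. P i \<in> Ob C"
      "\<And>i g. \<forall>z\<in>hom C Z (A i). g z \<in> hom C W (A i) \<Longrightarrow>
        \<exists>!h. h \<in> hom C (P i) (A i) \<and> (\<forall>z\<in>hom C Z (A i). h \<cdot> e i z = g z)"
      by metis
    define h where "h i s = (THE h. h \<in> hom C (P i) (A i) \<and> (\<forall>z\<in>hom C Z (A i). h \<cdot> e i z = s i z))" for i s
    have h: "h i s \<in> hom C (P i) (A i)" "\<And>z. z \<in> hom C Z (A i) \<Longrightarrow> h i s \<cdot> e i z = s i z"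
      if "s \<in> Fo W" for i s
      using theI'[OF P(2)[of i "s i"]] Fo_hom[OF that] by (auto simp: h_def)
    have "inj_on (\<lambda>s. (h False s, h True s)) (Fo W)"
    proof (rule inj_onI)
      fix s s' assume s: "s \<in> Fo W" "s' \<in> Fo W" and eq: "(h False s, h True s) = (h False s', h True s')"
      have "h i s = h i s'" for i using eq by (cases i) auto
      then show "s = s'" using h(2)[OF s(1)] h(2)[OF s(2)] by (intro Fo_eqI[OF s]) metis
    qed
    moreover have "small U ((\<lambda>s. (h False s, h True s)) ` Fo W)"
      by (rule small_subset[OF small_Times[OF universe small_hom[OF P(1)[of False] A[of False]]
          small_hom[OF P(1)[of True] A[of True]]]]) (use h in auto)
    ultimately show ?case using small_inj_on by blast
  qed
  obtain P \<pi> where P: "P \<in> Ob C" "\<pi> \<in> Fo P"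
    "\<And>Y y. Y \<in> Ob C \<Longrightarrow> y \<in> Fo Y \<Longrightarrow> \<exists>!k. k \<in> hom C Y P \<and> Fm k \<pi> = y"
    by (rule representable) blast
  show ?thesis
  proof (intro exI[of _ P] exI[of _ \<pi>] conjI allI impI ballI)
    fix W s assume W: "W \<in> Ob C" and s: "\<forall>i. \<forall>z\<in>hom C Z (A i). s i z \<in> hom C W (A i)"
      "\<forall>z\<in>hom C Z (A False). f \<cdot> s False z = s True (f \<cdot> z)"
    let ?s = "\<lambda>i z. if z \<in> hom C Z (A i) then s i z else undefined"
    have "?s \<in> Fo W" using s fz by (auto simp: Fo_def)
    from P(3)[OF W this]
    have "\<exists>!k. k \<in> hom C W P \<and> Fm k \<pi> = ?s" .
    moreover have "Fm k \<pi> = ?s \<longleftrightarrow> (\<forall>i. \<forall>z\<in>hom C Z (A i). \<pi> i z \<cdot> k = s i z)" for k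
      by (auto simp: Fm_def fun_eq_iff)
    ultimately show "\<exists>!k. k \<in> hom C W P \<and> (\<forall>i. \<forall>z\<in>hom C Z (A i). \<pi> i z \<cdot> k = s i z)"
      by simp
  qed (use P(1) Fo_hom[OF P(2)] Fo_compat[OF P(2)] in auto)
qed

lemma (in lfp_cat) arrow_monad_exists:
  fixes A :: "bool \<Rightarrow> 'o"
  assumes "f \<in> hom C (A False) (A True)"
  shows "\<exists>Po \<pi>. arrow_monad C A f Po \<pi>"
proof -
  define Q where "Q Z P \<pi> \<longleftrightarrow> P \<in> Ob C \<and>
    (\<forall>i. \<forall>z\<in>hom C Z (A i). \<pi> i z \<in> hom C P (A i)) \<and>
    (\<forall>z\<in>hom C Z (A False). f \<cdot> \<pi> False z = \<pi> True (f \<cdot> z)) \<and>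
    (\<forall>W s. W \<in> Ob C \<longrightarrow> (\<forall>i. \<forall>z\<in>hom C Z (A i). s i z \<in> hom C W (A i)) \<longrightarrow>
      (\<forall>z\<in>hom C Z (A False). f \<cdot> s False z = s True (f \<cdot> z)) \<longrightarrow>
      (\<exists>!k. k \<in> hom C W P \<and> (\<forall>i. \<forall>z\<in>hom C Z (A i). \<pi> i z \<cdot> k = s i z)))" for Z P \<pi>
  have "\<forall>Z\<in>Ob C. \<exists>P \<pi>. Q Z P \<pi>"
    using arrow_monad_object[where A = A, OF assms] unfolding Q_def by blast
  then obtain Po \<pi> where P: "\<And>Z. Z \<in> Ob C \<Longrightarrow> Q Z (Po Z) (\<pi> Z)"
    by metis
  note P = P[unfolded Q_def]
  \<comment> \<open>The universal pairs were chosen separately for each Z. They combine into one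
    family because a morphism z determines Z as its domain.\<close>
  have "arrow_monad C A f Po (\<lambda>i z. \<pi> (Dom C z) i z)"
  proof (unfold_locales, goal_cases)
    case (3 z i)
    then have "z \<in> hom C (Dom C z) (A i)" by (simp add: hom_iff)
    then show ?case using P[OF Dom_Ob[OF 3(1)]] by blast
  next
    case (4 z)
    have "z \<in> hom C (Dom C z) (A False)" using 4 by (simp add: hom_iff)
    then have "f \<cdot> \<pi> (Dom C z) False z = \<pi> (Dom C z) True (f \<cdot> z)"
      using P[OF Dom_Ob[OF 4(1)]] by blast
    then show ?case using 4 assms by (simp add: hom_iff)
  next
    case (5 W Z s)
    have "\<exists>!k. k \<in> hom C W (Po Z) \<and> (\<forall>i. \<forall>z\<in>hom C Z (A i). \<pi> Z i z \<cdot> k = s i z)"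
      by (rule P[OF 5(2), THEN conjunct2, THEN conjunct2, THEN conjunct2, rule_format, OF 5(1)])
        (use 5(3,4) in auto)
    moreover have "(\<forall>i. \<forall>z\<in>hom C Z (A i). \<pi> (Dom C z) i z \<cdot> k = s i z) \<longleftrightarrow>
        (\<forall>i. \<forall>z\<in>hom C Z (A i). \<pi> Z i z \<cdot> k = s i z)" for k
      by (auto simp: hom_iff)
    ultimately show ?case by simp
  qed (use assms P in auto)
  then show ?thesis by blast
qed

section \<open>From initiality among monads to algebras of the free monad\<close>

context lfp_cat
begin

context
  fixes F :: "('o, 'm, 'o, 'm) func" and M :: "('o, 'm) mnd" and e :: "'o \<Rightarrow> 'm"
  assumes F: "is_functor C C F" and free: "free_monad C F M e"
begin

lemma free_monadD: "monad C M" "nat_trans C C F M e" "is_functor C C M"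
  using free by (auto simp: free_monad_def monad_def)

text \<open>The two F-structures give a transformation from F to the codensity monad of f, which
  initiality extends to a monad morphism out of M; evaluating that at identities returns both
  M-algebras together with the fact that f is a morphism between them.\<close>

lemma free_algebra_exists:
  fixes A :: "bool \<Rightarrow> 'o"
  assumes f: "f \<in> hom C (A False) (A True)" and a: "\<And>i. a i \<in> hom C (omap F (A i)) (A i)"
    and fa: "f \<cdot> a False = a True \<cdot> amap F f"
  obtains \<alpha> where "\<And>i. monad_algebra C M (A i) (\<alpha> i)" "\<And>i. \<alpha> i \<cdot> e (A i) = a i"
    "f \<cdot> \<alpha> False = \<alpha> True \<cdot> amap M f"
proof -
  obtain Po \<pi> where "arrow_monad C A f Po \<pi>"
    using arrow_monad_exists[where A = A, OF f] by blast
  then interpret arrow_monad C A f Po \<pi> .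
  obtain p where p: "extends C M e mnd (act F a) p"
    using free monad_mnd nat_trans_act[OF F a fa] unfolding free_monad_def by blast
  then have pm: "monad_morphism C M mnd p" by (simp add: extends_def)
  show thesis
  proof (rule that)
    fix i
    show "monad_algebra C M (A i) (\<pi> i (Ide C (A i)) \<cdot> p (A i))"
      by (rule algebra_of_monad_morphism[OF free_monadD(1) pm])
    have "p (A i) \<cdot> e (A i) = act F a (A i)" using p by (simp add: extends_def)
    then show "(\<pi> i (Ide C (A i)) \<cdot> p (A i)) \<cdot> e (A i) = a i"
      using nat_trans_simps[OF category free_monadD(2)] pm
        nat_trans_simps[OF category, of C M mnd p] act[OF F a fa]
        functor_simps[OF category F] a[of i]
      by (simp add: monad_morphism_def hom_iff)
  next
    show "f \<cdot> \<pi> False (Ide C (A False)) \<cdot> p (A False) = (\<pi> True (Ide C (A True)) \<cdot> p (A True)) \<cdot> amap M f"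
      by (rule algebra_of_monad_morphism[OF free_monadD(1) pm])
  qed
qed

text \<open>Take the codensity monad of the identity arrow of X. Both algebras induce monad
  morphisms from M into it with the same restriction along e, so these coincide, and projection at
  the identity recovers the algebras.\<close>

lemma free_algebra_unique:
  assumes "monad_algebra C M X \<alpha>" "monad_algebra C M X \<beta>" "\<alpha> \<cdot> e X = \<beta> \<cdot> e X"
  shows "\<alpha> = \<beta>"
proof -
  note \<alpha> = monad_algebraD[OF assms(1)] and \<beta> = monad_algebraD[OF assms(2)]
  note [simp] = functor_simps[OF category F] nat_trans_simps[OF category free_monadD(2)]
    functor_simps[OF category free_monadD(3)]
  note X = \<alpha>(1)
  have I: "Ide C X \<in> hom C ((\<lambda>_. X) False) ((\<lambda>_. X) True)" using X by (simp add: hom_iff)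
  obtain Po \<pi> where "arrow_monad C (\<lambda>_. X) (Ide C X) Po \<pi>"
    using arrow_monad_exists[where A = "\<lambda>_. X", OF I] by blast
  then interpret arrow_monad C "\<lambda>_. X" "Ide C X" Po \<pi> .
  have ext: "extends C M e mnd (act F (\<lambda>_. \<gamma> \<cdot> e X)) (act M (\<lambda>_. \<gamma>))"
    if "monad_algebra C M X \<gamma>" for \<gamma>
  proof -
    note \<gamma> = monad_algebraD[OF that]
    have M1: "Ide C X \<cdot> \<gamma> = \<gamma> \<cdot> amap M (Ide C X)" using \<gamma> by simp
    have F1: "Ide C X \<cdot> \<gamma> \<cdot> e X = (\<gamma> \<cdot> e X) \<cdot> amap F (Ide C X)" using \<gamma> by simp
    have M2: "\<gamma> \<in> hom C (omap M X) X" using \<gamma> by (simp add: hom_iff)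
    have F2: "\<gamma> \<cdot> e X \<in> hom C (omap F X) X" using \<gamma> by (simp add: hom_iff)
    note [simp] = act[where a = "\<lambda>_. \<gamma>", OF free_monadD(3) M2 M1]
      act[where a = "\<lambda>_. \<gamma> \<cdot> e X", OF F F2 F1]
      act_pre[where a = "\<lambda>_. \<gamma>", OF free_monadD(3) M2 M1]
    have "act M (\<lambda>_. \<gamma>) Z \<cdot> e Z = act F (\<lambda>_. \<gamma> \<cdot> e X) Z" if Z: "Z \<in> Ob C" for Z
    proof (rule ext[where Z = Z])
      fix i z assume z: "z \<in> Mor C" "Dom C z = Z" "Cod C z = X"
      then show "\<pi> i z \<cdot> act M (\<lambda>_. \<gamma>) Z \<cdot> e Z = \<pi> i z \<cdot> act F (\<lambda>_. \<gamma> \<cdot> e X) Z"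
        using nat_trans_comm[OF free_monadD(2), of z Z X] \<gamma> Z by simp
    qed (use Z in auto)
    then show ?thesis
      using monad_morphism_act[OF free_monadD(1) that M1] by (simp add: extends_def)
  qed
  have F1: "Ide C X \<cdot> \<alpha> \<cdot> e X = (\<alpha> \<cdot> e X) \<cdot> amap F (Ide C X)" using \<alpha> by simp
  have F2: "\<alpha> \<cdot> e X \<in> hom C (omap F X) X" using \<alpha> by (simp add: hom_iff)
  obtain p where p: "\<And>q Z. extends C M e mnd (act F (\<lambda>_. \<alpha> \<cdot> e X)) q \<Longrightarrow> Z \<in> Ob C \<Longrightarrow> q Z = p Z"
    using free monad_mnd nat_trans_act[OF F F2 F1] unfolding free_monad_def by blast
  have "act M (\<lambda>_. \<alpha>) X = act M (\<lambda>_. \<beta>) X"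
    using p[OF ext[OF assms(1)] X] p[OF _ X, of "act M (\<lambda>_. \<beta>)"] ext[OF assms(2)] assms(3) by simp
  moreover have "\<pi> True (Ide C X) \<cdot> act M (\<lambda>_. \<gamma>) X = \<gamma>" if "monad_algebra C M X \<gamma>" for \<gamma>
  proof -
    note \<gamma> = monad_algebraD[OF that]
    have "Ide C X \<cdot> \<gamma> = \<gamma> \<cdot> amap M (Ide C X)" "\<gamma> \<in> hom C (omap M X) X"
      using \<gamma> by (auto simp: hom_iff)
    from act[OF free_monadD(3) this(2,1)] show ?thesis using \<gamma> by simp
  qed
  ultimately show ?thesis using assms(1,2) by metis
qed

lemma induced_alg:
  assumes "X \<in> Ob C" "a \<in> hom C (omap F X) X"
  shows "monad_algebra C M X (induced_alg C M e X a)" "induced_alg C M e X a \<cdot> e X = a"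
proof -
  have I: "Ide C X \<in> hom C ((\<lambda>_. X) False) ((\<lambda>_. X) True)"
    and a: "Ide C X \<cdot> (\<lambda>_. a) False = (\<lambda>_. a) True \<cdot> amap F (Ide C X)"
    using assms functor_simps[OF category F] by (auto simp: hom_iff)
  obtain c where "monad_algebra C M X c \<and> c \<cdot> e X = a"
    by (rule free_algebra_exists[where A = "\<lambda>_. X", OF I assms(2) a]) blast
  then have "\<exists>!c. monad_algebra C M X c \<and> c \<cdot> e X = a"
    using free_algebra_unique by blast
  from theI'[OF this]
  show "monad_algebra C M X (induced_alg C M e X a)" "induced_alg C M e X a \<cdot> e X = a"
    unfolding induced_alg_def by auto
qed

lemma induced_alg_eqI:
  assumes "monad_algebra C M X c" "c \<cdot> e X = a"
  shows "induced_alg C M e X a = c"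
  unfolding induced_alg_def using assms free_algebra_unique by (intro the_equality) auto

text \<open>Existence over the arrow f yields some pair of algebras for which f is a morphism;
  uniqueness at X and at Y identifies the pair with the given \<alpha> and \<beta>.\<close>

lemma free_algebra_hom:
  assumes "monad_algebra C M X \<alpha>" "monad_algebra C M Y \<beta>" "f \<in> hom C X Y"
    and "f \<cdot> \<alpha> \<cdot> e X = \<beta> \<cdot> e Y \<cdot> amap F f"
  shows "f \<cdot> \<alpha> = \<beta> \<cdot> amap M f"
proof -
  note \<alpha> = monad_algebraD[OF assms(1)] and \<beta> = monad_algebraD[OF assms(2)]
  note [simp] = functor_simps[OF category F] nat_trans_simps[OF category free_monadD(2)]
  let ?A = "\<lambda>i. if i then Y else X" and ?a = "\<lambda>i. if i then \<beta> \<cdot> e Y else \<alpha> \<cdot> e X"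
  obtain \<gamma> where "\<And>i. monad_algebra C M (?A i) (\<gamma> i)" "\<And>i. \<gamma> i \<cdot> e (?A i) = ?a i"
    "f \<cdot> \<gamma> False = \<gamma> True \<cdot> amap M f"
  proof (rule free_algebra_exists[of f ?A ?a])
    show "f \<cdot> ?a False = ?a True \<cdot> amap F f"
      using assms \<alpha> \<beta> by (simp add: hom_iff)
  qed (use \<alpha> \<beta> assms(3) in \<open>auto simp: hom_iff\<close>)
  note \<gamma> = this
  have "\<gamma> False = \<alpha>"
    using \<gamma>(1)[of False] \<gamma>(2)[of False] by (intro free_algebra_unique[OF _ assms(1)]) auto
  moreover have "\<gamma> True = \<beta>"
    using \<gamma>(1)[of True] \<gamma>(2)[of True] by (intro free_algebra_unique[OF _ assms(2)]) auto
  ultimately show ?thesis using \<gamma>(3) by simp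
qed

end

end


section \<open>Coproducts, monads and adjunctions\<close>

locale cat_sums = cat_laws C for C :: "('o, 'm) cat" (structure) +
  assumes sums: "X \<in> Ob C \<Longrightarrow> Y \<in> Ob C \<Longrightarrow> \<exists>p. is_coproduct C X Y p"
begin

lemma coproduct:
  assumes "X \<in> Ob C" "Y \<in> Ob C"
  shows "is_coproduct C X Y (X \<oplus> Y, in1 C X Y, in2 C X Y)"
  using someI_ex[OF sums[OF assms]] by (simp add: osum_def in1_def in2_def coproduct_def)

lemma in1_simps [simp]:
  assumes "X \<in> Ob C" "Y \<in> Ob C"
  shows "in1 C X Y \<in> Mor C" "Dom C (in1 C X Y) = X" "Cod C (in1 C X Y) = X \<oplus> Y"
  using coproduct[OF assms] by (auto simp: is_coproduct_def hom_iff)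

lemma in2_simps [simp]:
  assumes "X \<in> Ob C" "Y \<in> Ob C"
  shows "in2 C X Y \<in> Mor C" "Dom C (in2 C X Y) = Y" "Cod C (in2 C X Y) = X \<oplus> Y"
  using coproduct[OF assms] by (auto simp: is_coproduct_def hom_iff)

lemma osum_Ob [simp]: "X \<in> Ob C \<Longrightarrow> Y \<in> Ob C \<Longrightarrow> X \<oplus> Y \<in> Ob C"
  using Cod_Ob[of "in1 C X Y"] by simp

lemma copair:
  assumes "f \<in> Mor C" "g \<in> Mor C" "Cod C f = Cod C g"
  shows "copair C f g \<in> Mor C" "Dom C (copair C f g) = Dom C f \<oplus> Dom C g"
    "Cod C (copair C f g) = Cod C g"
    "copair C f g \<cdot> in1 C (Dom C f) (Dom C g) = f" "copair C f g \<cdot> in2 C (Dom C f) (Dom C g) = g"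
proof -
  have "\<exists>!h. h \<in> hom C (Dom C f \<oplus> Dom C g) (Cod C f) \<and>
      h \<cdot> in1 C (Dom C f) (Dom C g) = f \<and> h \<cdot> in2 C (Dom C f) (Dom C g) = g"
    using coproduct[of "Dom C f" "Dom C g"] assms by (simp add: is_coproduct_def hom_iff)
  from theI'[OF this] show "copair C f g \<in> Mor C" "Dom C (copair C f g) = Dom C f \<oplus> Dom C g"
    "Cod C (copair C f g) = Cod C g"
    "copair C f g \<cdot> in1 C (Dom C f) (Dom C g) = f" "copair C f g \<cdot> in2 C (Dom C f) (Dom C g) = g"
    using assms by (auto simp: copair_def hom_iff)
qed

lemmas copair_simps [simp] = copair(1-3)

lemma copair_in [simp]:
  assumes "f \<in> Mor C" "g \<in> Mor C" "Cod C f = Cod C g" "Dom C f = X" "Dom C g = Y"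
  shows "copair C f g \<cdot> in1 C X Y = f" "copair C f g \<cdot> in2 C X Y = g"
    and "x \<in> Mor C \<Longrightarrow> Cod C x = X \<Longrightarrow> copair C f g \<cdot> in1 C X Y \<cdot> x = f \<cdot> x"
    and "y \<in> Mor C \<Longrightarrow> Cod C y = Y \<Longrightarrow> copair C f g \<cdot> in2 C X Y \<cdot> y = g \<cdot> y"
proof -
  show 1: "copair C f g \<cdot> in1 C X Y = f" and 2: "copair C f g \<cdot> in2 C X Y = g"
    using copair(4,5)[OF assms(1-3)] assms(4,5) by auto
  have XY: "X \<in> Ob C" "Y \<in> Ob C" using assms by auto
  show "x \<in> Mor C \<Longrightarrow> Cod C x = X \<Longrightarrow> copair C f g \<cdot> in1 C X Y \<cdot> x = f \<cdot> x"
    by (rule Cmp_pre[OF 1]) (use assms XY in auto)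
  show "y \<in> Mor C \<Longrightarrow> Cod C y = Y \<Longrightarrow> copair C f g \<cdot> in2 C X Y \<cdot> y = g \<cdot> y"
    by (rule Cmp_pre[OF 2]) (use assms XY in auto)
qed

lemma copair_ext:
  assumes "h \<in> Mor C" "k \<in> Mor C" "Dom C h = X \<oplus> Y" "Dom C k = X \<oplus> Y" "Cod C h = Cod C k"
    and "X \<in> Ob C" "Y \<in> Ob C" "h \<cdot> in1 C X Y = k \<cdot> in1 C X Y" "h \<cdot> in2 C X Y = k \<cdot> in2 C X Y"
  shows "h = k"
proof -
  have "\<exists>!l. l \<in> hom C (X \<oplus> Y) (Cod C h) \<and> l \<cdot> in1 C X Y = h \<cdot> in1 C X Y \<and> l \<cdot> in2 C X Y = h \<cdot> in2 C X Y"
    using coproduct[OF assms(6,7)] assms by (simp add: is_coproduct_def hom_iff)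
  then show ?thesis using assms by (auto simp: hom_iff)
qed

lemma Cmp_copair [simp]:
  assumes "f \<in> Mor C" "g \<in> Mor C" "h \<in> Mor C" "Cod C f = Cod C g" "Dom C h = Cod C g"
  shows "h \<cdot> copair C f g = copair C (h \<cdot> f) (h \<cdot> g)"
  by (rule copair_ext[of _ _ "Dom C f" "Dom C g"]) (use assms in auto)

lemma copair_in_in [simp]: "X \<in> Ob C \<Longrightarrow> Y \<in> Ob C \<Longrightarrow> copair C (in1 C X Y) (in2 C X Y) = Ide C (X \<oplus> Y)"
  by (rule copair_ext[of _ _ X Y]) auto

lemma copair_eta:
  assumes "h \<in> Mor C" "Dom C h = X \<oplus> Y" "X \<in> Ob C" "Y \<in> Ob C"
  shows "copair C (h \<cdot> in1 C X Y) (h \<cdot> in2 C X Y) = h"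
  by (rule copair_ext[of _ _ X Y]) (use assms in auto)

lemma msum_simps [simp]:
  assumes "f \<in> Mor C" "g \<in> Mor C"
  shows "f \<boxplus> g \<in> Mor C" "Dom C (f \<boxplus> g) = Dom C f \<oplus> Dom C g" "Cod C (f \<boxplus> g) = Cod C f \<oplus> Cod C g"
  using assms by (auto simp: msum_def)

end

sublocale lfp_cat \<subseteq> cat_sums
  by unfold_locales (rule binary_coproduct)

section \<open>Rewriting rules for monads and adjunctions\<close>

locale cat_monad = cat_laws C for C :: "('o, 'm) cat" (structure) +
  fixes K :: "('o, 'm) mnd"
  assumes monad: "monad C K"
begin

lemma endofunctor: "is_functor C C K"
  and Eta_nat_trans: "nat_trans C C id_func K (Eta K)"
  and Mu_nat_trans: "nat_trans C C (func_comp K K) K (Mu K)"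
  using monad by (auto simp: monad_def)

lemmas functor_simps [simp] = functor_simps[OF category endofunctor]

text \<open>Images under K are merged into the image of a composite, and naturality moves units and
  multiplications to the left. In the resulting normal form most monad calculations are settled by
  rewriting alone. For the left adjoint L the opposite direction, splitting images, is
  chosen.\<close>

lemmas functor_Cmp [simp] =
  functor_Cmp[OF category endofunctor, symmetric] functor_Cmp_pre[OF category category endofunctor]

lemma Eta_simps [simp]:
  assumes "X \<in> Ob C"
  shows "Eta K X \<in> Mor C" "Dom C (Eta K X) = X" "Cod C (Eta K X) = omap K X"
  using nat_trans_simps[OF category Eta_nat_trans assms] by (auto simp: id_func_def)

lemma Mu_simps [simp]:
  assumes "X \<in> Ob C"
  shows "Mu K X \<in> Mor C" "Dom C (Mu K X) = omap K (omap K X)" "Cod C (Mu K X) = omap K X"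
  using nat_trans_simps[OF category Mu_nat_trans assms] by (auto simp: func_comp_def)

lemma Eta_nat [simp]:
  assumes "f \<in> Mor C" "Dom C f = X"
  shows "amap K f \<cdot> Eta K X = Eta K (Cod C f) \<cdot> f"
    and "x \<in> Mor C \<Longrightarrow> Cod C x = X \<Longrightarrow> amap K f \<cdot> Eta K X \<cdot> x = Eta K (Cod C f) \<cdot> f \<cdot> x"
proof -
  have X: "X \<in> Ob C" using assms by auto
  show *: "amap K f \<cdot> Eta K X = Eta K (Cod C f) \<cdot> f"
    using nat_trans_comm[OF Eta_nat_trans assms(1)] assms(2) by (simp add: id_func_def)
  show "amap K f \<cdot> Eta K X \<cdot> x = Eta K (Cod C f) \<cdot> f \<cdot> x" if "x \<in> Mor C" "Cod C x = X"
    using Cmp_pre[OF *, of x] that assms X by simp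
qed

lemma Mu_nat [simp]:
  assumes "f \<in> Mor C" "Dom C f = X"
  shows "amap K f \<cdot> Mu K X = Mu K (Cod C f) \<cdot> amap K (amap K f)"
    and "x \<in> Mor C \<Longrightarrow> Cod C x = omap K (omap K X) \<Longrightarrow>
      amap K f \<cdot> Mu K X \<cdot> x = Mu K (Cod C f) \<cdot> amap K (amap K f) \<cdot> x"
proof -
  have X: "X \<in> Ob C" using assms by auto
  show *: "amap K f \<cdot> Mu K X = Mu K (Cod C f) \<cdot> amap K (amap K f)"
    using nat_trans_comm[OF Mu_nat_trans assms(1)] assms(2) by (simp add: func_comp_def)
  show "amap K f \<cdot> Mu K X \<cdot> x = Mu K (Cod C f) \<cdot> amap K (amap K f) \<cdot> x"
    if "x \<in> Mor C" "Cod C x = omap K (omap K X)"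
    using Cmp_pre[OF *, of x] that assms X by simp
qed

lemma Mu_Eta [simp]:
  assumes "X \<in> Ob C" "Z = omap K X"
  shows "Mu K X \<cdot> Eta K Z = Ide C Z"
    and "x \<in> Mor C \<Longrightarrow> Cod C x = Z \<Longrightarrow> Mu K X \<cdot> Eta K Z \<cdot> x = x"
proof -
  show *: "Mu K X \<cdot> Eta K Z = Ide C Z"
    using monad assms unfolding monad_def by blast
  show "Mu K X \<cdot> Eta K Z \<cdot> x = x" if "x \<in> Mor C" "Cod C x = Z"
    using Cmp_pre[OF *, of x] that assms by simp
qed

lemma Mu_amap_Eta [simp]:
  assumes "X \<in> Ob C"
  shows "Mu K X \<cdot> amap K (Eta K X) = Ide C (omap K X)"
    and "x \<in> Mor C \<Longrightarrow> Cod C x = omap K X \<Longrightarrow> Mu K X \<cdot> amap K (Eta K X) \<cdot> x = x"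
    and "f \<in> Mor C \<Longrightarrow> Cod C f = X \<Longrightarrow> Mu K X \<cdot> amap K (Eta K X \<cdot> f) = amap K f"
    and "f \<in> Mor C \<Longrightarrow> Cod C f = X \<Longrightarrow> x \<in> Mor C \<Longrightarrow> Cod C x = omap K (Dom C f) \<Longrightarrow>
      Mu K X \<cdot> amap K (Eta K X \<cdot> f) \<cdot> x = amap K f \<cdot> x"
proof -
  show *: "Mu K X \<cdot> amap K (Eta K X) = Ide C (omap K X)"
    using monad assms unfolding monad_def by blast
  show 2: "Mu K X \<cdot> amap K (Eta K X) \<cdot> x = x" if "x \<in> Mor C" "Cod C x = omap K X" for x
    using Cmp_pre[OF *, of x] that assms by simp
  show "Mu K X \<cdot> amap K (Eta K X \<cdot> f) = amap K f" if "f \<in> Mor C" "Cod C f = X"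
    using 2[of "amap K f"] that assms by simp
  show "Mu K X \<cdot> amap K (Eta K X \<cdot> f) \<cdot> x = amap K f \<cdot> x"
    if "f \<in> Mor C" "Cod C f = X" "x \<in> Mor C" "Cod C x = omap K (Dom C f)"
    using 2[of "amap K f \<cdot> x"] that assms by simp
qed

lemma Mu_Mu [simp]:
  assumes "X \<in> Ob C" "Z = omap K X"
  shows "Mu K X \<cdot> Mu K Z = Mu K X \<cdot> amap K (Mu K X)"
    and "x \<in> Mor C \<Longrightarrow> Cod C x = omap K (omap K Z) \<Longrightarrow>
      Mu K X \<cdot> Mu K Z \<cdot> x = Mu K X \<cdot> amap K (Mu K X) \<cdot> x"
proof -
  show *: "Mu K X \<cdot> Mu K Z = Mu K X \<cdot> amap K (Mu K X)"
    using monad assms unfolding monad_def by blast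
  show "Mu K X \<cdot> Mu K Z \<cdot> x = Mu K X \<cdot> amap K (Mu K X) \<cdot> x"
    if "x \<in> Mor C" "Cod C x = omap K (omap K Z)"
    using Cmp_pre[OF *, of x] that assms by simp
qed

end

locale cat_adjunction = cat_laws C for C :: "('o, 'm) cat" (structure) +
  fixes L R :: "('o, 'm, 'o, 'm) func" and u v :: "'o \<Rightarrow> 'm"
  assumes adj: "adjunction C C L R u v"
begin

lemma L: "is_functor C C L" and R: "is_functor C C R"
  and u_nat: "nat_trans C C id_func (func_comp R L) u"
  and v_nat: "nat_trans C C (func_comp L R) id_func v"
  using adj by (auto simp: adjunction_def)

lemmas L_simps [simp] = functor_simps[OF category L]
lemmas R_simps [simp] = functor_simps[OF category R]
lemmas L_Cmp [simp] = functor_Cmp[OF category L]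

lemma u_simps [simp]:
  assumes "X \<in> Ob C"
  shows "u X \<in> Mor C" "Dom C (u X) = X" "Cod C (u X) = omap R (omap L X)"
  using nat_trans_simps[OF category u_nat assms] by (auto simp: id_func_def func_comp_def)

lemma v_simps [simp]:
  assumes "X \<in> Ob C"
  shows "v X \<in> Mor C" "Dom C (v X) = omap L (omap R X)" "Cod C (v X) = X"
  using nat_trans_simps[OF category v_nat assms] by (auto simp: id_func_def func_comp_def)

lemma v_LR [simp]:
  assumes "f \<in> Mor C" "Cod C f = Y"
  shows "v Y \<cdot> amap L (amap R f) = f \<cdot> v (Dom C f)"
    and "x \<in> Mor C \<Longrightarrow> Cod C x = omap L (omap R (Dom C f)) \<Longrightarrow>
      v Y \<cdot> amap L (amap R f) \<cdot> x = f \<cdot> v (Dom C f) \<cdot> x"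
proof -
  have Y: "Y \<in> Ob C" using assms by auto
  show *: "v Y \<cdot> amap L (amap R f) = f \<cdot> v (Dom C f)"
    using nat_trans_comm[OF v_nat assms(1)] assms(2) by (simp add: id_func_def func_comp_def)
  show "v Y \<cdot> amap L (amap R f) \<cdot> x = f \<cdot> v (Dom C f) \<cdot> x"
    if "x \<in> Mor C" "Cod C x = omap L (omap R (Dom C f))"
    using Cmp_pre[OF *, of x] that assms Y by simp
qed

lemma v_Lu [simp]:
  assumes "X \<in> Ob C" "Z = omap L X"
  shows "v Z \<cdot> amap L (u X) = Ide C Z"
    and "x \<in> Mor C \<Longrightarrow> Cod C x = Z \<Longrightarrow> v Z \<cdot> amap L (u X) \<cdot> x = x"
proof -
  show *: "v Z \<cdot> amap L (u X) = Ide C Z"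
    using adj assms unfolding adjunction_def by blast
  show "v Z \<cdot> amap L (u X) \<cdot> x = x" if "x \<in> Mor C" "Cod C x = Z"
    using Cmp_pre[OF *, of x] that assms by simp
qed

text \<open>Each h into R X is recovered from its transpose as R of the transpose after the unit.
  Equations into R X can thus be tested under L and the counit, where \<open>v_LR\<close> makes R
  disappear.\<close>

lemma transpose_inject:
  assumes "f \<in> Mor C" "g \<in> Mor C" "Dom C f = Dom C g" "X \<in> Ob C" "Cod C f = omap R X" "Cod C g = omap R X"
    and "v X \<cdot> amap L f = v X \<cdot> amap L g"
  shows "f = g"
proof -
  have Rv: "amap R (v X) \<cdot> u (omap R X) = Ide C (omap R X)"
    using adj assms(4) unfolding adjunction_def by blast
  have "h = amap R (v X \<cdot> amap L h) \<cdot> u (Dom C h)" if h: "h \<in> Mor C" "Cod C h = omap R X" for h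
  proof -
    have "u (omap R X) \<cdot> h = amap R (amap L h) \<cdot> u (Dom C h)"
      using nat_trans_comm[OF u_nat h(1)] h(2) by (simp add: id_func_def func_comp_def)
    then have "amap R (v X \<cdot> amap L h) \<cdot> u (Dom C h) = amap R (v X) \<cdot> u (omap R X) \<cdot> h"
      using h assms(4) by (simp add: functor_Cmp[OF category R])
    also have "\<dots> = h"
      using Cmp_pre[OF Rv, of h] h assms(4) by simp
    finally show ?thesis by simp
  qed
  from this[OF assms(1,5)] this[OF assms(2,6)] show ?thesis
    unfolding assms(3,7) by (rule trans[OF _ sym])
qed

text \<open>Transposed, each law reduces to the corresponding law of K together with naturality of
  the counit and the triangle identity.\<close>

lemma monad_RKL:
  assumes "monad C K"
  shows "monad C \<lparr>omap = (\<lambda>X. omap R (omap K (omap L X))), amap = (\<lambda>f. amap R (amap K (amap L f))),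
      Eta = (\<lambda>X. amap R (Eta K (omap L X)) \<cdot> u X),
      Mu = (\<lambda>X. amap R (Mu K (omap L X) \<cdot> amap K (v (omap K (omap L X)))))\<rparr>"
proof -
  interpret K: cat_monad C K by unfold_locales fact
  show ?thesis
    unfolding monad_def is_functor_def nat_trans_def id_func_def func_comp_def func.select_convs mnd.select_convs
  proof (intro conjI ballI allI, goal_cases)
    case (4 X Y Z f g)
    then show ?case
      by - (rule transpose_inject[where X = "omap K (omap L Z)"], auto simp: hom_iff)
  next
    case (6 X Y f)
    then show ?case
      by - (rule transpose_inject[where X = "omap K (omap L Y)"], auto simp: hom_iff)
  next
    case (8 X Y f)
    then show ?case
      by - (rule transpose_inject[where X = "omap K (omap L Y)"], auto simp: hom_iff)
  next
    case (9 X)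
    then show ?case
      by - (rule transpose_inject[where X = "omap K (omap L X)"], auto)
  next
    case (10 X)
    then show ?case
      by - (rule transpose_inject[where X = "omap K (omap L X)"], auto)
  next
    case (11 X)
    then show ?case
      by - (rule transpose_inject[where X = "omap K (omap L X)"], auto)
  qed (auto simp: hom_iff)
qed

end


section \<open>Simple structural laws\<close>

text \<open>A cocone on the sums restricts along the injections to a cocone for F and one for G.
  Their factorisations are copaired, and uniqueness is checked on each summand by joint
  epimorphy.\<close>

lemma (in lfp_cat) cocontinuous_sum:
  assumes F: "cocontinuous U C C F" and G: "cocontinuous U C C G"
  shows "cocontinuous U C C \<lparr>omap = (\<lambda>X. omap F X \<oplus> omap G X), amap = (\<lambda>f. amap F f \<boxplus> amap G f)\<rparr>"
    (is "cocontinuous U C C ?H")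
proof -
  have FF: "is_functor C C F" and GF: "is_functor C C G"
    using F G by (auto simp: cocontinuous_def)
  note [simp] = functor_simps[OF category FF] functor_simps[OF category GF]
    functor_Cmp[OF category FF] functor_Cmp[OF category GF] msum_def
  have H: "is_functor C C ?H"
    by (auto simp: is_functor_def hom_iff)
  have "preserves_colimits J C C ?H" if J: "small_cat U J" for J :: "('u, 'u) cat"
    unfolding preserves_colimits_def
  proof (intro allI impI, elim conjE)
    fix D X c assume D: "is_functor J C D" and X: "colimit J C D X c"
    interpret J: cat_laws J using J by unfold_locales (simp add: small_cat_def)
    note [simp] = functor_simps[OF J.category D]
    note colF = cocontinuous_colimit[OF F J D X] and colG = cocontinuous_colimit[OF G J D X]
    have XO [simp]: "X \<in> Ob C" using X by (simp add: colimit_def cocone_def)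
    have c [simp]: "c i \<in> Mor C" "Dom C (c i) = omap D i" "Cod C (c i) = X" if "i \<in> Ob J" for i
      using X that by (auto simp: colimit_def cocone_def hom_iff)
    have nat: "c j \<cdot> amap D w = c i" if "w \<in> hom J i j" for i j w
      using X that unfolding colimit_def cocone_def by blast
    show "colimit J C (func_comp ?H D) (omap ?H X) (\<lambda>i. amap ?H (c i))"
      unfolding colimit_def
    proof (intro conjI allI impI)
      show "cocone J C (func_comp ?H D) (omap ?H X) (\<lambda>i. amap ?H (c i))"
        unfolding cocone_def
      proof (intro conjI ballI allI)
        fix i j w assume w: "w \<in> hom J i j"
        then have ij [simp]: "i \<in> Ob J" "j \<in> Ob J" "w \<in> Mor J" "Dom J w = i" "Cod J w = j"
          by (auto simp: hom_iff)
        have "amap ?H (c j) \<cdot> amap ?H (amap D w) = amap ?H (c j \<cdot> amap D w)"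
          by (rule functor_Cmp[OF category H, symmetric]) auto
        then show "amap ?H (c j) \<cdot> amap (func_comp ?H D) w = amap ?H (c i)"
          using nat[OF w] by (simp add: func_comp_def)
      qed (auto simp: func_comp_def hom_iff)
    next
      fix Y k assume k: "cocone J C (func_comp ?H D) Y k"
      have Y [simp]: "Y \<in> Ob C" using k by (simp add: cocone_def)
      have ks [simp]: "k i \<in> Mor C" "Dom C (k i) = omap F (omap D i) \<oplus> omap G (omap D i)" "Cod C (k i) = Y"
        if "i \<in> Ob J" for i
        using k that by (auto simp: cocone_def func_comp_def hom_iff)
      have kn: "k j \<cdot> amap ?H (amap D w) = k i" if "w \<in> hom J i j" for i j w
        using k that by (simp add: cocone_def func_comp_def)
      let ?in1 = "\<lambda>Z. in1 C (omap F Z) (omap G Z)" and ?in2 = "\<lambda>Z. in2 C (omap F Z) (omap G Z)"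
      have coconeF: "cocone J C (func_comp F D) Y (\<lambda>i. k i \<cdot> ?in1 (omap D i))"
        unfolding cocone_def
      proof (intro conjI ballI allI)
        fix i j w assume w: "w \<in> hom J i j"
        then have ij [simp]: "i \<in> Ob J" "j \<in> Ob J" "w \<in> Mor J" "Dom J w = i" "Cod J w = j"
          by (auto simp: hom_iff)
        have "(k j \<cdot> amap ?H (amap D w)) \<cdot> ?in1 (omap D i) = k i \<cdot> ?in1 (omap D i)"
          by (simp only: kn[OF w])
        then show "(k j \<cdot> ?in1 (omap D j)) \<cdot> amap (func_comp F D) w = k i \<cdot> ?in1 (omap D i)"
          by (simp add: func_comp_def)
      qed (auto simp: func_comp_def hom_iff)
      have coconeG: "cocone J C (func_comp G D) Y (\<lambda>i. k i \<cdot> ?in2 (omap D i))"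
        unfolding cocone_def
      proof (intro conjI ballI allI)
        fix i j w assume w: "w \<in> hom J i j"
        then have ij [simp]: "i \<in> Ob J" "j \<in> Ob J" "w \<in> Mor J" "Dom J w = i" "Cod J w = j"
          by (auto simp: hom_iff)
        have "(k j \<cdot> amap ?H (amap D w)) \<cdot> ?in2 (omap D i) = k i \<cdot> ?in2 (omap D i)"
          by (simp only: kn[OF w])
        then show "(k j \<cdot> ?in2 (omap D j)) \<cdot> amap (func_comp G D) w = k i \<cdot> ?in2 (omap D i)"
          by (simp add: func_comp_def)
      qed (auto simp: func_comp_def hom_iff)
      from colimit_ex1[OF colF coconeF] colimit_ex1[OF colG coconeG] obtain p q where
        p: "p \<in> hom C (omap F X) Y" "\<And>i. i \<in> Ob J \<Longrightarrow> p \<cdot> amap F (c i) = k i \<cdot> ?in1 (omap D i)"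
        and q: "q \<in> hom C (omap G X) Y" "\<And>i. i \<in> Ob J \<Longrightarrow> q \<cdot> amap G (c i) = k i \<cdot> ?in2 (omap D i)"
        by blast
      have pq [simp]: "p \<in> Mor C" "q \<in> Mor C" "Dom C p = omap F X" "Dom C q = omap G X" "Cod C p = Y" "Cod C q = Y"
        using p q by (auto simp: hom_iff)
      show "\<exists>!f. f \<in> hom C (omap ?H X) Y \<and> (\<forall>i\<in>Ob J. f \<cdot> amap ?H (c i) = k i)"
      proof (rule ex1I[of _ "copair C p q"])
        show "copair C p q \<in> hom C (omap ?H X) Y \<and> (\<forall>i\<in>Ob J. copair C p q \<cdot> amap ?H (c i) = k i)"
          by (auto simp: hom_iff p(2) q(2) copair_eta)
      next
        fix f assume f: "f \<in> hom C (omap ?H X) Y \<and> (\<forall>i\<in>Ob J. f \<cdot> amap ?H (c i) = k i)"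
        then have fs [simp]: "f \<in> Mor C" "Dom C f = omap F X \<oplus> omap G X" "Cod C f = Y"
          by (auto simp: hom_iff)
        have fk: "(f \<cdot> amap ?H (c i)) \<cdot> ?in1 (omap D i) = k i \<cdot> ?in1 (omap D i)"
          "(f \<cdot> amap ?H (c i)) \<cdot> ?in2 (omap D i) = k i \<cdot> ?in2 (omap D i)" if "i \<in> Ob J" for i
          using f that by simp_all
        have "f \<cdot> ?in1 X = p"
          by (rule colimit_joint_epi[OF J.category is_functor_comp[OF D FF] colF _ p(1)])
            (use fk(1) p(2) in \<open>simp_all add: hom_iff\<close>)
        moreover have "f \<cdot> ?in2 X = q"
          by (rule colimit_joint_epi[OF J.category is_functor_comp[OF D GF] colG _ q(1)])
            (use fk(2) q(2) in \<open>simp_all add: hom_iff\<close>)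
        ultimately show "f = copair C p q"
          by - (rule copair_ext[of _ _ "omap F X" "omap G X"], auto)
      qed
    qed
  qed
  then show ?thesis using H by (simp add: cocontinuous_def)
qed

lemma func_comp_id: "func_comp id_func (D :: ('i, 'j, 'o, 'm) func) = D"
  by (simp add: func_comp_def id_func_def)

lemma cocontinuous_id:
  assumes "category C"
  shows "cocontinuous U C C id_func"
  using is_functor_id[OF assms]
  unfolding cocontinuous_def preserves_colimits_def func_comp_id by (simp add: id_func_def)

locale structural_law = law C Sig Gam S e d + lfp_cat C U
  for C :: "('o, 'm) cat" (structure) and Sig Gam S e d and U :: "'u itself" +
  assumes law: "simple_structural_law U"
begin

lemma Sig: "is_functor C C Sig" and Gam: "is_functor (prod_cat C C) C Gam"
  and S_free: "free_monad C Sig S e"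
  and d_nat_trans: "nat_trans (prod_cat C C) C d_source d_target d"
  using law by (auto simp: simple_structural_law_def finitary_def)

sublocale S: cat_monad C S
  by unfold_locales (use S_free in \<open>simp add: free_monad_def\<close>)

lemmas Sig_simps [simp] = functor_simps[OF category Sig]
lemmas Sig_Cmp = functor_Cmp[OF category Sig]

lemma Gam_Ob [simp]: "X \<in> Ob C \<Longrightarrow> Y \<in> Ob C \<Longrightarrow> \<Gamma>o X Y \<in> Ob C"
  using Gam by (auto simp: is_functor_def prod_cat_def)

lemma prod_hom: "(f, g) \<in> hom (prod_cat C C) (X, X') (Y, Y') \<longleftrightarrow> f \<in> hom C X Y \<and> g \<in> hom C X' Y'"
  by (auto simp: prod_cat_def hom_iff)

lemma Gam_simps [simp]:
  assumes "f \<in> Mor C" "g \<in> Mor C"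
  shows "\<Gamma>m f g \<in> Mor C" "Dom C (\<Gamma>m f g) = \<Gamma>o (Dom C f) (Dom C g)"
    "Cod C (\<Gamma>m f g) = \<Gamma>o (Cod C f) (Cod C g)"
proof -
  have "(f, g) \<in> hom (prod_cat C C) (Dom C f, Dom C g) (Cod C f, Cod C g)"
    unfolding prod_hom using assms by (simp add: hom_iff)
  then have "\<Gamma>m f g \<in> hom C (\<Gamma>o (Dom C f) (Dom C g)) (\<Gamma>o (Cod C f) (Cod C g))"
    using Gam unfolding is_functor_def by blast
  then show "\<Gamma>m f g \<in> Mor C" "Dom C (\<Gamma>m f g) = \<Gamma>o (Dom C f) (Dom C g)"
    "Cod C (\<Gamma>m f g) = \<Gamma>o (Cod C f) (Cod C g)"
    by (auto simp: hom_iff)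
qed

lemma Gam_Ide [simp]: "X \<in> Ob C \<Longrightarrow> Y \<in> Ob C \<Longrightarrow> \<Gamma>m (idm X) (idm Y) = idm (\<Gamma>o X Y)"
  using Gam by (auto simp: is_functor_def prod_cat_def)

lemma Gam_Cmp [simp]:
  assumes "f \<in> Mor C" "g \<in> Mor C" "f' \<in> Mor C" "g' \<in> Mor C" "Cod C f = Dom C f'" "Cod C g = Dom C g'"
  shows "\<Gamma>m f' g' \<cdot> \<Gamma>m f g = \<Gamma>m (f' \<cdot> f) (g' \<cdot> g)"
    and "x \<in> Mor C \<Longrightarrow> Cod C x = \<Gamma>o (Dom C f) (Dom C g) \<Longrightarrow>
      \<Gamma>m f' g' \<cdot> \<Gamma>m f g \<cdot> x = \<Gamma>m (f' \<cdot> f) (g' \<cdot> g) \<cdot> x"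
proof -
  have "(f, g) \<in> hom (prod_cat C C) (Dom C f, Dom C g) (Cod C f, Cod C g)"
    "(f', g') \<in> hom (prod_cat C C) (Cod C f, Cod C g) (Cod C f', Cod C g')"
    unfolding prod_hom using assms by (simp_all add: hom_iff)
  then have "amap Gam ((f', g') \<cdot>\<^bsub>prod_cat C C\<^esub> (f, g)) = \<Gamma>m f' g' \<cdot> \<Gamma>m f g"
    using Gam unfolding is_functor_def by blast
  then show *: "\<Gamma>m f' g' \<cdot> \<Gamma>m f g = \<Gamma>m (f' \<cdot> f) (g' \<cdot> g)"
    by (simp add: prod_cat_def)
  show "x \<in> Mor C \<Longrightarrow> Cod C x = \<Gamma>o (Dom C f) (Dom C g) \<Longrightarrow>
      \<Gamma>m f' g' \<cdot> \<Gamma>m f g \<cdot> x = \<Gamma>m (f' \<cdot> f) (g' \<cdot> g) \<cdot> x"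
    by (rule Cmp_pre[OF *]) (use assms in auto)
qed

lemma e_simps [simp]:
  assumes "X \<in> Ob C"
  shows "e X \<in> Mor C" "Dom C (e X) = omap Sig X" "Cod C (e X) = So X"
  using S_free assms by (auto simp: free_monad_def nat_trans_def hom_iff)

lemma e_nat:
  assumes "f \<in> Mor C" "Cod C f = Y"
  shows "e Y \<cdot> amap Sig f = Sm f \<cdot> e (Dom C f)"
    and "x \<in> Mor C \<Longrightarrow> Cod C x = omap Sig (Dom C f) \<Longrightarrow> e Y \<cdot> amap Sig f \<cdot> x = Sm f \<cdot> e (Dom C f) \<cdot> x"
proof -
  have Y: "Y \<in> Ob C" using assms by auto
  have "nat_trans C C Sig S e" using S_free by (simp add: free_monad_def)
  from nat_trans_comm[OF this assms(1) refl assms(2)]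
  show *: "e Y \<cdot> amap Sig f = Sm f \<cdot> e (Dom C f)" .
  show "x \<in> Mor C \<Longrightarrow> Cod C x = omap Sig (Dom C f) \<Longrightarrow> e Y \<cdot> amap Sig f \<cdot> x = Sm f \<cdot> e (Dom C f) \<cdot> x"
    using Cmp_pre[OF *, of x] assms Y by simp
qed

lemma d_simps [simp]:
  assumes "X \<in> Ob C" "Y \<in> Ob C"
  shows "d (X, Y) \<in> Mor C" "Dom C (d (X, Y)) = \<Gamma>o (omap Sig X) Y"
    "Cod C (d (X, Y)) = So (\<Gamma>o X (So Y) \<oplus> X \<oplus> Y)"
  using d_nat_trans assms
  by (auto simp: nat_trans_def prod_cat_def d_source_def d_target_def hom_iff)

lemma d_nat:
  assumes "f \<in> Mor C" "g \<in> Mor C" "Cod C f = Y" "Cod C g = Y'"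
  shows "d (Y, Y') \<cdot> \<Gamma>m (amap Sig f) g = Sm (\<Gamma>m f (Sm g) \<boxplus> f \<boxplus> g) \<cdot> d (Dom C f, Dom C g)"
    and "x \<in> Mor C \<Longrightarrow> Cod C x = \<Gamma>o (omap Sig (Dom C f)) (Dom C g) \<Longrightarrow>
      d (Y, Y') \<cdot> \<Gamma>m (amap Sig f) g \<cdot> x = Sm (\<Gamma>m f (Sm g) \<boxplus> f \<boxplus> g) \<cdot> d (Dom C f, Dom C g) \<cdot> x"
proof -
  have Y: "Y \<in> Ob C" "Y' \<in> Ob C" using assms by auto
  have "(f, g) \<in> hom (prod_cat C C) (Dom C f, Dom C g) (Y, Y')"
    unfolding prod_hom using assms by (simp_all add: hom_iff)
  then have "d (Y, Y') \<cdot> amap d_source (f, g) = amap d_target (f, g) \<cdot> d (Dom C f, Dom C g)"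
    using d_nat_trans unfolding nat_trans_def by blast
  then show *: "d (Y, Y') \<cdot> \<Gamma>m (amap Sig f) g = Sm (\<Gamma>m f (Sm g) \<boxplus> f \<boxplus> g) \<cdot> d (Dom C f, Dom C g)"
    by (simp add: d_source_def d_target_def)
  show "x \<in> Mor C \<Longrightarrow> Cod C x = \<Gamma>o (omap Sig (Dom C f)) (Dom C g) \<Longrightarrow>
      d (Y, Y') \<cdot> \<Gamma>m (amap Sig f) g \<cdot> x = Sm (\<Gamma>m f (Sm g) \<boxplus> f \<boxplus> g) \<cdot> d (Dom C f, Dom C g) \<cdot> x"
    using Cmp_pre[OF *, of x] assms Y by simp
qed

text \<open>\<open>L_fun Y\<close> is the sum of the cocontinuous functor \<Gamma>(-,SY) and the
  identity, so some right adjoint exists and the choice made in \<open>R_adj\<close> picks a genuine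
  adjunction.\<close>

lemma adjunction_L_fun:
  assumes "Y \<in> Ob C"
  shows "cat_adjunction C (L_fun Y) (R_fun Y) (R_unit Y) (R_counit Y)"
proof -
  have "cocontinuous U C C \<lparr>omap = (\<lambda>X. \<Gamma>o X (So Y)), amap = (\<lambda>f. \<Gamma>m f (idm (So Y)))\<rparr>"
    using law assms by (simp add: simple_structural_law_def)
  from cocontinuous_sum[OF this cocontinuous_id[OF category]]
  have "cocontinuous U C C (L_fun Y)"
    by (simp add: L_fun_def id_func_def)
  then obtain R u v where "adjunction C C (L_fun Y) R u v"
    using cocontinuous_left_adjoint by blast
  then have "\<exists>p. adjunction C C (L_fun Y) (fst p) (fst (snd p)) (snd (snd p))" by auto
  from someI_ex[OF this] have "adjunction C C (L_fun Y) (R_fun Y) (R_unit Y) (R_counit Y)"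
    unfolding R_fun_def R_unit_def R_counit_def R_adj_def case_prod_beta .
  then show ?thesis by unfold_locales
qed

lemma monad_K_mnd:
  assumes "Y \<in> Ob C"
  shows "monad C (K_mnd Y)"
  unfolding monad_def is_functor_def nat_trans_def id_func_def func_comp_def func.select_convs
    mnd.select_convs K_mnd_def
proof (intro conjI ballI allI)
qed (use assms in \<open>simp_all add: hom_iff msum_def copair_eta\<close>)

lemma h_tr_simps:
  assumes "X \<in> Ob C" "Y \<in> Ob C"
  shows "h1 X Y \<in> Mor C" "Dom C (h1 X Y) = \<Gamma>o (omap Sig X) (So Y)"
    "Cod C (h1 X Y) = So (\<Gamma>o X (So Y) \<oplus> X \<oplus> Y)"
    "h2 X Y \<in> Mor C" "Dom C (h2 X Y) = omap Sig X" "Cod C (h2 X Y) = So (\<Gamma>o X (So Y) \<oplus> X \<oplus> Y)"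
  using assms by (auto simp: h1_def h2_def Let_def msum_def)


text \<open>All maps after d are merged into one multiplication after one image under S. The
  copairing displays what happens to each summand: SSY is multiplied out inside \<Gamma>, X is a
  variable, and a term in SY is embedded as a term over the last summand.\<close>

lemma h1_eq:
  assumes "X \<in> Ob C" "Y \<in> Ob C"
  shows "h1 X Y = Mu S (\<Gamma>o X (So Y) \<oplus> X \<oplus> Y) \<cdot>
    Sm (copair C (copair C (Eta S (\<Gamma>o X (So Y) \<oplus> X \<oplus> Y) \<cdot> in1 C (\<Gamma>o X (So Y) \<oplus> X) Y \<cdot> in1 C (\<Gamma>o X (So Y)) X \<cdot> \<Gamma>m (idm X) (Mu S Y))
      (Eta S (\<Gamma>o X (So Y) \<oplus> X \<oplus> Y) \<cdot> in1 C (\<Gamma>o X (So Y) \<oplus> X) Y \<cdot> in2 C (\<Gamma>o X (So Y)) X))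
      (Sm (in2 C (\<Gamma>o X (So Y) \<oplus> X) Y))) \<cdot> d (X, So Y)"
  using assms by (simp add: h1_def Let_def msum_def)

lemma h_tr_nat:
  assumes "f \<in> Mor C" "Dom C f = X" "Cod C f = X'" "Y \<in> Ob C"
  shows "h_tr X' Y \<cdot> amap (L_fun Y) (amap Sig f) = amap (K_mnd Y) (amap (L_fun Y) f) \<cdot> h_tr X Y"
proof -
  have [simp]: "X \<in> Ob C" "X' \<in> Ob C" using assms by auto
  have "h1 X' Y \<cdot> \<Gamma>m (amap Sig f) (idm (So Y)) = amap (K_mnd Y) (amap (L_fun Y) f) \<cdot> h1 X Y"
    using assms by (simp add: h1_eq K_mnd_def L_fun_def msum_def d_nat)
  moreover have "h2 X' Y \<cdot> amap Sig f = amap (K_mnd Y) (amap (L_fun Y) f) \<cdot> h2 X Y"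
    using assms by (simp add: h2_def K_mnd_def L_fun_def msum_def e_nat)
  moreover have "amap (K_mnd Y) (amap (L_fun Y) f) \<in> Mor C"
    "Dom C (amap (K_mnd Y) (amap (L_fun Y) f)) = So (\<Gamma>o X (So Y) \<oplus> X \<oplus> Y)"
    "Cod C (amap (K_mnd Y) (amap (L_fun Y) f)) = So (\<Gamma>o X' (So Y) \<oplus> X' \<oplus> Y)"
    using assms by (simp_all add: K_mnd_def L_fun_def)
  moreover have "amap (L_fun Y) (amap Sig f) = copair C
      (in1 C (\<Gamma>o (omap Sig X') (So Y)) (omap Sig X') \<cdot> \<Gamma>m (amap Sig f) (idm (So Y)))
      (in2 C (\<Gamma>o (omap Sig X') (So Y)) (omap Sig X') \<cdot> amap Sig f)"
    using assms by (simp add: L_fun_def msum_def)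
  ultimately show ?thesis
    using assms h_tr_simps[of X Y] h_tr_simps[of X' Y] by (simp add: h_tr_def)
qed

section \<open>The monad morphism behind \<open>d_hat\<close> and its recursion\<close>

context
  fixes Y assumes Y: "Y \<in> Ob C"
begin

interpretation adj: cat_adjunction C "L_fun Y" "R_fun Y" "R_unit Y" "R_counit Y"
  by (rule adjunction_L_fun[OF Y])

interpretation K: cat_monad C "K_mnd Y"
  by unfold_locales (rule monad_K_mnd[OF Y])

lemma omap_L [simp]: "omap (L_fun Y) X = \<Gamma>o X (So Y) \<oplus> X"
  by (simp add: L_fun_def)

lemma omap_K [simp]: "omap (K_mnd Y) X = So (X \<oplus> Y)"
  by (simp add: K_mnd_def)

lemma monad_RKL_mnd: "monad C (RKL_mnd Y)"
  using adj.monad_RKL[OF K.monad] unfolding RKL_mnd_def Let_def .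

lemma h_tr_typing [simp]:
  assumes "X \<in> Ob C"
  shows "h_tr X Y \<in> Mor C" "Dom C (h_tr X Y) = \<Gamma>o (omap Sig X) (So Y) \<oplus> omap Sig X"
    "Cod C (h_tr X Y) = So (\<Gamma>o X (So Y) \<oplus> X \<oplus> Y)"
  using assms Y h_tr_simps[of X Y] by (auto simp: h_tr_def)

lemma h_transpose_nat: "nat_trans C C Sig (RKL_mnd Y) (h_transpose Y)"
  unfolding nat_trans_def RKL_mnd_def Let_def mnd.simps func.select_convs h_transpose_def
proof (intro conjI ballI allI)
  fix X assume "X \<in> Ob C"
  then show "amap (R_fun Y) (h_tr X Y) \<cdot> R_unit Y (omap Sig X) \<in>
      hom C (omap Sig X) (omap (R_fun Y) (omap (K_mnd Y) (omap (L_fun Y) X)))"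
    by (simp add: hom_iff)
next
  fix X X' f assume f: "f \<in> hom C X X'"
  then have [simp]: "f \<in> Mor C" "Dom C f = X" "Cod C f = X'" "X \<in> Ob C" "X' \<in> Ob C"
    by (auto simp: hom_iff)
  have [simp]: "h_tr X' Y \<cdot> amap (L_fun Y) (amap Sig f) = amap (K_mnd Y) (amap (L_fun Y) f) \<cdot> h_tr X Y"
    by (rule h_tr_nat) (auto simp: Y)
  show "(amap (R_fun Y) (h_tr X' Y) \<cdot> R_unit Y (omap Sig X')) \<cdot> amap Sig f =
      amap (R_fun Y) (amap (K_mnd Y) (amap (L_fun Y) f)) \<cdot> amap (R_fun Y) (h_tr X Y) \<cdot> R_unit Y (omap Sig X)"
    by (rule adj.transpose_inject[where X = "omap (K_mnd Y) (omap (L_fun Y) X')"]) (simp_all add: Y)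
qed

lemma h_ext: "extends C S e (RKL_mnd Y) (h_transpose Y) (h_ext Y)"
proof -
  have "\<exists>p. extends C S e (RKL_mnd Y) (h_transpose Y) p"
    using S_free monad_RKL_mnd h_transpose_nat unfolding free_monad_def by blast
  then show ?thesis unfolding h_ext_def by (rule someI_ex)
qed

text \<open>The whole transpose of the monad morphism, of which \<open>d_hat\<close> is the
  restriction to the first summand. The second summand is kept because the recursion refers to
  both.\<close>

definition h_hat :: "'o \<Rightarrow> 'm" where
  "h_hat X = R_counit Y (omap (K_mnd Y) (omap (L_fun Y) X)) \<cdot> amap (L_fun Y) (h_ext Y X)"

lemma h_ext_simps [simp]:
  assumes "X \<in> Ob C"
  shows "h_ext Y X \<in> Mor C" "Dom C (h_ext Y X) = So X"
    "Cod C (h_ext Y X) = omap (R_fun Y) (So (\<Gamma>o X (So Y) \<oplus> X \<oplus> Y))"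
  using h_ext assms
  by (auto simp: extends_def monad_morphism_def nat_trans_def RKL_mnd_def Let_def hom_iff)

lemma h_hat_simps [simp]:
  assumes "X \<in> Ob C"
  shows "h_hat X \<in> Mor C" "Dom C (h_hat X) = \<Gamma>o (So X) (So Y) \<oplus> So X"
    "Cod C (h_hat X) = So (\<Gamma>o X (So Y) \<oplus> X \<oplus> Y)"
  using assms Y by (auto simp: h_hat_def)

lemma h_hat_Eta:
  assumes X [simp]: "X \<in> Ob C"
  shows "h_hat X \<cdot> amap (L_fun Y) (Eta S X) = Eta (K_mnd Y) (omap (L_fun Y) X)"
proof -
  note [simp] = Y
  have "h_ext Y X \<cdot> Eta S X = amap (R_fun Y) (Eta (K_mnd Y) (omap (L_fun Y) X)) \<cdot> R_unit Y X"
    using h_ext X by (simp add: extends_def monad_morphism_def RKL_mnd_def Let_def del: omap_L omap_K)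
  then have "amap (L_fun Y) (h_ext Y X \<cdot> Eta S X) =
      amap (L_fun Y) (amap (R_fun Y) (Eta (K_mnd Y) (omap (L_fun Y) X)) \<cdot> R_unit Y X)"
    by simp
  then show ?thesis by (simp add: h_hat_def)
qed

text \<open>The multiplication law of \<open>h_ext\<close>, restricted along e to a single layer of
  operations and transposed. Since \<open>h_ext\<close> is prescribed on that layer, this is a
  recursion: it computes \<open>h_hat\<close> on an operation applied to terms from its values on
  those terms.\<close>

lemma h_hat_Mu_e:
  assumes X [simp]: "X \<in> Ob C"
  shows "h_hat X \<cdot> amap (L_fun Y) (Mu S X \<cdot> e (So X)) =
    Mu (K_mnd Y) (omap (L_fun Y) X) \<cdot> amap (K_mnd Y) (h_hat X) \<cdot> h_tr (So X) Y"
proof -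
  note [simp] = Y
  have mu: "h_ext Y X \<cdot> Mu S X = amap (R_fun Y) (Mu (K_mnd Y) (omap (L_fun Y) X) \<cdot>
      amap (K_mnd Y) (R_counit Y (omap (K_mnd Y) (omap (L_fun Y) X)))) \<cdot>
      amap (R_fun Y) (amap (K_mnd Y) (amap (L_fun Y) (h_ext Y X))) \<cdot> h_ext Y (So X)"
    using h_ext X by (simp add: extends_def monad_morphism_def RKL_mnd_def Let_def del: omap_L omap_K)
  have e: "h_ext Y (So X) \<cdot> e (So X) = amap (R_fun Y) (h_tr (So X) Y) \<cdot> R_unit Y (omap Sig (So X))"
    using h_ext by (simp add: extends_def h_transpose_def)
  have "h_ext Y X \<cdot> Mu S X \<cdot> e (So X) = amap (R_fun Y) (Mu (K_mnd Y) (omap (L_fun Y) X) \<cdot>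
      amap (K_mnd Y) (R_counit Y (omap (K_mnd Y) (omap (L_fun Y) X)))) \<cdot>
      amap (R_fun Y) (amap (K_mnd Y) (amap (L_fun Y) (h_ext Y X))) \<cdot>
      amap (R_fun Y) (h_tr (So X) Y) \<cdot> R_unit Y (omap Sig (So X))"
    using Cmp_pre[OF mu, of "e (So X)"] by (simp add: e)
  then have "amap (L_fun Y) (h_ext Y X \<cdot> Mu S X \<cdot> e (So X)) = amap (L_fun Y) (amap (R_fun Y) (Mu (K_mnd Y) (omap (L_fun Y) X) \<cdot>
      amap (K_mnd Y) (R_counit Y (omap (K_mnd Y) (omap (L_fun Y) X)))) \<cdot>
      amap (R_fun Y) (amap (K_mnd Y) (amap (L_fun Y) (h_ext Y X))) \<cdot>
      amap (R_fun Y) (h_tr (So X) Y) \<cdot> R_unit Y (omap Sig (So X)))"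
    by simp
  then show ?thesis by (simp add: h_hat_def)
qed

lemma d_hat_simps [simp]:
  assumes "X \<in> Ob C"
  shows "d_hat X Y \<in> Mor C" "Dom C (d_hat X Y) = \<Gamma>o (So X) (So Y)"
    "Cod C (d_hat X Y) = So (\<Gamma>o X (So Y) \<oplus> X \<oplus> Y)"
  using assms Y by (auto simp: d_hat_def)

lemma d_hat_eq:
  assumes "X \<in> Ob C"
  shows "d_hat X Y = h_hat X \<cdot> in1 C (\<Gamma>o (So X) (So Y)) (So X)"
  using assms Y by (simp add: d_hat_def h_hat_def)

lemma d_hat_Eta:
  assumes X [simp]: "X \<in> Ob C"
  shows "d_hat X Y \<cdot> \<Gamma>m (Eta S X) (idm (So Y)) =
    Eta S (\<Gamma>o X (So Y) \<oplus> X \<oplus> Y) \<cdot> in1 C (\<Gamma>o X (So Y) \<oplus> X) Y \<cdot> in1 C (\<Gamma>o X (So Y)) X"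
proof -
  note [simp] = Y
  from arg_cong[OF h_hat_Eta[OF X], of "\<lambda>h. h \<cdot> in1 C (\<Gamma>o X (So Y)) X"]
  show ?thesis by (simp add: L_fun_def msum_def K_mnd_def d_hat_eq)
qed

lemma h_hat_in2_Eta:
  assumes X [simp]: "X \<in> Ob C"
  shows "h_hat X \<cdot> in2 C (\<Gamma>o (So X) (So Y)) (So X) \<cdot> Eta S X =
    Eta S (\<Gamma>o X (So Y) \<oplus> X \<oplus> Y) \<cdot> in1 C (\<Gamma>o X (So Y) \<oplus> X) Y \<cdot> in2 C (\<Gamma>o X (So Y)) X"
proof -
  note [simp] = Y
  from arg_cong[OF h_hat_Eta[OF X], of "\<lambda>h. h \<cdot> in2 C (\<Gamma>o X (So Y)) X"]
  show ?thesis by (simp add: L_fun_def msum_def K_mnd_def)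
qed

lemma Mu_K_hh:
  assumes X [simp]: "X \<in> Ob C"
  shows "Mu (K_mnd Y) (omap (L_fun Y) X) \<cdot> amap (K_mnd Y) (h_hat X) =
    Mu S (\<Gamma>o X (So Y) \<oplus> X \<oplus> Y) \<cdot>
      Sm (copair C (h_hat X) (Eta S (\<Gamma>o X (So Y) \<oplus> X \<oplus> Y) \<cdot> in2 C (\<Gamma>o X (So Y) \<oplus> X) Y))"
  using Y by (simp add: K_mnd_def msum_def)

text \<open>On the second summand the recursion involves only \<open>h2\<close> and states that the
  restriction of \<open>h_hat\<close> is a morphism of \<Sigma>-algebras out of the free algebra SX.
  As such it is determined on X, where \<open>h_hat_in2_Eta\<close> gives its value.\<close>

lemma h_hat_in2:
  assumes X [simp]: "X \<in> Ob C"
  shows "h_hat X \<cdot> in2 C (\<Gamma>o (So X) (So Y)) (So X) = Sm (in1 C (\<Gamma>o X (So Y) \<oplus> X) Y \<cdot> in2 C (\<Gamma>o X (So Y)) X)"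
    (is "?j = _")
proof -
  note [simp] = Y
  let ?Z = "\<Gamma>o X (So Y) \<oplus> X \<oplus> Y"
  define Z where "Z = ?Z"
  have Z [simp]: "Z \<in> Ob C" by (simp add: Z_def)
  define j where "j = ?j"
  have j [simp]: "j \<in> Mor C" "Dom C j = So X" "Cod C j = So Z"
    by (simp_all add: j_def Z_def)
  \<comment> \<open>The right-associated form is undone so that \<open>Mu_K_hh\<close> can rewrite
    the first two factors as one block.\<close>
  have 1: "Mu (K_mnd Y) (omap (L_fun Y) X) \<cdot> amap (K_mnd Y) (h_hat X) \<cdot> h_tr (So X) Y =
      (Mu (K_mnd Y) (omap (L_fun Y) X) \<cdot> amap (K_mnd Y) (h_hat X)) \<cdot> h_tr (So X) Y"
    by (rule Cmp_assoc[symmetric]) simp_all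
  have "j \<cdot> Mu S X \<cdot> e (So X) =
      (Mu S Z \<cdot> Sm (copair C (h_hat X) (Eta S Z \<cdot> in2 C (\<Gamma>o X (So Y) \<oplus> X) Y))) \<cdot> h2 (So X) Y"
    using arg_cong[OF h_hat_Mu_e[OF X], of "\<lambda>h. h \<cdot> in2 C (\<Gamma>o (omap Sig (So X)) (So Y)) (omap Sig (So X))"]
      h_tr_simps[of "So X" Y]
    unfolding 1 Mu_K_hh[OF X] Z_def j_def
    by (simp add: L_fun_def msum_def h_tr_def)
  also have "\<dots> = (Mu S Z \<cdot> e (So Z)) \<cdot> amap Sig j"
    by (simp add: h2_def e_nat) (simp add: j_def Z_def)
  finally have "j \<cdot> Mu S X \<cdot> e (So X) = (Mu S Z \<cdot> e (So Z)) \<cdot> amap Sig j" .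
  then have "j \<cdot> Mu S X = Mu S Z \<cdot> Sm j"
    by (intro free_algebra_hom[OF Sig S_free]) (auto simp: hom_iff monad_algebra_def)
  from arg_cong[OF this, of "\<lambda>h. h \<cdot> Sm (Eta S X)"]
  have "j = Mu S Z \<cdot> Sm (j \<cdot> Eta S X)"
    by simp
  also have "j \<cdot> Eta S X = Eta S Z \<cdot> in1 C (\<Gamma>o X (So Y) \<oplus> X) Y \<cdot> in2 C (\<Gamma>o X (So Y)) X"
    using h_hat_in2_Eta[OF X] by (simp add: j_def Z_def)
  finally show ?thesis
    by (simp add: j_def Z_def)
qed

text \<open>The first component of the recursion for \<open>h_hat\<close>, closed up by inserting
  the known second component. From here on the adjunction is no longer visible in statements about
  \<open>d_hat\<close>.\<close>

lemma d_hat_Mu_e: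
  assumes X [simp]: "X \<in> Ob C"
  defines "Z \<equiv> \<Gamma>o X (So Y) \<oplus> X \<oplus> Y"
  shows "d_hat X Y \<cdot> \<Gamma>m (Mu S X \<cdot> e (So X)) (idm (So Y)) =
    Mu S Z \<cdot> Sm (copair C (copair C (d_hat X Y) (Sm (in1 C (\<Gamma>o X (So Y) \<oplus> X) Y \<cdot> in2 C (\<Gamma>o X (So Y)) X)))
      (Eta S Z \<cdot> in2 C (\<Gamma>o X (So Y) \<oplus> X) Y)) \<cdot> h1 (So X) Y"
proof -
  note [simp] = Y
  have 1: "Mu (K_mnd Y) (omap (L_fun Y) X) \<cdot> amap (K_mnd Y) (h_hat X) \<cdot> h_tr (So X) Y =
      (Mu (K_mnd Y) (omap (L_fun Y) X) \<cdot> amap (K_mnd Y) (h_hat X)) \<cdot> h_tr (So X) Y"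
    by (rule Cmp_assoc[symmetric]) simp_all
  have h_hat: "h_hat X = copair C (d_hat X Y) (Sm (in1 C (\<Gamma>o X (So Y) \<oplus> X) Y \<cdot> in2 C (\<Gamma>o X (So Y)) X))"
    unfolding d_hat_eq[OF X] h_hat_in2[OF X, symmetric] by (rule copair_eta[symmetric]) simp_all
  have "d_hat X Y \<cdot> \<Gamma>m (Mu S X \<cdot> e (So X)) (idm (So Y)) =
      (Mu S Z \<cdot> Sm (copair C (h_hat X) (Eta S Z \<cdot> in2 C (\<Gamma>o X (So Y) \<oplus> X) Y))) \<cdot> h1 (So X) Y"
    using arg_cong[OF h_hat_Mu_e[OF X], of "\<lambda>h. h \<cdot> in1 C (\<Gamma>o (omap Sig (So X)) (So Y)) (omap Sig (So X))"]
      h_tr_simps[of "So X" Y]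
    unfolding 1 Mu_K_hh[OF X] Z_def d_hat_eq[OF X]
    by (simp add: L_fun_def msum_def h_tr_def)
  then show ?thesis
    using h_tr_simps[of "So X" Y] unfolding h_hat by (simp add: Z_def)
qed

end

section \<open>Algebras of a structural law on free \<Sigma>-algebras\<close>

lemma S_free_algebra: "X \<in> Ob C \<Longrightarrow> monad_algebra C S (So X) (Mu S X)"
  by (simp add: monad_algebra_def hom_iff)

lemma S_algebra_pre:
  assumes "monad_algebra C S X a"
  shows "x \<in> Mor C \<Longrightarrow> Cod C x = X \<Longrightarrow> a \<cdot> Eta S X \<cdot> x = x"
    and "x \<in> Mor C \<Longrightarrow> Cod C x = So (So X) \<Longrightarrow> a \<cdot> Mu S X \<cdot> x = a \<cdot> Sm a \<cdot> x"
proof -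
  note a = monad_algebraD[OF assms]
  show "x \<in> Mor C \<Longrightarrow> Cod C x = X \<Longrightarrow> a \<cdot> Eta S X \<cdot> x = x"
    using Cmp_pre[OF a(5), of x] a by simp
  show "x \<in> Mor C \<Longrightarrow> Cod C x = So (So X) \<Longrightarrow> a \<cdot> Mu S X \<cdot> x = a \<cdot> Sm a \<cdot> x"
    using Cmp_pre[OF a(6), of x] a by simp
qed

text \<open>An algebra of the law, given by the S-algebra \<alpha> in place of the \<Sigma>-algebra
  \<open>\<alpha> \<cdot> e X\<close> that determines it. This eliminates \<open>induced_alg\<close>
  from the equation, in which b and its second argument are also merged.\<close>

definition law_algebra :: "'o \<Rightarrow> 'm \<Rightarrow> 'm \<Rightarrow> bool" where
  "law_algebra X \<alpha> b \<longleftrightarrow> monad_algebra C S X \<alpha> \<and> b \<in> hom C (\<Gamma>o X X) X \<and>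
    b \<cdot> \<Gamma>m (\<alpha> \<cdot> e X) (idm X) =
      \<alpha> \<cdot> Sm (copair C (copair C (b \<cdot> \<Gamma>m (idm X) \<alpha>) (idm X)) (idm X)) \<cdot> d (X, X)"

lemma L_algebra_eq:
  assumes "monad_algebra C S X \<alpha>" "b \<in> hom C (\<Gamma>o X X) X"
  shows "\<alpha> \<cdot> Sm (copair C (copair C b (idm X)) (idm X)) \<cdot> Sm (\<Gamma>m (idm X) \<alpha> \<boxplus> idm X \<boxplus> idm X) \<cdot> d (X, X) =
    \<alpha> \<cdot> Sm (copair C (copair C (b \<cdot> \<Gamma>m (idm X) \<alpha>) (idm X)) (idm X)) \<cdot> d (X, X)"
  using monad_algebraD(1-4)[OF assms(1)] assms(2) by (simp add: hom_iff msum_def)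

lemma L_algebra_iff:
  "L_algebra X a b \<longleftrightarrow> X \<in> Ob C \<and> a \<in> hom C (omap Sig X) X \<and> law_algebra X (induced_alg C S e X a) b"
proof (cases "X \<in> Ob C \<and> a \<in> hom C (omap Sig X) X \<and> b \<in> hom C (\<Gamma>o X X) X")
  case True
  note ind = induced_alg[OF Sig S_free, of X a]
  show ?thesis
    using True ind unfolding L_algebra_def law_algebra_def Let_def
    by (simp add: L_algebra_eq)
qed (auto simp: L_algebra_def law_algebra_def)

lemma L_algebra_of_law_algebra:
  assumes "law_algebra X \<alpha> b"
  shows "L_algebra X (\<alpha> \<cdot> e X) b" "induced_alg C S e X (\<alpha> \<cdot> e X) = \<alpha>"
proof -
  have \<alpha>: "monad_algebra C S X \<alpha>" using assms by (simp add: law_algebra_def)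
  show "induced_alg C S e X (\<alpha> \<cdot> e X) = \<alpha>"
    by (rule induced_alg_eqI[OF Sig S_free \<alpha> refl])
  then show "L_algebra X (\<alpha> \<cdot> e X) b"
    using assms monad_algebraD[OF \<alpha>] by (simp add: L_algebra_iff hom_iff)
qed

text \<open>Transposing along the adjunction L_fun X, the recursion says that [g, k] corresponds to a
  morphism of \<Sigma>-algebras from the free one on X, which is determined by its restriction to X.\<close>

lemma recursion_unique:
  assumes X: "X \<in> Ob C" and \<beta>: "monad_algebra C S B \<beta>"
    and k: "k \<in> hom C (So X) B" "k \<cdot> Mu S X = \<beta> \<cdot> Sm k"
    and g: "\<And>i. g i \<in> hom C (\<Gamma>o (So X) (So X)) B"
      "\<And>i. g i \<cdot> \<Gamma>m (Mu S X \<cdot> e (So X)) (idm (So X)) =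
        \<beta> \<cdot> Sm (copair C (copair C (g i \<cdot> \<Gamma>m (idm (So X)) (Mu S X)) k) k) \<cdot> d (So X, So X)"
    and start: "\<And>i j. g i \<cdot> \<Gamma>m (Eta S X) (idm (So X)) = g j \<cdot> \<Gamma>m (Eta S X) (idm (So X))"
  shows "g (i :: bool) = g j"
proof -
  note [simp] = X monad_algebraD(1-4)[OF \<beta>]
  have ks [simp]: "k \<in> Mor C" "Dom C k = So X" "Cod C k = B" using k(1) by (auto simp: hom_iff)
  have gs [simp]: "g i \<in> Mor C" "Dom C (g i) = \<Gamma>o (So X) (So X)" "Cod C (g i) = B" for i
    using g(1)[of i] by (auto simp: hom_iff)
  interpret adj: cat_adjunction C "L_fun X" "R_fun X" "R_unit X" "R_counit X"
    by (rule adjunction_L_fun[OF X])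
  note omap_L [simp] = omap_L[OF X]
  define Q where "Q = omap (R_fun X) B"
  define v where "v = R_counit X B"
  have Q [simp]: "Q \<in> Ob C" by (simp add: Q_def)
  have v [simp]: "v \<in> Mor C" "Dom C v = \<Gamma>o Q (So X) \<oplus> Q" "Cod C v = B"
    by (simp_all add: v_def Q_def)
  \<comment> \<open>The components of the counit form the universal pair: a morphism from W to Q
    amounts to a pair of morphisms from \<Gamma>(W,SX) and from W to B.\<close>
  define v1 where "v1 = v \<cdot> in1 C (\<Gamma>o Q (So X)) Q"
  define v2 where "v2 = v \<cdot> in2 C (\<Gamma>o Q (So X)) Q"
  have v1 [simp]: "v1 \<in> Mor C" "Dom C v1 = \<Gamma>o Q (So X)" "Cod C v1 = B"
    and v2 [simp]: "v2 \<in> Mor C" "Dom C v2 = Q" "Cod C v2 = B"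
    by (simp_all add: v1_def v2_def)
  \<comment> \<open>The right side of the recursion with the universal pair (v1, v2) in place of (g,
    k). The last summand of the target of d comes from the second argument, which is fixed to SX, so
    k remains there. Transposing \<open>r\<close> turns Q into a \<Sigma>-algebra for which v2 is a
    morphism to B.\<close>
  define r1 where "r1 = \<beta> \<cdot> Sm (copair C (copair C (v1 \<cdot> \<Gamma>m (idm Q) (Mu S X)) v2) k) \<cdot> d (Q, So X)"
  have r1 [simp]: "r1 \<in> Mor C" "Dom C r1 = \<Gamma>o (omap Sig Q) (So X)" "Cod C r1 = B"
    by (simp_all add: r1_def)
  define r where "r = copair C r1 (\<beta> \<cdot> e B \<cdot> amap Sig v2)"
  have r [simp]: "r \<in> Mor C" "Dom C r = omap (L_fun X) (omap Sig Q)" "Cod C r = B"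
    by (simp_all add: r_def)
  define \<rho> where "\<rho> = amap (R_fun X) r \<cdot> R_unit X (omap Sig Q)"
  have \<rho> [simp]: "\<rho> \<in> Mor C" "Dom C \<rho> = omap Sig Q" "Cod C \<rho> = Q"
    by (simp_all add: \<rho>_def Q_def)
  define \<gamma> where "\<gamma> = induced_alg C S e Q \<rho>"
  have \<gamma>: "monad_algebra C S Q \<gamma>" "\<gamma> \<cdot> e Q = \<rho>"
    unfolding \<gamma>_def using induced_alg[OF Sig S_free, of Q \<rho>] by (auto simp: hom_iff)
  define G where "G i = amap (R_fun X) (copair C (g i) k) \<cdot> R_unit X (So X)" for i
  have G [simp]: "G i \<in> Mor C" "Dom C (G i) = So X" "Cod C (G i) = Q" for i
    by (simp_all add: G_def Q_def)
  have vG: "v \<cdot> amap (L_fun X) (G i) = copair C (g i) k" for i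
    by (simp add: G_def v_def)
  have v1G: "v1 \<cdot> \<Gamma>m (G i) (idm (So X)) = g i" for i
    using arg_cong[OF vG[of i], of "\<lambda>h. h \<cdot> in1 C (\<Gamma>o (So X) (So X)) (So X)"]
    by (simp add: L_fun_def msum_def v1_def)
  have v2G: "v2 \<cdot> G i = k" for i
    using arg_cong[OF vG[of i], of "\<lambda>h. h \<cdot> in2 C (\<Gamma>o (So X) (So X)) (So X)"]
    by (simp add: L_fun_def msum_def v2_def)
  \<comment> \<open>Transposed, the first component of this equation is the recursion for g i, and
    the second is the fact that k is a morphism of \<Sigma>-algebras.\<close>
  have Ghom: "G i \<cdot> Mu S X \<cdot> e (So X) = \<rho> \<cdot> amap Sig (G i)" for i
  proof (rule adj.transpose_inject[where X = B])
    have ke: "k \<cdot> Mu S X \<cdot> e (So X) = \<beta> \<cdot> e B \<cdot> amap Sig k"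
      using Cmp_pre[OF k(2), of "e (So X)"] by (simp add: e_nat)
    have v1': "v1 \<cdot> \<Gamma>m (G i) (Mu S X) = g i \<cdot> \<Gamma>m (idm (So X)) (Mu S X)"
      by (simp flip: v1G[of i])
    have ind: "r1 \<cdot> \<Gamma>m (amap Sig (G i)) (idm (So X)) = g i \<cdot> \<Gamma>m (Mu S X \<cdot> e (So X)) (idm (So X))"
      unfolding g(2) r1_def by (simp add: d_nat msum_def v2G v1')
    have "v \<cdot> amap (L_fun X) (G i \<cdot> Mu S X \<cdot> e (So X)) =
        (v \<cdot> amap (L_fun X) (G i)) \<cdot> amap (L_fun X) (Mu S X \<cdot> e (So X))"
      by simp
    also have "\<dots> = copair C (g i \<cdot> \<Gamma>m (Mu S X \<cdot> e (So X)) (idm (So X))) (k \<cdot> Mu S X \<cdot> e (So X))"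
      unfolding vG by (simp add: L_fun_def msum_def)
    also have "\<dots> = r \<cdot> amap (L_fun X) (amap Sig (G i))"
      using v2G[of i] by (simp add: r_def L_fun_def msum_def ind ke flip: Sig_Cmp)
    also have "\<dots> = v \<cdot> amap (L_fun X) (\<rho> \<cdot> amap Sig (G i))"
      by (simp add: \<rho>_def v_def)
    finally show "R_counit X B \<cdot> amap (L_fun X) (G i \<cdot> Mu S X \<cdot> e (So X)) =
        R_counit X B \<cdot> amap (L_fun X) (\<rho> \<cdot> amap Sig (G i))"
      unfolding v_def .
  qed (simp_all add: Q_def[symmetric])
  have GMu: "G i \<cdot> Mu S X = \<gamma> \<cdot> Sm (G i)" for i
    by (rule free_algebra_hom[OF Sig S_free S_free_algebra[OF X] \<gamma>(1)])
      (use Ghom[of i] Cmp_pre[OF \<gamma>(2), of "amap Sig (G i)"] monad_algebraD(2-4)[OF \<gamma>(1)]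
        in \<open>simp_all add: hom_iff\<close>)
  \<comment> \<open>A morphism of S-algebras out of SX is fixed by its restriction to generators, so
    it remains to compare the two transposes there, where \<open>start\<close> applies.\<close>
  have GEta: "G i = \<gamma> \<cdot> Sm (G i \<cdot> Eta S X)" for i
    using arg_cong[OF GMu[of i], of "\<lambda>h. h \<cdot> Sm (Eta S X)"] monad_algebraD[OF \<gamma>(1)] by simp
  have "G i \<cdot> Eta S X = G j \<cdot> Eta S X"
  proof (rule adj.transpose_inject[where X = B])
    have "(v \<cdot> amap (L_fun X) (G i)) \<cdot> amap (L_fun X) (Eta S X) =
        (v \<cdot> amap (L_fun X) (G j)) \<cdot> amap (L_fun X) (Eta S X)"
      unfolding vG using start[of i j] by (simp add: L_fun_def msum_def)
    then show "R_counit X B \<cdot> amap (L_fun X) (G i \<cdot> Eta S X) = R_counit X B \<cdot> amap (L_fun X) (G j \<cdot> Eta S X)"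
      by (simp flip: v_def)
  qed (simp_all add: Q_def[symmetric])
  then have "G i = G j" using GEta[of i] GEta[of j] by simp
  then show ?thesis using v1G[of i] v1G[of j] by simp
qed

text \<open>The operation b of the algebra of the law carried by SX. \<open>lift_alg\<close>
  precomposes it with the multiplication in the second argument, just as b yields
  \<open>b \<cdot> \<Gamma>m (idm X) \<alpha>\<close> in a general algebra of the law.\<close>

definition free_op :: "'o \<Rightarrow> 'm \<Rightarrow> 'm" where
  "free_op X c = Sm (copair C (copair C c (idm X)) (idm X)) \<cdot> d_hat X X"

lemma lift_alg_eq:
  "X \<in> Ob C \<Longrightarrow> c \<in> hom C (\<Gamma>o X (So X)) X \<Longrightarrow> lift_alg X c = free_op X c \<cdot> \<Gamma>m (idm (So X)) (Mu S X)"
  using d_hat_simps[of X X] by (simp add: lift_alg_def free_op_def hom_iff)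

context
  fixes X c assumes X [simp]: "X \<in> Ob C" and c: "c \<in> hom C (\<Gamma>o X (So X)) X"
begin

lemma c_simps: "c \<in> Mor C" "Dom C c = \<Gamma>o X (So X)" "Cod C c = X"
  using c by (auto simp: hom_iff)

lemma free_op_simps:
  "free_op X c \<in> Mor C" "Dom C (free_op X c) = \<Gamma>o (So X) (So X)" "Cod C (free_op X c) = So X"
  using d_hat_simps[of X X] c_simps by (auto simp: free_op_def)

lemma free_op_Eta: "free_op X c \<cdot> \<Gamma>m (Eta S X) (idm (So X)) = Eta S X \<cdot> c"
  using d_hat_simps[of X X] d_hat_Eta[of X X] c_simps by (simp add: free_op_def)

text \<open>The recursion for \<open>d_hat\<close> with Y = X, pushed forward along [c,id,id]. The
  unit left in the last place turns into an identity because \<open>h1\<close> feeds that place a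
  term in SX, which the multiplication then returns unchanged.\<close>

lemma free_op_Mu_e:
  "free_op X c \<cdot> \<Gamma>m (Mu S X \<cdot> e (So X)) (idm (So X)) =
    Mu S X \<cdot> Sm (copair C (copair C (free_op X c \<cdot> \<Gamma>m (idm (So X)) (Mu S X)) (idm (So X))) (idm (So X))) \<cdot> d (So X, So X)"
proof -
  let ?k = "copair C (copair C c (idm X)) (idm X)"
  let ?Z = "\<Gamma>o X (So X) \<oplus> X \<oplus> X"
  note [simp] = c_simps free_op_simps d_hat_simps[of X X] h_tr_simps[of "So X" X]
  have "free_op X c \<cdot> \<Gamma>m (Mu S X \<cdot> e (So X)) (idm (So X)) =
      Sm ?k \<cdot> Mu S ?Z \<cdot> Sm (copair C (copair C (d_hat X X) (Sm (in1 C (\<Gamma>o X (So X) \<oplus> X) X \<cdot> in2 C (\<Gamma>o X (So X)) X)))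
        (Eta S ?Z \<cdot> in2 C (\<Gamma>o X (So X) \<oplus> X) X)) \<cdot> h1 (So X) X"
    using d_hat_Mu_e[of X X] by (simp add: free_op_def)
  also have "\<dots> = Mu S X \<cdot> Sm (copair C (copair C (free_op X c) (idm (So X))) (Eta S X)) \<cdot> h1 (So X) X"
    by (simp add: free_op_def)
  also have "\<dots> = Mu S X \<cdot> Sm (copair C (copair C (free_op X c \<cdot> \<Gamma>m (idm (So X)) (Mu S X)) (idm (So X))) (idm (So X))) \<cdot> d (So X, So X)"
    by (simp add: h1_eq)
  finally show ?thesis .
qed

lemma law_algebra_free_op: "law_algebra (So X) (Mu S X) (free_op X c)"
  unfolding law_algebra_def using S_free_algebra[of X] free_op_Mu_e free_op_simps by (simp add: hom_iff)

text \<open>Thus free_op X c makes SX the free algebra of the law on (X, c).\<close>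

lemma free_op_hom:
  assumes B: "law_algebra B \<beta> b" and f: "f \<in> hom C X B"
    and fc: "f \<cdot> c = b \<cdot> \<Gamma>m f (\<beta> \<cdot> Sm f)"
  shows "(\<beta> \<cdot> Sm f) \<cdot> free_op X c = b \<cdot> \<Gamma>m (\<beta> \<cdot> Sm f) (\<beta> \<cdot> Sm f)"
proof -
  have \<beta>: "monad_algebra C S B \<beta>" and b: "b \<in> hom C (\<Gamma>o B B) B"
    and law: "b \<cdot> \<Gamma>m (\<beta> \<cdot> e B) (idm B) =
      \<beta> \<cdot> Sm (copair C (copair C (b \<cdot> \<Gamma>m (idm B) \<beta>) (idm B)) (idm B)) \<cdot> d (B, B)"
    using B by (auto simp: law_algebra_def)
  note \<beta>s = monad_algebraD[OF \<beta>]
  note [simp] = c_simps free_op_simps \<beta>s(1-4) S_algebra_pre[OF \<beta>]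
  have bs [simp]: "b \<in> Mor C" "Dom C b = \<Gamma>o B B" "Cod C b = B"
    and fs [simp]: "f \<in> Mor C" "Dom C f = X" "Cod C f = B"
    using b f by (auto simp: hom_iff)
  define k where "k = \<beta> \<cdot> Sm f"
  have k [simp]: "k \<in> Mor C" "Dom C k = So X" "Cod C k = B"
    by (simp_all add: k_def)
  have k_Mu: "k \<cdot> Mu S X = \<beta> \<cdot> Sm k"
    by (simp add: k_def)
  have k_Mu': "k \<cdot> Mu S X \<cdot> x = \<beta> \<cdot> Sm k \<cdot> x" if "x \<in> Mor C" "Cod C x = So (So X)" for x
    using Cmp_pre[OF k_Mu, of x] that by simp
  have k_Eta: "k \<cdot> Eta S X = f"
    by (simp add: k_def)
  have k_Eta': "k \<cdot> Eta S X \<cdot> x = f \<cdot> x" if "x \<in> Mor C" "Cod C x = X" for x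
    using Cmp_pre[OF k_Eta, of x] that by simp
  \<comment> \<open>The two sides to be compared are two solutions of one recursion along k. They
    agree on generators, \<open>free_op_Eta\<close> reducing the first to c and \<open>fc\<close>
    matching it with the second.\<close>
  define g where "g i = (if i then k \<cdot> free_op X c else b \<cdot> \<Gamma>m k k)" for i
  have "g True = g False"
  proof (rule recursion_unique[OF X \<beta>])
    show "k \<in> hom C (So X) B" by (simp add: hom_iff)
    show "k \<cdot> Mu S X = \<beta> \<cdot> Sm k" by (rule k_Mu)
    show "g i \<in> hom C (\<Gamma>o (So X) (So X)) B" for i by (simp add: g_def hom_iff)
    have "(k \<cdot> free_op X c) \<cdot> \<Gamma>m (Mu S X \<cdot> e (So X)) (idm (So X)) =
        \<beta> \<cdot> Sm (copair C (copair C ((k \<cdot> free_op X c) \<cdot> \<Gamma>m (idm (So X)) (Mu S X)) k) k) \<cdot> d (So X, So X)"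
      by (simp add: free_op_Mu_e k_Mu')
    moreover have "(b \<cdot> \<Gamma>m k k) \<cdot> \<Gamma>m (Mu S X \<cdot> e (So X)) (idm (So X)) =
        \<beta> \<cdot> Sm (copair C (copair C ((b \<cdot> \<Gamma>m k k) \<cdot> \<Gamma>m (idm (So X)) (Mu S X)) k) k) \<cdot> d (So X, So X)"
    proof -
      \<comment> \<open>As k is a morphism of \<Sigma>-algebras, the law in B precomposed with
        \<Gamma>(\<Sigma>k,k) becomes, by naturality of d, the recursion for
        \<open>b \<cdot> \<Gamma>m k k\<close>.\<close>
      have "k \<cdot> Mu S X \<cdot> e (So X) = (\<beta> \<cdot> e B) \<cdot> amap Sig k"
        by (simp add: k_Mu' e_nat)
      then have "(b \<cdot> \<Gamma>m k k) \<cdot> \<Gamma>m (Mu S X \<cdot> e (So X)) (idm (So X)) =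
          (b \<cdot> \<Gamma>m (\<beta> \<cdot> e B) (idm B)) \<cdot> \<Gamma>m (amap Sig k) k"
        by simp
      also have "\<dots> = \<beta> \<cdot> Sm (copair C (copair C ((b \<cdot> \<Gamma>m k k) \<cdot> \<Gamma>m (idm (So X)) (Mu S X)) k) k) \<cdot> d (So X, So X)"
        unfolding law by (simp add: d_nat msum_def k_Mu)
      finally show ?thesis .
    qed
    ultimately show "g i \<cdot> \<Gamma>m (Mu S X \<cdot> e (So X)) (idm (So X)) =
        \<beta> \<cdot> Sm (copair C (copair C (g i \<cdot> \<Gamma>m (idm (So X)) (Mu S X)) k) k) \<cdot> d (So X, So X)" for i
      by (cases i) (simp_all only: g_def if_True if_False)
    have "(k \<cdot> free_op X c) \<cdot> \<Gamma>m (Eta S X) (idm (So X)) = (b \<cdot> \<Gamma>m k k) \<cdot> \<Gamma>m (Eta S X) (idm (So X))"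
      using fc by (simp add: free_op_Eta k_Eta k_Eta' flip: k_def)
    then show "g i \<cdot> \<Gamma>m (Eta S X) (idm (So X)) = g j \<cdot> \<Gamma>m (Eta S X) (idm (So X))" for i j
      by (cases i; cases j) (simp_all only: g_def if_True if_False)
  qed
  then show ?thesis by (simp add: g_def k_def)
qed

end

end


section \<open>Algebras of the composite monad\<close>

locale composite_law = structural_law C Sig Gam S e d U
  for C :: "('o, 'm) cat" (structure) and Sig Gam S e d and U :: "'u itself" +
  fixes T :: "('o, 'm) mnd" and t :: "'o \<Rightarrow> 'm"
  assumes T_free: "free_monad C GS T t"
begin

lemma GS: "is_functor C C GS"
  unfolding is_functor_def by (auto simp: GS_def hom_iff)

sublocale T: cat_monad C T
  by unfold_locales (use T_free in \<open>simp add: free_monad_def\<close>)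

lemma t_simps [simp]:
  assumes "X \<in> Ob C"
  shows "t X \<in> Mor C" "Dom C (t X) = \<Gamma>o X (So X)" "Cod C (t X) = omap T X"
proof -
  have "nat_trans C C GS T t" using T_free by (simp add: free_monad_def)
  from nat_trans_simps[OF category this assms]
  show "t X \<in> Mor C" "Dom C (t X) = \<Gamma>o X (So X)" "Cod C (t X) = omap T X"
    by (auto simp: GS_def)
qed

lemma t_nat:
  assumes "f \<in> Mor C" "Dom C f = X"
  shows "amap T f \<cdot> t X = t (Cod C f) \<cdot> \<Gamma>m f (Sm f)"
    and "x \<in> Mor C \<Longrightarrow> Cod C x = \<Gamma>o X (So X) \<Longrightarrow> amap T f \<cdot> t X \<cdot> x = t (Cod C f) \<cdot> \<Gamma>m f (Sm f) \<cdot> x"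
proof -
  have X: "X \<in> Ob C" using assms by auto
  have "nat_trans C C GS T t" using T_free by (simp add: free_monad_def)
  from nat_trans_comm[OF this assms refl]
  show *: "amap T f \<cdot> t X = t (Cod C f) \<cdot> \<Gamma>m f (Sm f)" by (simp add: GS_def)
  show "x \<in> Mor C \<Longrightarrow> Cod C x = \<Gamma>o X (So X) \<Longrightarrow> amap T f \<cdot> t X \<cdot> x = t (Cod C f) \<cdot> \<Gamma>m f (Sm f) \<cdot> x"
    using Cmp_pre[OF *, of x] assms X by simp
qed

lemma T_free_algebra: "X \<in> Ob C \<Longrightarrow> monad_algebra C T (omap T X) (Mu T X)"
  by (simp add: monad_algebra_def hom_iff)

lemma T_hom:
  assumes "monad_algebra C T X \<alpha>" "monad_algebra C T Y \<beta>" "f \<in> hom C X Y"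
    and "f \<cdot> \<alpha> \<cdot> t X = \<beta> \<cdot> t Y \<cdot> \<Gamma>m f (Sm f)"
  shows "f \<cdot> \<alpha> = \<beta> \<cdot> amap T f"
  using free_algebra_hom[OF GS T_free assms(1-3)] assms(4) by (simp add: GS_def)

text \<open>The lifting of a T-algebra along S. It is needed for arbitrary T-algebras, although
  \<open>dist_law\<close> is built from its values at free ones.\<close>

definition lift :: "'o \<Rightarrow> 'm \<Rightarrow> 'm" where
  "lift X \<beta> = induced_alg C T t (So X) (lift_alg X (\<beta> \<cdot> t X))"

lemma op_hom: "monad_algebra C T X \<beta> \<Longrightarrow> \<beta> \<cdot> t X \<in> hom C (\<Gamma>o X (So X)) X"
  using monad_algebraD(1-4)[of C T X \<beta>] by (simp add: hom_iff)

lemma lift: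
  assumes "monad_algebra C T X \<beta>"
  shows "monad_algebra C T (So X) (lift X \<beta>)"
    and "lift X \<beta> \<cdot> t (So X) = free_op X (\<beta> \<cdot> t X) \<cdot> \<Gamma>m (idm (So X)) (Mu S X)"
proof -
  note [simp] = monad_algebraD(1-4)[OF assms] free_op_simps[OF monad_algebraD(1)[OF assms] op_hom[OF assms]]
  have "lift_alg X (\<beta> \<cdot> t X) = free_op X (\<beta> \<cdot> t X) \<cdot> \<Gamma>m (idm (So X)) (Mu S X)"
    by (rule lift_alg_eq[OF _ op_hom[OF assms]]) simp
  then show "monad_algebra C T (So X) (lift X \<beta>)"
    "lift X \<beta> \<cdot> t (So X) = free_op X (\<beta> \<cdot> t X) \<cdot> \<Gamma>m (idm (So X)) (Mu S X)"
    unfolding lift_def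
    using induced_alg[OF GS T_free, of "So X" "lift_alg X (\<beta> \<cdot> t X)"]
    by (simp_all add: GS_def hom_iff)
qed

text \<open>Freeness of SX restated for T-algebras: the S-algebra extension of a T-morphism into an
  algebra of the law is again a T-morphism. By algebraic freeness of T it suffices to compare along
  t, where \<open>free_op_hom\<close> applies.\<close>

lemma lift_law_algebra_hom:
  assumes \<alpha>: "law_algebra B \<alpha> b" and \<beta>: "monad_algebra C T B \<beta>" "\<beta> \<cdot> t B = b \<cdot> \<Gamma>m (idm B) \<alpha>"
    and \<gamma>: "monad_algebra C T X \<gamma>" and f: "f \<in> hom C X B" "f \<cdot> \<gamma> = \<beta> \<cdot> amap T f"
  shows "(\<alpha> \<cdot> Sm f) \<cdot> lift X \<gamma> = \<beta> \<cdot> amap T (\<alpha> \<cdot> Sm f)"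
proof (rule T_hom[OF lift(1)[OF \<gamma>] \<beta>(1)])
  have \<alpha>S: "monad_algebra C S B \<alpha>" and b: "b \<in> Mor C" "Dom C b = \<Gamma>o B B" "Cod C b = B"
    using \<alpha> by (auto simp: law_algebra_def hom_iff)
  note [simp] = monad_algebraD(1-4)[OF \<alpha>S] S_algebra_pre[OF \<alpha>S] monad_algebraD(1-4)[OF \<beta>(1)]
    monad_algebraD(1-4)[OF \<gamma>] b
  have fs [simp]: "f \<in> Mor C" "Dom C f = X" "Cod C f = B" using f(1) by (auto simp: hom_iff)
  note [simp] = free_op_simps[OF monad_algebraD(1)[OF \<gamma>] op_hom[OF \<gamma>]] monad_algebraD(2-4)[OF lift(1)[OF \<gamma>]]
  show "\<alpha> \<cdot> Sm f \<in> hom C (So X) B" by (simp add: hom_iff)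
  have \<beta>t: "\<beta> \<cdot> t B \<cdot> x = b \<cdot> \<Gamma>m (idm B) \<alpha> \<cdot> x" if "x \<in> Mor C" "Cod C x = \<Gamma>o B (So B)" for x
    using Cmp_pre[OF \<beta>(2), of x] that by simp
  have "f \<cdot> \<gamma> \<cdot> t X = \<beta> \<cdot> amap T f \<cdot> t X"
    using Cmp_pre[OF f(2), of "t X"] by simp
  also have "\<dots> = b \<cdot> \<Gamma>m f (\<alpha> \<cdot> Sm f)"
    by (simp add: t_nat \<beta>t)
  finally have "(\<alpha> \<cdot> Sm f) \<cdot> free_op X (\<gamma> \<cdot> t X) = b \<cdot> \<Gamma>m (\<alpha> \<cdot> Sm f) (\<alpha> \<cdot> Sm f)"
    using free_op_hom[OF monad_algebraD(1)[OF \<gamma>] op_hom[OF \<gamma>] \<alpha> f(1)] by simp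
  then have "(\<alpha> \<cdot> Sm f) \<cdot> lift X \<gamma> \<cdot> t (So X) =
      (b \<cdot> \<Gamma>m (\<alpha> \<cdot> Sm f) (\<alpha> \<cdot> Sm f)) \<cdot> \<Gamma>m (idm (So X)) (Mu S X)"
    unfolding lift(2)[OF \<gamma>] by (subst Cmp_assoc[symmetric]) simp_all
  also have "\<dots> = \<beta> \<cdot> t B \<cdot> \<Gamma>m (\<alpha> \<cdot> Sm f) (Sm (\<alpha> \<cdot> Sm f))"
    by (simp add: \<beta>t)
  finally show "(\<alpha> \<cdot> Sm f) \<cdot> lift X \<gamma> \<cdot> t (So X) = \<beta> \<cdot> t B \<cdot> \<Gamma>m (\<alpha> \<cdot> Sm f) (Sm (\<alpha> \<cdot> Sm f))" .
qed

text \<open>Along t this reduces to \<open>free_op_Eta\<close>, because the multiplication inside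
  the lifted operation cancels the unit inserted in its second argument.\<close>

lemma lift_Eta:
  assumes \<beta>: "monad_algebra C T X \<beta>"
  shows "Eta S X \<cdot> \<beta> = lift X \<beta> \<cdot> amap T (Eta S X)"
proof (rule T_hom[OF \<beta> lift(1)[OF \<beta>]])
  note [simp] = monad_algebraD(1-4)[OF \<beta>] monad_algebraD(2-4)[OF lift(1)[OF \<beta>]]
  note op = monad_algebraD(1)[OF \<beta>] op_hom[OF \<beta>]
  note [simp] = free_op_simps[OF op]
  show "Eta S X \<in> hom C X (So X)" by (simp add: hom_iff)
  have "lift X \<beta> \<cdot> t (So X) \<cdot> \<Gamma>m (Eta S X) (Sm (Eta S X)) = free_op X (\<beta> \<cdot> t X) \<cdot> \<Gamma>m (Eta S X) (idm (So X))"
    using Cmp_pre[OF lift(2)[OF \<beta>], of "\<Gamma>m (Eta S X) (Sm (Eta S X))"] by simp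
  then show "Eta S X \<cdot> \<beta> \<cdot> t X = lift X \<beta> \<cdot> t (So X) \<cdot> \<Gamma>m (Eta S X) (Sm (Eta S X))"
    using free_op_Eta[OF op] by simp
qed

text \<open>An instance of freeness: the target is the algebra of the law on SY, and the T-morphism
  to be extended is f followed by the unit. Its S-algebra extension is \<open>Sm f\<close>.\<close>

lemma lift_hom:
  assumes \<beta>: "monad_algebra C T X \<beta>" and \<gamma>: "monad_algebra C T Y \<gamma>"
    and f: "f \<in> hom C X Y" "f \<cdot> \<beta> = \<gamma> \<cdot> amap T f"
  shows "Sm f \<cdot> lift X \<beta> = lift Y \<gamma> \<cdot> amap T (Sm f)"
proof -
  note [simp] = monad_algebraD(1-4)[OF \<beta>] monad_algebraD(1-4)[OF \<gamma>] monad_algebraD(2-4)[OF lift(1)[OF \<gamma>]]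
  have fs [simp]: "f \<in> Mor C" "Dom C f = X" "Cod C f = Y" using f(1) by (auto simp: hom_iff)
  have "(Eta S Y \<cdot> f) \<cdot> \<beta> = Eta S Y \<cdot> \<gamma> \<cdot> amap T f"
    using f(2) by simp
  also have "\<dots> = lift Y \<gamma> \<cdot> amap T (Eta S Y \<cdot> f)"
    using Cmp_pre[OF lift_Eta[OF \<gamma>], of "amap T f"] by simp
  finally have "(Mu S Y \<cdot> Sm (Eta S Y \<cdot> f)) \<cdot> lift X \<beta> = lift Y \<gamma> \<cdot> amap T (Mu S Y \<cdot> Sm (Eta S Y \<cdot> f))"
    by (intro lift_law_algebra_hom[OF law_algebra_free_op[OF _ op_hom[OF \<gamma>]] lift[OF \<gamma>] \<beta>])
      (simp_all add: hom_iff)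
  then show ?thesis by simp
qed

lemma dist_law_eq: "dist_law T t X = lift (omap T X) (Mu T X) \<cdot> amap T (Sm (Eta T X))"
  by (simp add: dist_law_def lift_def)

context
  fixes X assumes X [simp]: "X \<in> Ob C"
begin

lemma lift_T_simps [simp]:
  "lift (omap T X) (Mu T X) \<in> Mor C" "Dom C (lift (omap T X) (Mu T X)) = omap T (So (omap T X))"
  "Cod C (lift (omap T X) (Mu T X)) = So (omap T X)"
  using monad_algebraD(2-4)[OF lift(1)[OF T_free_algebra[OF X]]] by simp_all

lemma dist_law_simps [simp]:
  "dist_law T t X \<in> Mor C" "Dom C (dist_law T t X) = omap T (So X)" "Cod C (dist_law T t X) = So (omap T X)"
  by (simp_all add: dist_law_eq)

lemma dist_law_Eta_T:
  shows "dist_law T t X \<cdot> Eta T (So X) = Sm (Eta T X)"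
    and "x \<in> Mor C \<Longrightarrow> Cod C x = So X \<Longrightarrow> dist_law T t X \<cdot> Eta T (So X) \<cdot> x = Sm (Eta T X) \<cdot> x"
proof -
  have 1: "lift (omap T X) (Mu T X) \<cdot> Eta T (So (omap T X)) = idm (So (omap T X))"
    using monad_algebraD(5)[OF lift(1)[OF T_free_algebra[OF X]]] .
  show *: "dist_law T t X \<cdot> Eta T (So X) = Sm (Eta T X)"
    using Cmp_pre[OF 1, of "Sm (Eta T X)"] by (simp add: dist_law_eq)
  show "x \<in> Mor C \<Longrightarrow> Cod C x = So X \<Longrightarrow> dist_law T t X \<cdot> Eta T (So X) \<cdot> x = Sm (Eta T X) \<cdot> x"
    using Cmp_pre[OF *, of x] by simp
qed

lemma dist_law_amap_Eta: "dist_law T t X \<cdot> amap T (Eta S X) = Eta S (omap T X)"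
proof -
  have "lift (omap T X) (Mu T X) \<cdot> amap T (Eta S (omap T X)) \<cdot> amap T (Eta T X) =
      (Eta S (omap T X) \<cdot> Mu T X) \<cdot> amap T (Eta T X)"
    using Cmp_pre[OF lift_Eta[OF T_free_algebra[OF X], symmetric], of "amap T (Eta T X)"] by simp
  then show ?thesis by (simp add: dist_law_eq)
qed

text \<open>The multiplication of T is a T-morphism between free algebras, so S carries it to a
  morphism of lifted algebras and it can be moved past \<open>lift\<close>, where it cancels the
  unit in \<open>dist_law\<close>. The multiplication of ST thereby turns into that of S after a
  lifted structure.\<close>

lemma Mu_dist_law:
  "Sm (Mu T X) \<cdot> dist_law T t (omap T X) = lift (omap T X) (Mu T X)"
proof -
  have TX: "omap T X \<in> Ob C" by simp
  have h: "Sm (Mu T X) \<cdot> lift (omap T (omap T X)) (Mu T (omap T X)) = lift (omap T X) (Mu T X) \<cdot> amap T (Sm (Mu T X))"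
    by (rule lift_hom) (simp_all add: T_free_algebra hom_iff)
  note [simp] = monad_algebraD(2-4)[OF lift(1)[OF T_free_algebra[OF TX]]]
  show ?thesis
    using Cmp_pre[OF h, of "amap T (Sm (Eta T (omap T X)))"] by (simp add: dist_law_eq)
qed

end

section \<open>Splitting an algebra of the composite monad\<close>

lemma ST_simps [simp]:
  "omap (ST_mnd T t) X = So (omap T X)" "amap (ST_mnd T t) f = Sm (amap T f)"
  "Eta (ST_mnd T t) X = Eta S (omap T X) \<cdot> Eta T X"
  "Mu (ST_mnd T t) X = Mu S (omap T X) \<cdot> Sm (Sm (Mu T X)) \<cdot> Sm (dist_law T t (omap T X))"
  by (simp_all add: ST_mnd_def)

text \<open>The common normal form of both kinds of algebra: (\<alpha> \<cdot> e X, b) is the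
  algebra of the law and \<alpha> \<cdot> S\<beta> the algebra of ST. Each of the two determines the
  whole triple.\<close>

definition decomposition :: "'o \<Rightarrow> 'm \<Rightarrow> 'm \<Rightarrow> 'm \<Rightarrow> bool" where
  "decomposition X \<alpha> b \<beta> \<longleftrightarrow>
    law_algebra X \<alpha> b \<and> monad_algebra C T X \<beta> \<and> \<beta> \<cdot> t X = b \<cdot> \<Gamma>m (idm X) \<alpha>"

lemma decompositionD:
  assumes "decomposition X \<alpha> b \<beta>"
  shows "law_algebra X \<alpha> b" "monad_algebra C S X \<alpha>" "monad_algebra C T X \<beta>" "\<beta> \<cdot> t X = b \<cdot> \<Gamma>m (idm X) \<alpha>"
    "b \<in> Mor C" "Dom C b = \<Gamma>o X X" "Cod C b = X"
  using assms by (auto simp: decomposition_def law_algebra_def hom_iff)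

text \<open>After \<open>Mu_dist_law\<close>, associativity amounts to \<alpha> \<cdot> S\<beta>
  being a T-morphism from the lifted free algebra to (X, \<beta>). This is
  \<open>lift_law_algebra_hom\<close> for the T-morphism \<beta> itself.\<close>

lemma ST_algebra_of_decomposition:
  assumes "decomposition X \<alpha> b \<beta>"
  shows "monad_algebra C (ST_mnd T t) X (\<alpha> \<cdot> Sm \<beta>)"
    and "(\<alpha> \<cdot> Sm \<beta>) \<cdot> Sm (Eta T X) = \<alpha>" "(\<alpha> \<cdot> Sm \<beta>) \<cdot> Eta S (omap T X) = \<beta>"
    "\<beta> \<cdot> t X \<cdot> \<Gamma>m (idm X) (Eta S X) = b"
proof -
  note D = decompositionD[OF assms]
  note \<alpha> = monad_algebraD[OF D(2)] and \<beta> = monad_algebraD[OF D(3)]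
  note [simp] = \<alpha>(1-4) \<beta>(2-4) \<alpha>(5) \<beta>(5) D(5-7) S_algebra_pre[OF D(2)]
  show "(\<alpha> \<cdot> Sm \<beta>) \<cdot> Sm (Eta T X) = \<alpha>" "(\<alpha> \<cdot> Sm \<beta>) \<cdot> Eta S (omap T X) = \<beta>"
    by simp_all
  show "\<beta> \<cdot> t X \<cdot> \<Gamma>m (idm X) (Eta S X) = b"
    using Cmp_pre[OF D(4), of "\<Gamma>m (idm X) (Eta S X)"] by simp
  have \<beta>_hom: "\<alpha> \<cdot> Sm \<beta> \<cdot> lift (omap T X) (Mu T X) = \<beta> \<cdot> amap T (\<alpha> \<cdot> Sm \<beta>)"
    using lift_law_algebra_hom[OF D(1,3,4) T_free_algebra[OF \<alpha>(1)], of \<beta>] \<beta>(6) by (simp add: hom_iff)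
  have "(\<alpha> \<cdot> Sm \<beta>) \<cdot> Mu (ST_mnd T t) X = \<alpha> \<cdot> Sm (\<alpha> \<cdot> Sm \<beta> \<cdot> Sm (Mu T X) \<cdot> dist_law T t (omap T X))"
    by simp
  also have "\<dots> = \<alpha> \<cdot> Sm (\<beta> \<cdot> amap T (\<alpha> \<cdot> Sm \<beta>))"
    unfolding Mu_dist_law[OF \<alpha>(1)] \<beta>_hom ..
  finally show "monad_algebra C (ST_mnd T t) X (\<alpha> \<cdot> Sm \<beta>)"
    unfolding monad_algebra_def by (simp add: hom_iff)
qed

lemma decomposition_of_ST_algebra:
  assumes "monad_algebra C (ST_mnd T t) X x"
  defines "\<alpha> \<equiv> x \<cdot> Sm (Eta T X)" and "\<beta> \<equiv> x \<cdot> Eta S (omap T X)"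
  shows "decomposition X \<alpha> (\<beta> \<cdot> t X \<cdot> \<Gamma>m (idm X) (Eta S X)) \<beta>" "\<alpha> \<cdot> Sm \<beta> = x"
proof -
  note x = monad_algebraD[OF assms(1)]
  note [simp] = x(1,2,4)
  have [simp]: "Dom C x = So (omap T X)" using x(3) by simp
  note [simp] = dist_law_Eta_T[of "omap T X"] dist_law_amap_Eta[of "omap T X"]
    dist_law_simps[of "omap T X"]
  have TX: "omap T X \<in> Ob C" by simp
  let ?D = "dist_law T t (omap T X)"
  have assoc: "x \<cdot> Sm (amap T x) = x \<cdot> Mu S (omap T X) \<cdot> Sm (Sm (Mu T X) \<cdot> ?D)"
    using x(6) by simp
  \<comment> \<open>Associativity of x is an identity on STSTX, and y inserts units into it.
    Restricted to SSX it is associativity of \<alpha>, to TTX that of \<beta>, to STX the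
    factorisation of x, and to TSX the exchange of \<alpha> and \<beta>.\<close>
  have pre: "x \<cdot> Sm (amap T x) \<cdot> y = x \<cdot> Mu S (omap T X) \<cdot> Sm (Sm (Mu T X) \<cdot> ?D) \<cdot> y"
    if "y \<in> Mor C" "Cod C y = So (omap T (So (omap T X)))" for y
    using Cmp_pre[OF assoc, of y] that by simp
  have \<alpha> [simp]: "\<alpha> \<in> Mor C" "Dom C \<alpha> = So X" "Cod C \<alpha> = X"
    and \<beta> [simp]: "\<beta> \<in> Mor C" "Dom C \<beta> = omap T X" "Cod C \<beta> = X"
    by (simp_all add: \<alpha>_def \<beta>_def)
  have unit: "x \<cdot> Eta S (omap T X) \<cdot> Eta T X = idm X" using x(5) by simp
  have "\<alpha> \<cdot> Sm \<alpha> = \<alpha> \<cdot> Mu S X"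
    using pre[of "Sm (Eta T (So (omap T X)) \<cdot> Sm (Eta T X))"] by (simp add: \<alpha>_def)
  moreover have "\<alpha> \<cdot> Eta S X = idm X"
    using unit by (simp add: \<alpha>_def)
  ultimately have \<alpha>_alg: "monad_algebra C S X \<alpha>"
    by (simp add: monad_algebra_def hom_iff)
  have "\<beta> \<cdot> amap T \<beta> = \<beta> \<cdot> Mu T X"
    using pre[of "Eta S (omap T (So (omap T X))) \<cdot> amap T (Eta S (omap T X))"] by (simp add: \<beta>_def)
  moreover have "\<beta> \<cdot> Eta T X = idm X"
    using unit by (simp add: \<beta>_def)
  ultimately have \<beta>_alg: "monad_algebra C T X \<beta>"
    by (simp add: monad_algebra_def hom_iff)
  show x_eq: "\<alpha> \<cdot> Sm \<beta> = x"
    using pre[of "Sm (Eta T (So (omap T X)) \<cdot> Eta S (omap T X))"] by (simp add: \<alpha>_def \<beta>_def)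
  note [simp] = S_algebra_pre[OF \<alpha>_alg] monad_algebraD(5)[OF \<alpha>_alg]
  let ?\<Lambda> = "lift (omap T X) (Mu T X)"
  note \<Lambda> [simp] = lift_T_simps[OF x(1)] and lift_simps [simp] = monad_algebraD(2-4)[OF lift(1)[OF \<beta>_alg]]
  \<comment> \<open>The restriction to TSX. Once the distributive law is replaced by the lifting, it
    says that \<alpha> is a T-morphism from the lifted algebra SX to X.\<close>
  have "\<beta> \<cdot> amap T \<alpha> = x \<cdot> (Sm (Mu T X) \<cdot> ?D) \<cdot> amap T (Sm (Eta T X))"
    using pre[of "Eta S (omap T (So (omap T X))) \<cdot> amap T (Sm (Eta T X))"] by (simp add: \<alpha>_def \<beta>_def)
  also have "\<dots> = (\<alpha> \<cdot> Sm \<beta>) \<cdot> ?\<Lambda> \<cdot> amap T (Sm (Eta T X))"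
    unfolding Mu_dist_law[OF x(1)] x_eq ..
  also have "\<dots> = \<alpha> \<cdot> lift X \<beta>"
  proof -
    have "Sm \<beta> \<cdot> ?\<Lambda> = lift X \<beta> \<cdot> amap T (Sm \<beta>)"
      by (rule lift_hom[OF T_free_algebra[OF x(1)] \<beta>_alg])
        (use monad_algebraD(6)[OF \<beta>_alg] in \<open>simp_all add: hom_iff\<close>)
    from Cmp_pre[OF this, of "amap T (Sm (Eta T X))"] show ?thesis
      using monad_algebraD(5)[OF \<beta>_alg] by simp
  qed
  finally have \<alpha>_hom: "\<beta> \<cdot> amap T \<alpha> = \<alpha> \<cdot> lift X \<beta>" .
  define c where "c = \<beta> \<cdot> t X"
  have c: "c \<in> hom C (\<Gamma>o X (So X)) X" by (simp add: c_def hom_iff)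
  note [simp] = c_simps[OF x(1) c] free_op_simps[OF x(1) c]
  let ?\<phi> = "free_op X c"
  have c_hom: "\<alpha> \<cdot> ?\<phi> \<cdot> \<Gamma>m (idm (So X)) (Mu S X) = c \<cdot> \<Gamma>m \<alpha> (Sm \<alpha>)"
    using arg_cong[OF \<alpha>_hom, of "\<lambda>h. h \<cdot> t (So X)"] lift(2)[OF \<beta>_alg]
    by (simp add: t_nat c_def)
  have c_pre: "\<alpha> \<cdot> ?\<phi> \<cdot> \<Gamma>m (idm (So X)) (Mu S X) \<cdot> y = c \<cdot> \<Gamma>m \<alpha> (Sm \<alpha>) \<cdot> y"
    if "y \<in> Mor C" "Cod C y = \<Gamma>o (So X) (So (So X))" for y
    using arg_cong[OF c_hom, of "\<lambda>h. h \<cdot> y"] that by simp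
  \<comment> \<open>Restricting \<open>c_hom\<close> to generators in the first argument removes
    \<alpha> and \<open>?\<phi>\<close>. What is left says that c does not distinguish multiplying
    its second argument out from evaluating it by S\<alpha>.\<close>
  have "?\<phi> \<cdot> \<Gamma>m (Eta S X) (Mu S X) = Eta S X \<cdot> c \<cdot> \<Gamma>m (idm X) (Mu S X)"
    using Cmp_pre[OF free_op_Eta[OF x(1) c], of "\<Gamma>m (idm X) (Mu S X)"] by simp
  then have c_Mu: "c \<cdot> \<Gamma>m (idm X) (Mu S X) = c \<cdot> \<Gamma>m (idm X) (Sm \<alpha>)"
    using c_pre[of "\<Gamma>m (Eta S X) (idm (So (So X)))"] by simp
  define b where "b = c \<cdot> \<Gamma>m (idm X) (Eta S X)"
  have b [simp]: "b \<in> Mor C" "Dom C b = \<Gamma>o X X" "Cod C b = X"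
    by (simp_all add: b_def)
  \<comment> \<open>Insert the unit at SX in the second argument: one side collapses to c, and on
    the other naturality moves \<alpha> in front of the unit, leaving b.\<close>
  have c_b: "c = b \<cdot> \<Gamma>m (idm X) \<alpha>"
    using arg_cong[OF c_Mu, of "\<lambda>h. h \<cdot> \<Gamma>m (idm X) (Eta S (So X))"] by (simp add: b_def)
  have \<alpha>\<phi>: "\<alpha> \<cdot> ?\<phi> = c \<cdot> \<Gamma>m \<alpha> (idm (So X))"
    using c_pre[of "\<Gamma>m (idm (So X)) (Sm (Eta S X))"] by simp
  have \<alpha>\<phi>_pre: "\<alpha> \<cdot> ?\<phi> \<cdot> y = c \<cdot> \<Gamma>m \<alpha> (idm (So X)) \<cdot> y"
    if "y \<in> Mor C" "Cod C y = \<Gamma>o (So X) (So X)" for y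
    using arg_cong[OF \<alpha>\<phi>, of "\<lambda>h. h \<cdot> y"] that by simp
  have "b \<cdot> \<Gamma>m (\<alpha> \<cdot> e X) (idm X) = \<alpha> \<cdot> Sm (copair C (copair C c (idm X)) (idm X)) \<cdot> d (X, X)"
  proof -
    \<comment> \<open>Since e X is the multiplication after e at SX after \<Sigma> of the unit, the
      law at X is the image under \<alpha> of the recursion on SX, restricted to generators in both
      arguments.\<close>
    let ?y = "\<Gamma>m (amap Sig (Eta S X)) (Eta S X)"
    have "b \<cdot> \<Gamma>m (\<alpha> \<cdot> e X) (idm X) = \<alpha> \<cdot> (?\<phi> \<cdot> \<Gamma>m (Mu S X \<cdot> e (So X)) (idm (So X))) \<cdot> ?y"
      by (simp add: b_def \<alpha>\<phi>_pre e_nat)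
    also have "\<dots> = \<alpha> \<cdot> Sm (copair C (copair C c (idm X)) (idm X)) \<cdot> d (X, X)"
      unfolding free_op_Mu_e[OF x(1) c] by (simp add: d_nat msum_def free_op_Eta[OF x(1) c])
    finally show ?thesis .
  qed
  then have "law_algebra X \<alpha> b"
    unfolding law_algebra_def using \<alpha>_alg by (simp add: hom_iff flip: c_b)
  then have "decomposition X \<alpha> b \<beta>"
    unfolding decomposition_def using \<beta>_alg c_b by (simp add: c_def)
  then show "decomposition X \<alpha> (\<beta> \<cdot> t X \<cdot> \<Gamma>m (idm X) (Eta S X)) \<beta>"
    by (simp add: b_def c_def)
qed

text \<open>Both conditions amount to f being a morphism for \<alpha> and for \<beta>. The first
  gives this by algebraic freeness of S and T, the second by restricting along the two units; b is
  recovered from \<beta> by \<open>ST_algebra_of_decomposition\<close>.\<close>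

lemma decomposition_hom:
  assumes D: "decomposition X \<alpha> b \<beta>" and D': "decomposition Y \<alpha>' b' \<beta>'" and f: "f \<in> hom C X Y"
  shows "f \<cdot> \<alpha> \<cdot> e X = (\<alpha>' \<cdot> e Y) \<cdot> amap Sig f \<and> f \<cdot> b = b' \<cdot> \<Gamma>m f f \<longleftrightarrow>
    f \<cdot> \<alpha> \<cdot> Sm \<beta> = (\<alpha>' \<cdot> Sm \<beta>') \<cdot> Sm (amap T f)"
proof -
  note DD = decompositionD[OF D] decompositionD[OF D']
  note [simp] = monad_algebraD(1-4)[OF DD(2)] monad_algebraD(2-4)[OF DD(3)] DD(5-7)
    monad_algebraD(1-4)[OF DD(9)] monad_algebraD(2-4)[OF DD(10)] DD(12-14)
  have fs [simp]: "f \<in> Mor C" "Dom C f = X" "Cod C f = Y" using f by (auto simp: hom_iff)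
  note st = ST_algebra_of_decomposition[OF D] and st' = ST_algebra_of_decomposition[OF D']
  show ?thesis
  proof
    assume h: "f \<cdot> \<alpha> \<cdot> e X = (\<alpha>' \<cdot> e Y) \<cdot> amap Sig f \<and> f \<cdot> b = b' \<cdot> \<Gamma>m f f"
    then have \<alpha>: "f \<cdot> \<alpha> = \<alpha>' \<cdot> Sm f"
      by (intro free_algebra_hom[OF Sig S_free DD(2,9) f]) simp
    have "f \<cdot> \<beta> \<cdot> t X = (f \<cdot> b) \<cdot> \<Gamma>m (idm X) \<alpha>"
      using DD(4) by simp
    also have "\<dots> = (b' \<cdot> \<Gamma>m (idm Y) \<alpha>') \<cdot> \<Gamma>m f (Sm f)"
      using h \<alpha> by simp
    finally have \<beta>: "f \<cdot> \<beta> = \<beta>' \<cdot> amap T f"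
      by (intro T_hom[OF DD(3,10) f]) (simp flip: DD(11))
    then show "f \<cdot> \<alpha> \<cdot> Sm \<beta> = (\<alpha>' \<cdot> Sm \<beta>') \<cdot> Sm (amap T f)"
      using Cmp_pre[OF \<alpha>, of "Sm \<beta>"] by simp
  next
    assume h: "f \<cdot> \<alpha> \<cdot> Sm \<beta> = (\<alpha>' \<cdot> Sm \<beta>') \<cdot> Sm (amap T f)"
    have \<alpha>: "f \<cdot> \<alpha> = \<alpha>' \<cdot> Sm f"
    proof -
      have "f \<cdot> (\<alpha> \<cdot> Sm \<beta>) \<cdot> Sm (Eta T X) = ((\<alpha>' \<cdot> Sm \<beta>') \<cdot> Sm (Eta T Y)) \<cdot> Sm f"
        using arg_cong[OF h, of "\<lambda>g. g \<cdot> Sm (Eta T X)"] by simp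
      then show ?thesis unfolding st(2) st'(2) .
    qed
    have \<beta>: "f \<cdot> \<beta> = \<beta>' \<cdot> amap T f"
    proof -
      have "f \<cdot> (\<alpha> \<cdot> Sm \<beta>) \<cdot> Eta S (omap T X) = ((\<alpha>' \<cdot> Sm \<beta>') \<cdot> Eta S (omap T Y)) \<cdot> amap T f"
        using arg_cong[OF h, of "\<lambda>g. g \<cdot> Eta S (omap T X)"] by simp
      then show ?thesis unfolding st(3) st'(3) .
    qed
    have "f \<cdot> \<alpha> \<cdot> e X = (\<alpha>' \<cdot> e Y) \<cdot> amap Sig f"
      using Cmp_pre[OF \<alpha>, of "e X"] by (simp add: e_nat)
    moreover have "f \<cdot> b = (\<beta>' \<cdot> t Y \<cdot> \<Gamma>m (idm Y) (Eta S Y)) \<cdot> \<Gamma>m f f"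
      unfolding st(4)[symmetric]
      using Cmp_pre[OF \<beta>, of "t X \<cdot> \<Gamma>m (idm X) (Eta S X)"] by (simp add: t_nat)
    ultimately show "f \<cdot> \<alpha> \<cdot> e X = (\<alpha>' \<cdot> e Y) \<cdot> amap Sig f \<and> f \<cdot> b = b' \<cdot> \<Gamma>m f f"
      unfolding st'(4) by simp
  qed
qed

section \<open>The isomorphism of categories\<close>

definition to_ST :: "'o \<times> 'm \<times> 'm \<Rightarrow> 'o \<times> 'm" where
  "to_ST = (\<lambda>(X, a, b). let \<alpha> = induced_alg C S e X a in
     (X, \<alpha> \<cdot> Sm (induced_alg C T t X (b \<cdot> \<Gamma>m (idm X) \<alpha>))))"

definition of_ST :: "'o \<times> 'm \<Rightarrow> 'o \<times> 'm \<times> 'm" where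
  "of_ST = (\<lambda>(X, x). (X, (x \<cdot> Sm (Eta T X)) \<cdot> e X,
     (x \<cdot> Eta S (omap T X)) \<cdot> t X \<cdot> \<Gamma>m (idm X) (Eta S X)))"

lemma to_ST_decomposition:
  assumes "decomposition X \<alpha> b \<beta>"
  shows "to_ST (X, \<alpha> \<cdot> e X, b) = (X, \<alpha> \<cdot> Sm \<beta>)"
proof -
  note D = decompositionD[OF assms]
  have "induced_alg C T t X (b \<cdot> \<Gamma>m (idm X) \<alpha>) = \<beta>"
    by (rule induced_alg_eqI[OF GS T_free D(3,4)])
  then show ?thesis
    using L_algebra_of_law_algebra(2)[OF D(1)] by (simp add: to_ST_def Let_def)
qed

lemma of_ST_decomposition:
  assumes "decomposition X \<alpha> b \<beta>"
  shows "of_ST (X, \<alpha> \<cdot> Sm \<beta>) = (X, \<alpha> \<cdot> e X, b)"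
  unfolding of_ST_def using ST_algebra_of_decomposition(2-4)[OF assms] by simp

lemma L_algebra_decomposition:
  assumes "L_algebra X a b"
  obtains \<alpha> \<beta> where "decomposition X \<alpha> b \<beta>" "a = \<alpha> \<cdot> e X"
proof -
  let ?\<alpha> = "induced_alg C S e X a"
  have X: "X \<in> Ob C" "a \<in> hom C (omap Sig X) X" and \<alpha>: "law_algebra X ?\<alpha> b"
    using assms by (auto simp: L_algebra_iff)
  note ind = induced_alg[OF Sig S_free X]
  have "b \<cdot> \<Gamma>m (idm X) ?\<alpha> \<in> hom C (omap GS X) X"
    using \<alpha> monad_algebraD(1-4)[OF ind(1)] by (simp add: law_algebra_def hom_iff GS_def)
  from induced_alg[OF GS T_free X(1) this]
  show thesis using that \<alpha> ind(2) unfolding decomposition_def by metis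
qed

lemma ST_algebra_decomposition:
  assumes "monad_algebra C (ST_mnd T t) X x"
  obtains \<alpha> b \<beta> where "decomposition X \<alpha> b \<beta>" "x = \<alpha> \<cdot> Sm \<beta>"
  using decomposition_of_ST_algebra[OF assms] by metis

text \<open>Together with \<open>ST_hom\<close>, this describes the tagged morphisms of both
  categories in one shape, so that comparing morphisms reduces to an equivalence of predicates on
  the same underlying f.\<close>

definition L_hom :: "'o \<times> 'm \<times> 'm \<Rightarrow> 'm \<Rightarrow> 'o \<times> 'm \<times> 'm \<Rightarrow> bool" where
  "L_hom = (\<lambda>(X, a, b) f (Y, a', b'). L_algebra X a b \<and> L_algebra Y a' b' \<and> f \<in> hom C X Y \<and>
     f \<cdot> a = a' \<cdot> amap Sig f \<and> f \<cdot> b = b' \<cdot> \<Gamma>m f f)"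

definition ST_hom :: "'o \<times> 'm \<Rightarrow> 'm \<Rightarrow> 'o \<times> 'm \<Rightarrow> bool" where
  "ST_hom = (\<lambda>(X, a) f (Y, b). monad_algebra C (ST_mnd T t) X a \<and> monad_algebra C (ST_mnd T t) Y b \<and>
     f \<in> hom C X Y \<and> f \<cdot> a = b \<cdot> amap (ST_mnd T t) f)"

lemma decomposition_L_algebra: "decomposition X \<alpha> b \<beta> \<Longrightarrow> L_algebra X (\<alpha> \<cdot> e X) b"
  using L_algebra_of_law_algebra(1) decompositionD(1) by blast

lemma to_ST_bij:
  "A \<in> Ob L_alg \<Longrightarrow> to_ST A \<in> Ob (EM C (ST_mnd T t)) \<and> of_ST (to_ST A) = A \<and> fst (to_ST A) = fst A"
  "B \<in> Ob (EM C (ST_mnd T t)) \<Longrightarrow> of_ST B \<in> Ob L_alg \<and> to_ST (of_ST B) = B \<and> fst (of_ST B) = fst B"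
proof -
  assume "A \<in> Ob L_alg"
  then obtain X a b where A: "A = (X, a, b)" "L_algebra X a b" by (auto simp: L_alg_def)
  from L_algebra_decomposition[OF A(2)] obtain \<alpha> \<beta> where D: "decomposition X \<alpha> b \<beta>" "a = \<alpha> \<cdot> e X" .
  show "to_ST A \<in> Ob (EM C (ST_mnd T t)) \<and> of_ST (to_ST A) = A \<and> fst (to_ST A) = fst A"
    using ST_algebra_of_decomposition(1)[OF D(1)]
    by (simp add: A D(2) to_ST_decomposition[OF D(1)] of_ST_decomposition[OF D(1)] EM_def)
next
  assume "B \<in> Ob (EM C (ST_mnd T t))"
  then obtain X x where B: "B = (X, x)" "monad_algebra C (ST_mnd T t) X x" by (auto simp: EM_def)
  from ST_algebra_decomposition[OF B(2)] obtain \<alpha> b \<beta> where D: "decomposition X \<alpha> b \<beta>" "x = \<alpha> \<cdot> Sm \<beta>" .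
  show "of_ST B \<in> Ob L_alg \<and> to_ST (of_ST B) = B \<and> fst (of_ST B) = fst B"
    using decomposition_L_algebra[OF D(1)]
    by (simp add: B D(2) to_ST_decomposition[OF D(1)] of_ST_decomposition[OF D(1)] L_alg_def)
qed

lemma L_hom_iff_ST_hom:
  assumes "A \<in> Ob L_alg" "A' \<in> Ob L_alg"
  shows "L_hom A f A' \<longleftrightarrow> ST_hom (to_ST A) f (to_ST A')"
proof -
  obtain X a b X' a' b' where A: "A = (X, a, b)" "A' = (X', a', b')" "L_algebra X a b" "L_algebra X' a' b'"
    using assms by (auto simp: L_alg_def)
  from L_algebra_decomposition[OF A(3)] obtain \<alpha> \<beta> where D: "decomposition X \<alpha> b \<beta>" "a = \<alpha> \<cdot> e X" .
  from L_algebra_decomposition[OF A(4)] obtain \<alpha>' \<beta>' where D': "decomposition X' \<alpha>' b' \<beta>'" "a' = \<alpha>' \<cdot> e X'" .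
  note alg = ST_algebra_of_decomposition(1)[OF D(1)] ST_algebra_of_decomposition(1)[OF D'(1)]
    decomposition_L_algebra[OF D(1)] decomposition_L_algebra[OF D'(1)]
  show ?thesis
    using alg decomposition_hom[OF D(1) D'(1), of f]
    unfolding A(1,2) D(2) D'(2) to_ST_decomposition[OF D(1)] to_ST_decomposition[OF D'(1)] L_hom_def ST_hom_def
    by simp blast
qed

theorem L_alg_isomorphic_EM: "isomorphic_over L_alg forget (EM C (ST_mnd T t)) forget"
proof -
  let ?E = "EM C (ST_mnd T t)"
  have MorL: "Mor L_alg = {(A, f, A'). L_hom A f A'}"
    by (auto simp: L_alg_def L_hom_def)
  have MorE: "Mor ?E = {(B, f, B'). ST_hom B f B'}"
    by (auto simp: EM_def ST_hom_def)
  have ObL: "A \<in> Ob L_alg \<and> A' \<in> Ob L_alg" if "L_hom A f A'" for A f A'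
    using that by (cases A; cases A') (auto simp: L_alg_def L_hom_def)
  have ObE: "B \<in> Ob ?E \<and> B' \<in> Ob ?E" if "ST_hom B f B'" for B f B'
    using that by (cases B; cases B') (auto simp: EM_def ST_hom_def)
  have Fhom: "ST_hom (to_ST A) f (to_ST A')" if "L_hom A f A'" for A f A'
    using that L_hom_iff_ST_hom ObL by blast
  have Ghom: "L_hom (of_ST B) f (of_ST B')" if "ST_hom B f B'" for B f B'
    using that L_hom_iff_ST_hom[of "of_ST B" "of_ST B'" f] to_ST_bij(2) ObE[OF that] by simp
  \<comment> \<open>Both functors change only the tags and keep the underlying morphism, so
    identities, composition and the forgetful functors are respected at once.\<close>
  define F where "F = \<lparr>omap = to_ST, amap = (\<lambda>(A, f :: 'm, A'). (to_ST A, f, to_ST A'))\<rparr>"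
  define G where "G = \<lparr>omap = of_ST, amap = (\<lambda>(B, f :: 'm, B'). (of_ST B, f, of_ST B'))\<rparr>"
  have L: "Dom L_alg = (\<lambda>(A, f, B). A)" "Cod L_alg = (\<lambda>(A, f, B). B)" "Ide L_alg = (\<lambda>A. (A, idm (fst A), A))"
    "Cmp L_alg = (\<lambda>(B', g, B) (A, f, A'). (A, g \<cdot> f, B))"
    by (simp_all add: L_alg_def)
  have E: "Dom ?E = (\<lambda>(A, f, B). A)" "Cod ?E = (\<lambda>(A, f, B). B)" "Ide ?E = (\<lambda>A. (A, idm (fst A), A))"
    "Cmp ?E = (\<lambda>(B', g, B) (A, f, A'). (A, g \<cdot> f, B))"
    by (simp_all add: EM_def)
  have "is_functor L_alg ?E F"
    unfolding is_functor_def by (auto simp: F_def hom_iff MorL MorE L E to_ST_bij Fhom)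
  moreover have "is_functor ?E L_alg G"
    unfolding is_functor_def by (auto simp: G_def hom_iff MorL MorE L E to_ST_bij Ghom)
  moreover have "amap G (amap F f) = f" "amap forget (amap F f) = amap forget f" if "f \<in> Mor L_alg" for f
    using that ObL by (auto simp: MorL F_def G_def to_ST_bij forget_def)
  moreover have "amap F (amap G g) = g" if "g \<in> Mor ?E" for g
    using that ObE by (auto simp: MorE F_def G_def to_ST_bij)
  moreover have "omap G (omap F A) = A" "omap forget (omap F A) = omap forget A" if "A \<in> Ob L_alg" for A
    using that to_ST_bij by (auto simp: F_def G_def forget_def)
  moreover have "omap F (omap G B) = B" if "B \<in> Ob ?E" for B
    using that to_ST_bij by (auto simp: F_def G_def)
  ultimately show ?thesis
    unfolding isomorphic_over_def by blast
qed

end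

theorem proposition3p7:
  fixes C :: "('o, 'm) cat"
    and \<Sigma> :: "('o, 'm, 'o, 'm) func"
    and \<Gamma> :: "('o \<times> 'o, 'm \<times> 'm, 'o, 'm) func"
    and S T :: "('o, 'm) mnd"
    and \<eta>\<^sub>\<Sigma> t :: "'o \<Rightarrow> 'm"
    and d :: "'o \<times> 'o \<Rightarrow> 'm"
  assumes "universe TYPE('u)"
    and "locally_finitely_presentable TYPE('u) C"
    and "law.simple_structural_law C \<Sigma> \<Gamma> S \<eta>\<^sub>\<Sigma> d TYPE('u)"
    and "free_monad C (law.GS \<Gamma> S) T t"
  shows "isomorphic_over
           (law.L_alg C \<Sigma> \<Gamma> S \<eta>\<^sub>\<Sigma> d) forget
           (EM C (law.ST_mnd C \<Sigma> \<Gamma> S \<eta>\<^sub>\<Sigma> d T t)) forget"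
proof -
  interpret composite_law C \<Sigma> \<Gamma> S \<eta>\<^sub>\<Sigma> d "TYPE('u)" T t
    using assms by unfold_locales (auto simp: locally_finitely_presentable_def)
  show ?thesis by (rule L_alg_isomorphic_EM)
qed

end
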